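(* Let $\mathbb{K}$ be an integral domain which is a commutative $\mathbb{Q}$-algebra. Then $(\mathbb{K}\langle \mathrm{Cmp}_{\mathrm{con}}\rangle, \ast, \eta, \Delta, \epsilon)$ is a graded, connected and commutative Hopf algebra (graded by $\mathrm{weight}$), where $\ast$ is the two-parameter quasi-shuffle product, $\Delta$ the deconcatenation coproduct, $\epsilon$ the counit and $\eta$ the unit map. Its antipode $A:\mathbb{K}\langle \mathrm{Cmp}_{\mathrm{con}}\rangle\to \mathbb{K}\langle \mathrm{Cmp}_{\mathrm{con}}\rangle$ is the linear map with $A(\mathsf{e})=\mathsf{e}$ and, for every non-empty matrix composition $\mathbf{a}=\mathrm{diag}(\mathbf{v}_1,\ldots,\mathbf{v}_k)$ written via its unique factorization into connected compositions, $$A(\mathbf{a})=\sum_{(\iota_1,\ldots,\iota_\ell)\in\mathcal{C}(k)}(-1)^\ell\, \mathrm{diag}(\mathbf{v}_1,\ldots,\mathbf{v}_{\iota_1})\ast \mathrm{diag}(\mathbf{v}_{\iota_1+1},\ldots,\mathbf{v}_{\iota_1+\iota_2})\ast\cdots\ast\mathrm{diag}(\mathbf{v}_{\iota_1+\cdots+\iota_{\ell-1}+1},\ldots,\mathbf{v}_k),$$ where $\mathcal{C}(k)$ is the set of all tuples of positive integers $(\iota_1,\ldots,\iota_\ell)$, $\ell\geq 1$, with $\iota_1+\cdots+\iota_\ell=k$. In particular, the commutative $\mathbb{K}$-algebra $(\mathbb{K}\langle \mathrm{Cmp}_{\mathrm{con}}\rangle,+,\ast,0,\mathsf{e})$ is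 free (as a commutative algebra).
   Context: $\mathbb{N}=\{1,2,\ldots\}$, and $d\in\mathbb{N}$ is fixed. $(\mathfrak{M}_d,\star,\varepsilon)$ is the free commutative monoid generated by $d$ letters $\mathbf{1},\ldots,\mathbf{d}$. A non-empty matrix composition is a matrix $\mathbf{a}\in\mathfrak{M}_d^{m\times n}$ ($m,n\geq1$) such that no row and no column consists only of entries $\varepsilon$. $\mathrm{Cmp}$ is the set of all these matrices together with an additional element $\mathsf{e}$, the empty composition. $\mathrm{diag}(\mathbf{a},\mathbf{b})$ is the block diagonal matrix with blocks $\mathbf{a}$ (upper left) and $\mathbf{b}$ (lower right) and all other entries $\varepsilon$; blocks need not be square; $\mathrm{diag}(\mathsf{e},\mathbf{a})=\mathrm{diag}(\mathbf{a},\mathsf{e})=\mathbf{a}$. This is associative and $\mathrm{diag}(\mathbf{a}_1,\ldots,\mathbf{a}_k)$ denotes the iterated operation. A composition $\mathbf{a}\neq\mathsf{e}$ is connected if $\mathbf{a}=\mathrm{diag}(\mathbf{b},\mathbf{c})$ with $\mathbf b,\mathbf c\in\mathrm{Cmp}$ implies $\mathbf{b}=\mathsf{e}$ or $\mathbf{c}=\mathsf{e}$; $\mathrm{Cmp}_{\mathrm{con}}$ is the set of connected compositions. Every non-empty composition has a unique factorization $\mathbf{a}=\mathrm{diag}(\mathbf{v}_1,\ldots,\mathbf{v}_k)$ with $k\in\mathbb{N}$ and all $\mathbf{v}_i$ connected. $\mathbb{K}\langle\mathrm{Cmp}_{\mathrm{con}}\rangle$ denotes the free $\mathbb{K}$-module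 with basis $\mathrm{Cmp}$. It is graded by $\mathrm{weight}(\mathbf{a})=\sum_{i,j}\mathrm{weight}(\mathbf{a}_{i,j})$, where $\mathrm{weight}:\mathfrak{M}_d\to\mathbb{N}_0$ is the monoid homomorphism sending each letter to $1$ (and $\mathrm{weight}(\mathsf{e})=0$). Connected means that the weight-$0$ component is $\mathbb{K}\mathsf{e}$. For $m,s,j\in\mathbb{N}$, $\mathrm{qSh}(m,s;j)$ is the set of surjections $q:\{1,\ldots,m+s\}\to\{1,\ldots,j\}$ with $q(1)<\cdots<q(m)$ and $q(m+1)<\cdots<q(m+s)$. The two-parameter quasi-shuffle product $\ast$ is the bilinear map with $\mathsf{e}$ as neutral element and, for non-empty compositions $\mathbf{a}\in\mathfrak{M}_d^{m\times n}$, $\mathbf{b}\in\mathfrak{M}_d^{s\times t}$, $$\mathbf{a}\ast\mathbf{b}=\sum_{j,k\in\mathbb{N}}\ \sum_{p\in\mathrm{qSh}(m,s;j),\ q\in\mathrm{qSh}(n,t;k)}\mathbf{c}^{p,q},\qquad \mathbf{c}^{p,q}\in\mathfrak{M}_d^{j\times k},\quad \mathbf{c}^{p,q}_{x,y}=\bigstar_{u\in p^{-1}(x),\,v\in q^{-1}(y)}\mathrm{diag}(\mathbf{a},\mathbf{b})_{u,v}.$$ The deconcatenation coproduct is the linear map with $\Delta\mathbf{a}=\sum_{\mathrm{diag}(\mathbf{b},\mathbf{c})=\mathbf{a}}\mathbf{b}\otimes\mathbf{c}$, summing over all pairs $(\mathbf{b},\mathbf{c})\in\mathrm{Cmp}^2$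 (in particular $\Delta\mathsf{e}=\mathsf{e}\otimes\mathsf{e}$). The counit is the linear map with $\epsilon(\mathsf{e})=1$ and $\epsilon(\mathbf{a})=0$ for $\mathbf{a}\neq\mathsf{e}$; the unit is $\eta(1)=\mathsf{e}$. *)

theory Defs
  imports
    "HOL-Library.Multiset"
    "HOL-Library.FuncSet"
    "HOL-Library.Poly_Mapping"
    "Jordan_Normal_Form.Matrix"
begin

section \<open>Free modules and their tensor products\<close>

text \<open>The free \<open>'k\<close>-module with basis \<open>'b\<close> is the type \<open>'b \<Rightarrow>\<^sub>0 'k\<close> of finitely supported
  functions; \<open>basis b\<close> is the basis element belonging to \<open>b\<close>.\<close>

definition scl :: "'k::comm_ring_1 \<Rightarrow> ('b \<Rightarrow>\<^sub>0 'k) \<Rightarrow> ('b \<Rightarrow>\<^sub>0 'k)"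
  where "scl c x = Poly_Mapping.map ((*) c) x"

abbreviation basis :: "'b \<Rightarrow> ('b \<Rightarrow>\<^sub>0 'k::comm_ring_1)"
  where "basis b \<equiv> Poly_Mapping.single b 1"

lemma lookup_scl [simp]: "Poly_Mapping.lookup (scl c x) b = c * Poly_Mapping.lookup x b"
  by (simp add: scl_def Poly_Mapping.map.rep_eq when_def in_keys_iff)

interpretation fm: Modules.module "scl :: 'k::comm_ring_1 \<Rightarrow> ('b \<Rightarrow>\<^sub>0 'k) \<Rightarrow> ('b \<Rightarrow>\<^sub>0 'k)"
  by unfold_locales (auto intro!: poly_mapping_eqI simp: lookup_add algebra_simps)

definition lin :: "('b \<Rightarrow> ('c \<Rightarrow>\<^sub>0 'k)) \<Rightarrow> ('b \<Rightarrow>\<^sub>0 'k) \<Rightarrow> ('c \<Rightarrow>\<^sub>0 'k::comm_ring_1)"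
  where "lin f x = (\<Sum>b\<in>Poly_Mapping.keys x. scl (Poly_Mapping.lookup x b) (f b))"

definition bilin ::
    "('a \<Rightarrow> 'b \<Rightarrow> ('c \<Rightarrow>\<^sub>0 'k)) \<Rightarrow> ('a \<Rightarrow>\<^sub>0 'k) \<Rightarrow> ('b \<Rightarrow>\<^sub>0 'k) \<Rightarrow> ('c \<Rightarrow>\<^sub>0 'k::comm_ring_1)"
  where "bilin f x y = lin (\<lambda>a. lin (f a) y) x"

text \<open>The tensor product of the free modules with bases \<open>'a\<close> and \<open>'b\<close> is realised as the free
  module with basis \<open>'a \<times> 'b\<close>; see \<open>tensor_bilinear\<close> and \<open>tensor_universal\<close> below.\<close>

definition tensor :: "('a \<Rightarrow>\<^sub>0 'k) \<Rightarrow> ('b \<Rightarrow>\<^sub>0 'k) \<Rightarrow> ('a \<times> 'b \<Rightarrow>\<^sub>0 'k::comm_ring_1)"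
  where "tensor = bilin (\<lambda>a b. basis (a, b))"

definition tensor_map ::
    "(('a \<Rightarrow>\<^sub>0 'k) \<Rightarrow> ('c \<Rightarrow>\<^sub>0 'k)) \<Rightarrow> (('b \<Rightarrow>\<^sub>0 'k) \<Rightarrow> ('d \<Rightarrow>\<^sub>0 'k))
      \<Rightarrow> ('a \<times> 'b \<Rightarrow>\<^sub>0 'k) \<Rightarrow> ('c \<times> 'd \<Rightarrow>\<^sub>0 'k::comm_ring_1)"
  where "tensor_map f g = lin (\<lambda>(a, b). tensor (f (basis a)) (g (basis b)))"

definition tensor_assoc :: "(('a \<times> 'b) \<times> 'c \<Rightarrow>\<^sub>0 'k) \<Rightarrow> ('a \<times> 'b \<times> 'c \<Rightarrow>\<^sub>0 'k::comm_ring_1)"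
  where "tensor_assoc = lin (\<lambda>((a, b), c). basis (a, b, c))"

text \<open>\<open>tensor_mult m\<close> is the product \<open>(a \<otimes> b) (c \<otimes> d) = m a c \<otimes> m b d\<close>, and \<open>mult_map m\<close> is the
  linear map \<open>a \<otimes> b \<mapsto> m a b\<close>.\<close>

definition tensor_mult ::
    "(('b \<Rightarrow>\<^sub>0 'k) \<Rightarrow> ('b \<Rightarrow>\<^sub>0 'k) \<Rightarrow> ('b \<Rightarrow>\<^sub>0 'k))
      \<Rightarrow> ('b \<times> 'b \<Rightarrow>\<^sub>0 'k) \<Rightarrow> ('b \<times> 'b \<Rightarrow>\<^sub>0 'k) \<Rightarrow> ('b \<times> 'b \<Rightarrow>\<^sub>0 'k::comm_ring_1)"
  where "tensor_mult m =
    bilin (\<lambda>(a, b) (c, d). tensor (m (basis a) (basis c)) (m (basis b) (basis d)))"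

definition mult_map ::
    "(('b \<Rightarrow>\<^sub>0 'k) \<Rightarrow> ('b \<Rightarrow>\<^sub>0 'k) \<Rightarrow> ('b \<Rightarrow>\<^sub>0 'k)) \<Rightarrow> ('b \<times> 'b \<Rightarrow>\<^sub>0 'k) \<Rightarrow> ('b \<Rightarrow>\<^sub>0 'k::comm_ring_1)"
  where "mult_map m = lin (\<lambda>(a, b). m (basis a) (basis b))"

lemma lin_superset:
  assumes "finite A" "Poly_Mapping.keys x \<subseteq> A"
  shows "lin f x = (\<Sum>b\<in>A. scl (Poly_Mapping.lookup x b) (f b))"
  unfolding lin_def by (rule sum.mono_neutral_left) (use assms in \<open>auto simp: in_keys_iff\<close>)

lemma lin_add: "lin f (x + y) = lin f x + lin f y"
  by (simp add: lin_superset[of "Poly_Mapping.keys x \<union> Poly_Mapping.keys y"] keys_add lookup_add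
      fm.scale_left_distrib sum.distrib)

lemma lin_scl: "lin f (scl c x) = scl c (lin f x)"
proof -
  have "Poly_Mapping.keys (scl c x) \<subseteq> Poly_Mapping.keys x"
    by (auto simp: in_keys_iff)
  then show ?thesis
    by (simp add: lin_superset[of "Poly_Mapping.keys x"] fm.scale_sum_right)
qed

lemma module_hom_lin: "module_hom scl scl (lin f)"
  by unfold_locales (simp_all add: lin_add lin_scl)

lemma lin_basis [simp]: "lin f (basis b) = f b"
proof -
  have "lin f (basis b) = (\<Sum>b'\<in>{b}. scl (Poly_Mapping.lookup (basis b) b') (f b'))"
    by (rule lin_superset) auto
  then show ?thesis by simp
qed

lemma lin_basis_id: "lin basis x = x"
proof (rule poly_mapping_eqI)
  fix b
  show "Poly_Mapping.lookup (lin basis x) b = Poly_Mapping.lookup x b"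
    by (simp add: lin_def lookup_sum lookup_single when_def in_keys_iff if_distrib cong: if_cong)
qed

lemma lin_unique:
  assumes "module_hom scl scl g" "\<And>b. g (basis b) = f b"
  shows "g = lin f"
proof
  fix x
  interpret module_hom scl scl g by fact
  have "g x = g (lin basis x)" by (simp add: lin_basis_id)
  also have "\<dots> = lin f x" by (simp add: lin_def sum scale assms(2))
  finally show "g x = lin f x" .
qed

lemma lin_fun_add: "lin (\<lambda>a. f a + g a) x = lin f x + lin g x"
  by (simp add: lin_def fm.scale_right_distrib sum.distrib)

lemma lin_fun_scl: "lin (\<lambda>a. scl c (f a)) x = scl c (lin f x)"
  by (simp add: lin_def fm.scale_sum_right mult.commute)

lemma bilin_bilinear:
  "module_hom scl scl (\<lambda>x. bilin f x y)" "module_hom scl scl (bilin f x)"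
  by (unfold_locales; simp add: bilin_def lin_add lin_scl lin_fun_add lin_fun_scl)+

lemma bilin_basis [simp]: "bilin f (basis a) (basis b) = f a b"
  by (simp add: bilin_def)

lemma bilin_unique:
  assumes "\<And>y. module_hom scl scl (\<lambda>x. h x y)" "\<And>x. module_hom scl scl (h x)"
    and "\<And>a b. h (basis a) (basis b) = f a b"
  shows "h = bilin f"
proof (intro ext)
  fix x y
  have "h (basis a) = lin (f a)" for a
    using lin_unique[OF assms(2)] assms(3) by metis
  then have "(\<lambda>x. h x y) = lin (\<lambda>a. lin (f a) y)"
    by (intro lin_unique assms(1)) simp
  then show "h x y = bilin f x y" by (simp add: bilin_def fun_eq_iff)
qed

lemma tensor_bilinear:
  "module_hom scl scl (\<lambda>x. tensor x y)" "module_hom scl scl (tensor x)"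
  by (simp_all add: tensor_def bilin_bilinear)

lemma tensor_basis [simp]: "tensor (basis a) (basis b) = basis (a, b)"
  by (simp add: tensor_def)

lemma tensor_universal:
  fixes h :: "('a \<Rightarrow>\<^sub>0 'k::comm_ring_1) \<Rightarrow> ('b \<Rightarrow>\<^sub>0 'k) \<Rightarrow> ('c \<Rightarrow>\<^sub>0 'k)"
  assumes "\<And>y. module_hom scl scl (\<lambda>x. h x y)" "\<And>x. module_hom scl scl (h x)"
  shows "\<exists>!g. module_hom scl scl g \<and> (\<forall>x y. g (tensor x y) = h x y)"
proof (rule ex1I)
  let ?g = "lin (\<lambda>(a, b). h (basis a) (basis b)) :: ('a \<times> 'b \<Rightarrow>\<^sub>0 'k) \<Rightarrow> ('c \<Rightarrow>\<^sub>0 'k)"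
  let ?f = "\<lambda>a b. h (basis a) (basis b)"
  have comp: "module_hom scl scl (\<lambda>x. ?g (u x))" if "module_hom scl scl u"
    for u :: "('e \<Rightarrow>\<^sub>0 'k) \<Rightarrow> ('a \<times> 'b \<Rightarrow>\<^sub>0 'k)"
    using module_hom_compose[OF that module_hom_lin] by (simp add: o_def)
  have "(\<lambda>x y. ?g (tensor x y)) = bilin ?f"
    by (rule bilin_unique) (auto intro!: comp tensor_bilinear)
  moreover have "h = bilin ?f"
    by (rule bilin_unique) (use assms in auto)
  ultimately show "module_hom scl scl ?g \<and> (\<forall>x y. ?g (tensor x y) = h x y)"
    by (metis module_hom_lin)
next
  fix g assume g: "module_hom scl scl g \<and> (\<forall>x y. g (tensor x y) = h x y)"
  then have "g (basis (a, b)) = h (basis a) (basis b)" for a b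
    by (metis tensor_basis)
  with g show "g = lin (\<lambda>(a, b). h (basis a) (basis b))"
    by (intro lin_unique) auto
qed


section \<open>Hopf algebras on free modules\<close>

locale fm_algebra =
  fixes m :: "('b \<Rightarrow>\<^sub>0 'k::comm_ring_1) \<Rightarrow> ('b \<Rightarrow>\<^sub>0 'k) \<Rightarrow> ('b \<Rightarrow>\<^sub>0 'k)"
    and \<eta> :: "'k \<Rightarrow> ('b \<Rightarrow>\<^sub>0 'k)"
  assumes mult_linear_left: "module_hom scl scl (\<lambda>x. m x y)"
    and mult_linear_right: "module_hom scl scl (\<lambda>y. m x y)"
    and mult_assoc: "m (m x y) z = m x (m y z)"
    and unit_linear: "module_hom (*) scl \<eta>"
    and unit_left: "m (\<eta> 1) x = x"
    and unit_right: "m x (\<eta> 1) = x"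

locale fm_coalgebra =
  fixes \<Delta> :: "('b \<Rightarrow>\<^sub>0 'k::comm_ring_1) \<Rightarrow> ('b \<times> 'b \<Rightarrow>\<^sub>0 'k)"
    and \<epsilon> :: "('b \<Rightarrow>\<^sub>0 'k) \<Rightarrow> 'k"
  assumes comult_linear: "module_hom scl scl \<Delta>"
    and counit_linear: "module_hom scl (*) \<epsilon>"
    and coassoc: "tensor_assoc (tensor_map \<Delta> id (\<Delta> x)) = tensor_map id \<Delta> (\<Delta> x)"
    and counit_left: "lin (\<lambda>(a, b). scl (\<epsilon> (basis a)) (basis b)) (\<Delta> x) = x"
    and counit_right: "lin (\<lambda>(a, b). scl (\<epsilon> (basis b)) (basis a)) (\<Delta> x) = x"

locale fm_bialgebra = fm_algebra m \<eta> + fm_coalgebra \<Delta> \<epsilon>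
  for m :: "('b \<Rightarrow>\<^sub>0 'k::comm_ring_1) \<Rightarrow> ('b \<Rightarrow>\<^sub>0 'k) \<Rightarrow> ('b \<Rightarrow>\<^sub>0 'k)" and \<eta> \<Delta> \<epsilon> +
  assumes comult_mult: "\<Delta> (m x y) = tensor_mult m (\<Delta> x) (\<Delta> y)"
    and comult_unit: "\<Delta> (\<eta> 1) = tensor (\<eta> 1) (\<eta> 1)"
    and counit_mult: "\<epsilon> (m x y) = \<epsilon> x * \<epsilon> y"
    and counit_unit: "\<epsilon> (\<eta> 1) = 1"

definition fm_antipode ::
    "(('b \<Rightarrow>\<^sub>0 'k::comm_ring_1) \<Rightarrow> ('b \<Rightarrow>\<^sub>0 'k) \<Rightarrow> ('b \<Rightarrow>\<^sub>0 'k)) \<Rightarrow> ('k \<Rightarrow> ('b \<Rightarrow>\<^sub>0 'k))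
      \<Rightarrow> (('b \<Rightarrow>\<^sub>0 'k) \<Rightarrow> ('b \<times> 'b \<Rightarrow>\<^sub>0 'k)) \<Rightarrow> (('b \<Rightarrow>\<^sub>0 'k) \<Rightarrow> 'k)
      \<Rightarrow> (('b \<Rightarrow>\<^sub>0 'k) \<Rightarrow> ('b \<Rightarrow>\<^sub>0 'k)) \<Rightarrow> bool"
  where "fm_antipode m \<eta> \<Delta> \<epsilon> S \<longleftrightarrow> module_hom scl scl S \<and>
    (\<forall>x. mult_map m (tensor_map S id (\<Delta> x)) = \<eta> (\<epsilon> x)) \<and>
    (\<forall>x. mult_map m (tensor_map id S (\<Delta> x)) = \<eta> (\<epsilon> x))"

locale fm_hopf_algebra = fm_bialgebra m \<eta> \<Delta> \<epsilon>
  for m :: "('b \<Rightarrow>\<^sub>0 'k::comm_ring_1) \<Rightarrow> ('b \<Rightarrow>\<^sub>0 'k) \<Rightarrow> ('b \<Rightarrow>\<^sub>0 'k)" and \<eta> \<Delta> \<epsilon> +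
  assumes antipode_exists: "\<exists>S. fm_antipode m \<eta> \<Delta> \<epsilon> S"

text \<open>A grading is a decomposition into a direct sum of submodules \<open>gr n\<close> for which all structure
  maps are homogeneous of degree 0, where the ground ring has degree 0.\<close>

locale graded_fm_hopf_algebra = fm_hopf_algebra m \<eta> \<Delta> \<epsilon>
  for m :: "('b \<Rightarrow>\<^sub>0 'k::comm_ring_1) \<Rightarrow> ('b \<Rightarrow>\<^sub>0 'k) \<Rightarrow> ('b \<Rightarrow>\<^sub>0 'k)" and \<eta> \<Delta> \<epsilon> +
  fixes gr :: "nat \<Rightarrow> ('b \<Rightarrow>\<^sub>0 'k) set"
  assumes gr_submodule: "fm.subspace (gr n)"
    and gr_direct_sum:
      "\<exists>!c. (\<forall>n. c n \<in> gr n) \<and> finite {n. c n \<noteq> 0} \<and> x = (\<Sum>n | c n \<noteq> 0. c n)"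
    and gr_mult: "\<lbrakk>x \<in> gr i; y \<in> gr j\<rbrakk> \<Longrightarrow> m x y \<in> gr (i + j)"
    and gr_unit: "\<eta> c \<in> gr 0"
    and gr_comult: "x \<in> gr n \<Longrightarrow>
      \<Delta> x \<in> fm.span {tensor y z | y z i j. y \<in> gr i \<and> z \<in> gr j \<and> i + j = n}"
    and gr_counit: "\<lbrakk>x \<in> gr n; n \<noteq> 0\<rbrakk> \<Longrightarrow> \<epsilon> x = 0"
    and gr_antipode: "\<lbrakk>fm_antipode m \<eta> \<Delta> \<epsilon> S; x \<in> gr n\<rbrakk> \<Longrightarrow> S x \<in> gr n"

locale graded_connected_commutative_fm_hopf_algebra = graded_fm_hopf_algebra m \<eta> \<Delta> \<epsilon> gr
  for m :: "('b \<Rightarrow>\<^sub>0 'k::comm_ring_1) \<Rightarrow> ('b \<Rightarrow>\<^sub>0 'k) \<Rightarrow> ('b \<Rightarrow>\<^sub>0 'k)" and \<eta> \<Delta> \<epsilon> gr +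
  assumes connected: "gr 0 = {\<eta> c | c. True}"
    and commutative: "m x y = m y x"

text \<open>The polynomial algebra over \<open>'k\<close> in a set \<open>X\<close> of variables, as a subalgebra of the algebra
  \<open>('x \<Rightarrow>\<^sub>0 nat) \<Rightarrow>\<^sub>0 'k\<close> of polynomials in the variables of type \<open>'x\<close> (with the multiplication
  from \<open>Poly_Mapping\<close>).\<close>

definition polys_in :: "'x set \<Rightarrow> (('x \<Rightarrow>\<^sub>0 nat) \<Rightarrow>\<^sub>0 'k::comm_ring_1) set"
  where "polys_in X = {P. \<forall>\<alpha>\<in>Poly_Mapping.keys P. Poly_Mapping.keys \<alpha> \<subseteq> X}"

definition poly_var :: "'x \<Rightarrow> (('x \<Rightarrow>\<^sub>0 nat) \<Rightarrow>\<^sub>0 'k::comm_ring_1)"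
  where "poly_var x = Poly_Mapping.single (Poly_Mapping.single x 1) 1"

text \<open>A commutative algebra is free iff it has a free generating set \<open>X\<close>, i.e. there is an algebra
  isomorphism from the polynomial algebra in \<open>X\<close> that sends the variable \<open>x\<close> to \<open>x\<close>.\<close>

definition free_fm_comm_algebra ::
    "(('b \<Rightarrow>\<^sub>0 'k::comm_ring_1) \<Rightarrow> ('b \<Rightarrow>\<^sub>0 'k) \<Rightarrow> ('b \<Rightarrow>\<^sub>0 'k)) \<Rightarrow> ('k \<Rightarrow> ('b \<Rightarrow>\<^sub>0 'k)) \<Rightarrow> bool"
  where "free_fm_comm_algebra m \<eta> \<longleftrightarrow>
    (\<exists>(X :: ('b \<Rightarrow>\<^sub>0 'k) set) (\<phi> :: ((('b \<Rightarrow>\<^sub>0 'k) \<Rightarrow>\<^sub>0 nat) \<Rightarrow>\<^sub>0 'k) \<Rightarrow> ('b \<Rightarrow>\<^sub>0 'k)).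
      bij_betw \<phi> (polys_in X) UNIV \<and>
      (\<forall>P\<in>polys_in X. \<forall>Q\<in>polys_in X. \<phi> (P + Q) = \<phi> P + \<phi> Q) \<and>
      (\<forall>c. \<forall>P\<in>polys_in X. \<phi> (scl c P) = scl c (\<phi> P)) \<and>
      (\<forall>P\<in>polys_in X. \<forall>Q\<in>polys_in X. \<phi> (P * Q) = m (\<phi> P) (\<phi> Q)) \<and>
      \<phi> 1 = \<eta> 1 \<and>
      (\<forall>x\<in>X. \<phi> (poly_var x) = x))"


section \<open>Matrix compositions\<close>

text \<open>The \<open>d\<close> letters are the elements of a finite type \<open>'d\<close> (so \<open>d = CARD('d) \<ge> 1\<close>), and the free
  commutative monoid on them is \<open>'d multiset\<close> with \<open>\<star>\<close> being \<open>+\<close> and \<open>\<epsilon>\<close> being \<open>0 = {#}\<close>. The weight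
  of a monomial is its \<open>size\<close>. The empty composition is the \<open>0 \<times> 0\<close> matrix. The
  condition on rows and columns excludes the other matrices without entries. Matrix indices start
  at 0.\<close>

definition is_cmp :: "'d multiset mat \<Rightarrow> bool"
  where "is_cmp A \<longleftrightarrow>
    dim_row A = 0 \<and> dim_col A = 0 \<or>
    dim_row A \<ge> 1 \<and> dim_col A \<ge> 1 \<and>
    (\<forall>i<dim_row A. \<exists>j<dim_col A. A $$ (i, j) \<noteq> {#}) \<and>
    (\<forall>j<dim_col A. \<exists>i<dim_row A. A $$ (i, j) \<noteq> {#})"

typedef (overloaded) 'd cmp = "{A :: 'd::finite multiset mat. is_cmp A}"
  by (rule exI[of _ "0\<^sub>m 0 0"]) (simp add: is_cmp_def)

setup_lifting type_definition_cmp

lift_definition cempty :: "'d::finite cmp" is "0\<^sub>m 0 0"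
  by (simp add: is_cmp_def)

lemma is_cmp_alt: "is_cmp A \<longleftrightarrow>
    (\<forall>i<dim_row A. \<exists>j<dim_col A. A $$ (i, j) \<noteq> {#}) \<and>
    (\<forall>j<dim_col A. \<exists>i<dim_row A. A $$ (i, j) \<noteq> {#})"
  unfolding is_cmp_def by (cases "dim_row A"; cases "dim_col A"; force)

lemma is_cmp_diag_block:
  assumes "is_cmp A" "is_cmp B"
  shows "is_cmp (diag_block_mat [A, B])"
  unfolding is_cmp_alt
proof (intro conjI allI impI)
  fix i assume i: "i < dim_row (diag_block_mat [A, B])"
  show "\<exists>j<dim_col (diag_block_mat [A, B]). diag_block_mat [A, B] $$ (i, j) \<noteq> {#}"
  proof (cases "i < dim_row A")
    case True
    then obtain j where "j < dim_col A" "A $$ (i, j) \<noteq> {#}"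
      using assms(1) unfolding is_cmp_alt by blast
    with True i show ?thesis by (intro exI[of _ j]) (auto simp: Let_def)
  next
    case False
    with i have "i - dim_row A < dim_row B" by (auto simp: Let_def)
    then obtain j where "j < dim_col B" "B $$ (i - dim_row A, j) \<noteq> {#}"
      using assms(2) unfolding is_cmp_alt by blast
    with False i show ?thesis by (intro exI[of _ "dim_col A + j"]) (auto simp: Let_def)
  qed
next
  fix j assume j: "j < dim_col (diag_block_mat [A, B])"
  show "\<exists>i<dim_row (diag_block_mat [A, B]). diag_block_mat [A, B] $$ (i, j) \<noteq> {#}"
  proof (cases "j < dim_col A")
    case True
    then obtain i where "i < dim_row A" "A $$ (i, j) \<noteq> {#}"
      using assms(1) unfolding is_cmp_alt by blast
    with True j show ?thesis by (intro exI[of _ i]) (auto simp: Let_def)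
  next
    case False
    with j have "j - dim_col A < dim_col B" by (auto simp: Let_def)
    then obtain i where "i < dim_row B" "B $$ (i, j - dim_col A) \<noteq> {#}"
      using assms(2) unfolding is_cmp_alt by blast
    with False j show ?thesis by (intro exI[of _ "dim_row A + i"]) (auto simp: Let_def)
  qed
qed

lift_definition cdiag :: "'d::finite cmp \<Rightarrow> 'd cmp \<Rightarrow> 'd cmp" is "\<lambda>A B. diag_block_mat [A, B]"
  by (rule is_cmp_diag_block)

definition cdiag_list :: "'d::finite cmp list \<Rightarrow> 'd cmp"
  where "cdiag_list vs = foldr cdiag vs cempty"

definition cconnected :: "'d::finite cmp \<Rightarrow> bool"
  where "cconnected a \<longleftrightarrow> a \<noteq> cempty \<and> (\<forall>b c. a = cdiag b c \<longrightarrow> b = cempty \<or> c = cempty)"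

lift_definition crows :: "'d::finite cmp \<Rightarrow> nat" is dim_row .
lift_definition ccols :: "'d::finite cmp \<Rightarrow> nat" is dim_col .
lift_definition centry :: "'d::finite cmp \<Rightarrow> nat \<Rightarrow> nat \<Rightarrow> 'd multiset" is "\<lambda>A i j. A $$ (i, j)" .

definition cweight :: "'d::finite cmp \<Rightarrow> nat"
  where "cweight a = (\<Sum>i<crows a. \<Sum>j<ccols a. size (centry a i j))"


section \<open>The Hopf algebra structure on matrix compositions\<close>

text \<open>Domain and codomain of the surjections are shifted to \<open>{0..<m+s}\<close> and \<open>{0..<j}\<close>.\<close>

definition qSh :: "nat \<Rightarrow> nat \<Rightarrow> nat \<Rightarrow> (nat \<Rightarrow> nat) set"
  where "qSh m s j = {q \<in> {..<m + s} \<rightarrow>\<^sub>E {..<j}.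
    q ` {..<m + s} = {..<j} \<and> strict_mono_on {..<m} q \<and> strict_mono_on {m..<m + s} q}"

definition qsh_mat ::
    "'d::finite cmp \<Rightarrow> 'd cmp \<Rightarrow> nat \<Rightarrow> nat \<Rightarrow> (nat \<Rightarrow> nat) \<Rightarrow> (nat \<Rightarrow> nat) \<Rightarrow> 'd multiset mat"
  where "qsh_mat a b j k p q = mat j k (\<lambda>(x, y).
    \<Sum>u | u < crows a + crows b \<and> p u = x.
    \<Sum>v | v < ccols a + ccols b \<and> q v = y. centry (cdiag a b) u v)"

lemma cdiag_dims: "crows (cdiag a b) = crows a + crows b" "ccols (cdiag a b) = ccols a + ccols b"
  by (transfer; simp add: Let_def)+

lemma cmp_entry_nonempty:
  "i < crows a \<Longrightarrow> \<exists>j<ccols a. centry a i j \<noteq> {#}"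
  "j < ccols a \<Longrightarrow> \<exists>i<crows a. centry a i j \<noteq> {#}"
  by (transfer, simp add: is_cmp_alt)+

lemma is_cmp_qsh_mat:
  assumes p: "p \<in> qSh (crows a) (crows b) j" and q: "q \<in> qSh (ccols a) (ccols b) k"
  shows "is_cmp (qsh_mat a b j k p q)"
proof -
  let ?M = "crows a + crows b" and ?N = "ccols a + ccols b" and ?D = "cdiag a b"
  have D: "\<And>u. u < ?M \<Longrightarrow> \<exists>v<?N. centry ?D u v \<noteq> {#}" "\<And>v. v < ?N \<Longrightarrow> \<exists>u<?M. centry ?D u v \<noteq> {#}"
    using cmp_entry_nonempty[of _ ?D] by (simp_all add: cdiag_dims)
  have pi: "p ` {..<?M} = {..<j}" and qi: "q ` {..<?N} = {..<k}"
    using p q by (auto simp: qSh_def)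
  have nz: "qsh_mat a b j k p q $$ (p u, q v) \<noteq> {#}"
    if "u < ?M" "v < ?N" "centry ?D u v \<noteq> {#}" for u v
  proof -
    have "p u < j" "q v < k" using that pi qi by blast+
    moreover have "qsh_mat a b j k p q $$ (p u, q v) = {#} \<longleftrightarrow>
        (\<forall>u'. u' < ?M \<and> p u' = p u \<longrightarrow> (\<forall>v'. v' < ?N \<and> q v' = q v \<longrightarrow> centry ?D u' v' = {#}))"
      using calculation by (simp add: qsh_mat_def set_mset_sum flip: set_mset_eq_empty_iff)
    ultimately show ?thesis using that by blast
  qed
  show ?thesis
    unfolding is_cmp_alt
  proof (intro conjI allI impI)
    fix x assume "x < dim_row (qsh_mat a b j k p q)"
    then obtain u where u: "u < ?M" "x = p u" using pi by (auto simp: qsh_mat_def)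
    with D obtain v where v: "v < ?N" "centry ?D u v \<noteq> {#}" by blast
    have "q v < k" using v qi by blast
    with nz u v show "\<exists>y<dim_col (qsh_mat a b j k p q). qsh_mat a b j k p q $$ (x, y) \<noteq> {#}"
      by (intro exI[of _ "q v"]) (auto simp: qsh_mat_def)
  next
    fix y assume "y < dim_col (qsh_mat a b j k p q)"
    then obtain v where v: "v < ?N" "y = q v" using qi by (auto simp: qsh_mat_def)
    with D obtain u where u: "u < ?M" "centry ?D u v \<noteq> {#}" by blast
    have "p u < j" using u pi by blast
    with nz u v show "\<exists>x<dim_row (qsh_mat a b j k p q). qsh_mat a b j k p q $$ (x, y) \<noteq> {#}"
      by (intro exI[of _ "p u"]) (auto simp: qsh_mat_def)
  qed
qed

text \<open>The sum over all \<open>j, k \<ge> 1\<close> is cut off where the sets \<open>qSh\<close> become empty: a surjection onto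
  \<open>j\<close> elements needs \<open>j \<le> m + s\<close>. By \<open>is_cmp_qsh_mat\<close>, \<open>Abs_cmp\<close> is only applied to
  compositions.\<close>

definition qsh_basis :: "'d::finite cmp \<Rightarrow> 'd cmp \<Rightarrow> ('d cmp \<Rightarrow>\<^sub>0 'k::comm_ring_1)"
  where "qsh_basis a b =
    (if a = cempty then basis b
     else if b = cempty then basis a
     else \<Sum>j\<in>{1..crows a + crows b}. \<Sum>k\<in>{1..ccols a + ccols b}.
          \<Sum>p\<in>qSh (crows a) (crows b) j. \<Sum>q\<in>qSh (ccols a) (ccols b) k.
            basis (Abs_cmp (qsh_mat a b j k p q)))"

definition qsh ::
    "('d::finite cmp \<Rightarrow>\<^sub>0 'k::comm_ring_1) \<Rightarrow> ('d cmp \<Rightarrow>\<^sub>0 'k) \<Rightarrow> ('d cmp \<Rightarrow>\<^sub>0 'k)"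
  where "qsh = bilin qsh_basis"

definition cunit :: "'k::comm_ring_1 \<Rightarrow> ('d::finite cmp \<Rightarrow>\<^sub>0 'k)"
  where "cunit c = scl c (basis cempty)"

definition deconc :: "('d::finite cmp \<Rightarrow>\<^sub>0 'k::comm_ring_1) \<Rightarrow> ('d cmp \<times> 'd cmp \<Rightarrow>\<^sub>0 'k)"
  where "deconc = lin (\<lambda>a. \<Sum>(b, c) | cdiag b c = a. tensor (basis b) (basis c))"

text \<open>The linear map with value 1 at \<open>cempty\<close> and 0 at all other basis elements.\<close>

definition ccounit :: "('d::finite cmp \<Rightarrow>\<^sub>0 'k::comm_ring_1) \<Rightarrow> 'k"
  where "ccounit x = Poly_Mapping.lookup x cempty"

definition cgrade :: "nat \<Rightarrow> ('d::finite cmp \<Rightarrow>\<^sub>0 'k::comm_ring_1) set"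
  where "cgrade n = fm.span {basis a | a. cweight a = n}"

text \<open>The sum defining \<open>deconc\<close> has finitely many summands.\<close>

lemma finite_cdiag_eq: "finite {(b, c). cdiag b c = (a :: 'd::finite cmp)}"
proof (rule finite_imageD)
  let ?f = "\<lambda>(b, c). (crows b, ccols b, crows c, ccols c)"
  show "finite (?f ` {(b, c). cdiag b c = a})"
    by (rule finite_subset[of _
          "{..crows a} \<times> {..ccols a} \<times> {..crows a} \<times> {..ccols a}"])
      (auto simp: cdiag_dims)
  have *: "A = A' \<and> B = B'"
    if eq: "diag_block_mat [A, B] = diag_block_mat [A', B']"
      and dims: "dim_row A = dim_row A'" "dim_col A = dim_col A'"
        "dim_row B = dim_row B'" "dim_col B = dim_col B'"
    for A B A' B' :: "'d::finite multiset mat"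
  proof
    have e: "diag_block_mat [A, B] $$ (i, j) = diag_block_mat [A', B'] $$ (i, j)" for i j
      by (simp only: eq)
    show "A = A'"
    proof (rule eq_matI)
      fix i j assume "i < dim_row A'" "j < dim_col A'"
      then show "A $$ (i, j) = A' $$ (i, j)" using e[of i j] dims by (simp add: Let_def)
    qed (use dims in auto)
    show "B = B'"
    proof (rule eq_matI)
      fix i j assume "i < dim_row B'" "j < dim_col B'"
      then show "B $$ (i, j) = B' $$ (i, j)"
        using e[of "dim_row A + i" "dim_col A + j"] dims by (simp add: Let_def)
    qed (use dims in auto)
  qed
  have **: "b = b' \<and> c = c'"
    if "cdiag b c = cdiag b' c'" "crows b = crows b'" "ccols b = ccols b'"
      "crows c = crows c'" "ccols c = ccols c'" for b c b' c' :: "'d::finite cmp"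
    using that by transfer (rule *)
  then show "inj_on ?f {(b, c). cdiag b c = a}"
    by (intro inj_onI) (clarify, metis (no_types, lifting) ** old.prod.case prod.inject)
qed


section \<open>The antipode formula\<close>

definition int_compositions :: "nat \<Rightarrow> nat list set"
  where "int_compositions k = {is. is \<noteq> [] \<and> (\<forall>i\<in>set is. 0 < i) \<and> sum_list is = k}"

text \<open>Cut a list into consecutive blocks of the given lengths.\<close>

fun blocks :: "nat list \<Rightarrow> 'a list \<Rightarrow> 'a list list"
  where
    "blocks [] vs = []"
  | "blocks (i # is) vs = take i vs # blocks is (drop i vs)"

definition qsh_prod :: "('d::finite cmp \<Rightarrow>\<^sub>0 'k::comm_ring_1) list \<Rightarrow> ('d cmp \<Rightarrow>\<^sub>0 'k)"
  where "qsh_prod xs = foldr qsh xs (basis cempty)"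

text \<open>Since every non-empty composition is \<open>cdiag_list vs\<close> for a unique non-empty list \<open>vs\<close> of connected
  compositions, these conditions determine \<open>A\<close> on the basis.\<close>

definition antipode_formula :: "(('d::finite cmp \<Rightarrow>\<^sub>0 'k::comm_ring_1) \<Rightarrow> ('d cmp \<Rightarrow>\<^sub>0 'k)) \<Rightarrow> bool"
  where "antipode_formula A \<longleftrightarrow>
    module_hom scl scl A \<and>
    A (basis cempty) = basis cempty \<and>
    (\<forall>vs. vs \<noteq> [] \<and> (\<forall>v\<in>set vs. cconnected v) \<longrightarrow>
      A (basis (cdiag_list vs)) =
        (\<Sum>is\<in>int_compositions (length vs).
          scl ((-1) ^ length is) (qsh_prod (map (\<lambda>b. basis (cdiag_list b)) (blocks is vs)))))"

end

theory Submission
  imports Defs "HOL-Library.List_Lexorder" "HOL-Library.Sublist"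
begin

text \<open>Consider commuting variables \<open>x\<^sub>i\<^sub>j\<close>, one for every position in an infinite matrix, with exponents in
  the free commutative monoid. A monomial \<open>F\<close> in these variables is an infinite matrix with finitely
  many non-trivial entries, and deleting its trivial rows and columns leaves a composition \<open>cmpr F\<close>.
  Send a composition \<open>a\<close> to the formal sum of all monomials \<open>F\<close> with \<open>cmpr F = a\<close>. A quasi-shuffle is
  exactly a way to interleave, with possible collisions, the rows (or columns) of two such
  monomials, so this map turns the two-parameter quasi-shuffle product into the multiplication of
  formal power series. In coefficients (\<open>lookup_qsh\<close>): the coefficient of \<open>cmpr F\<close> in a product is a
  sum over all decompositions \<open>F = G + H\<close>. This makes the product associative and commutative.

  Deconcatenation is dual to \<open>cdiag\<close>, and \<open>cmpr (F + G) = cdiag (cmpr F) (cmpr G)\<close> if \<open>G\<close> lives below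
  and to the right of \<open>F\<close>. As \<open>F\<close> and \<open>G\<close> then have no variable in common, to decompose \<open>F + G\<close> is to
  decompose \<open>F\<close> and \<open>G\<close> independently; this is the compatibility of product and coproduct
  (\<open>deconc_qsh\<close>).

  A refinement property of block decompositions (\<open>cdiag_levi\<close>) shows that the compositions form the
  free monoid over the connected ones. Deconcatenation thus cuts words, and the alternating sum over
  all ways to cut a word into blocks is an antipode because splitting off its first or its last
  block gives the two recursions \<open>antipode_word_first\<close> and \<open>antipode_word_last\<close>. The defining equation
  of a left antipode, read as a recursion over words, leaves no other choice.

  For freeness, every connected component of a composition that occurs in the product of \<open>a\<close> and \<open>b\<close>
  uses up at least one factor of \<open>a\<close> or of \<open>b\<close>, and if it uses up only one, then it equals this
  factor. So the words in a product of two words are either shuffles of them or shorter (\<open>struct_const_word\<close>). Well-order the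
  letters and compare words first by length and then lexicographically. The largest word in a
  product of Lyndon words \<open>l\<^sub>1 \<ge> \<dots> \<ge> l\<^sub>k\<close> is then their concatenation, with a positive integer as
  its coefficient. Since every word is such a concatenation in exactly one way, the monomials in the
  Lyndon words are triangular with respect to the basis of all words, and the diagonal entries are
  invertible because the ground ring contains the rationals (\<open>bij_lin_qsh_monomial\<close>).\<close>

section \<open>Coefficients of linear and bilinear maps\<close>

abbreviation lookup where "lookup \<equiv> Poly_Mapping.lookup"
abbreviation keys where "keys \<equiv> Poly_Mapping.keys"

lemma lin_ext:
  assumes "module_hom scl scl g" "module_hom scl scl h" "\<And>b. g (basis b) = h (basis b)"
  shows "g x = h x"
  using lin_unique[OF assms(1), of "\<lambda>b. h (basis b)"] lin_unique[OF assms(2), of "\<lambda>b. h (basis b)"] assms(3)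
  by simp

lemma lookup_lin: "lookup (lin f x) c = (\<Sum>b\<in>keys x. lookup x b * lookup (f b) c)"
  by (simp add: lin_def lookup_sum)

lemma sum_keys_delta: "(\<Sum>b\<in>keys x. lookup x b * (if b = t then 1 else 0)) = lookup x t"
  for x :: "'b \<Rightarrow>\<^sub>0 'k::comm_ring_1"
  by (simp add: if_distrib in_keys_iff cong: if_cong)

lemma lookup_basis: "lookup (basis a) b = (if b = a then 1 else 0)"
  by (auto simp: lookup_single when_def)

text \<open>If the structure constants of a bilinear map count the elements of a finite set, then the
  coefficients of all its values are sums over this set.\<close>

lemma lookup_bilin_count:
  assumes "finite I"
    and "\<And>a b. lookup (f a b) c = (\<Sum>i\<in>I. (if a = u i then 1 else 0) * (if b = v i then 1 else 0))"
  shows "lookup (bilin f x y) c = (\<Sum>i\<in>I. lookup x (u i) * lookup y (v i))"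
proof -
  have "lookup (bilin f x y) c = (\<Sum>a\<in>keys x. \<Sum>b\<in>keys y. \<Sum>i\<in>I.
      (lookup x a * (if a = u i then 1 else 0)) * (lookup y b * (if b = v i then 1 else 0)))"
    by (simp add: bilin_def lookup_lin assms(2) sum_distrib_left mult_ac)
  also have "\<dots> = (\<Sum>i\<in>I. (\<Sum>a\<in>keys x. lookup x a * (if a = u i then 1 else 0)) *
      (\<Sum>b\<in>keys y. lookup y b * (if b = v i then 1 else 0)))"
    by (simp only: sum_product sum.swap[of _ I])
  finally show ?thesis unfolding sum_keys_delta .
qed

lemma lookup_tensor: "lookup (tensor x y) (a, b) = lookup x a * lookup y b"
proof -
  have "lookup (tensor x y) (a, b) = (\<Sum>i\<in>{()}. lookup x a * lookup y b)"
    unfolding tensor_def by (rule lookup_bilin_count) (auto simp: lookup_basis)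
  then show ?thesis by simp
qed

lemma lookup_tensor_map: "lookup (tensor_map f g t) (c, d) =
    (\<Sum>(a, b)\<in>keys t. lookup t (a, b) * (lookup (f (basis a)) c * lookup (g (basis b)) d))"
  by (auto simp: tensor_map_def lookup_lin lookup_tensor intro!: sum.cong)

lemma lookup_tensor_assoc: "lookup (tensor_assoc t) (a, b, c) = lookup t ((a, b), c)"
proof -
  have "lookup (tensor_assoc t) (a, b, c) =
      (\<Sum>s\<in>keys t. lookup t s * (if s = ((a, b), c) then 1 else 0))"
    unfolding tensor_assoc_def lookup_lin
    by (intro sum.cong refl arg_cong2[where f = "(*)"]) (auto simp: lookup_basis split: if_splits)
  then show ?thesis by (simp only: sum_keys_delta)
qed

section \<open>Compositions as compressed monomials\<close>

text \<open>A monomial in commuting variables that are indexed by matrix positions (row, column), with exponents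
  in the free commutative monoid on the letters. The product of monomials is \<open>+\<close>.\<close>

type_synonym 'd mono = "nat \<times> nat \<Rightarrow>\<^sub>0 'd multiset"

text \<open>The entry \<open>(i, j)\<close> of \<open>a\<close> becomes the exponent at position \<open>(p i, q j)\<close>. For maps \<open>p\<close>, \<open>q\<close> that
  are not injective, the entries that meet at a position are multiplied.\<close>

definition place :: "(nat \<Rightarrow> nat) \<Rightarrow> (nat \<Rightarrow> nat) \<Rightarrow> 'd::finite cmp \<Rightarrow> 'd mono"
  where "place p q a =
    (\<Sum>i<crows a. \<Sum>j<ccols a. Poly_Mapping.single (p i, q j) (centry a i j))"

definition mrows :: "'d::finite mono \<Rightarrow> nat list"
  where "mrows F = sorted_list_of_set (fst ` keys F)"

definition mcols :: "'d::finite mono \<Rightarrow> nat list"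
  where "mcols F = sorted_list_of_set (snd ` keys F)"

text \<open>What remains of the matrix \<open>F\<close> when its trivial rows and columns are deleted.\<close>

definition cmpr :: "'d::finite mono \<Rightarrow> 'd cmp"
  where "cmpr F = Abs_cmp (mat (length (mrows F)) (length (mcols F))
    (\<lambda>(i, j). lookup F (mrows F ! i, mcols F ! j)))"

lemma cmp_eqI:
  assumes "crows a = crows b" "ccols a = ccols b"
    and "\<And>i j. i < crows a \<Longrightarrow> j < ccols a \<Longrightarrow> centry a i j = centry b i j"
  shows "a = b"
  using assms by transfer (auto intro!: eq_matI)

lemma Abs_cmp_dims:
  assumes "is_cmp M"
  shows "crows (Abs_cmp M) = dim_row M" "ccols (Abs_cmp M) = dim_col M"
    "centry (Abs_cmp M) i j = M $$ (i, j)"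
  using assms by (simp_all add: crows.rep_eq ccols.rep_eq centry.rep_eq Abs_cmp_inverse)

lemma crows_eq_0_iff: "crows a = 0 \<longleftrightarrow> a = cempty"
  and ccols_eq_0_iff: "ccols a = 0 \<longleftrightarrow> a = cempty"
  by (transfer; auto simp: is_cmp_def intro!: eq_matI)+

lemma cempty_dims [simp]: "crows cempty = 0" "ccols cempty = 0"
  by (simp_all add: crows_eq_0_iff ccols_eq_0_iff)

lemma keys_add_multiset: "keys (F + G) = keys F \<union> keys G" for F G :: "'a \<Rightarrow>\<^sub>0 'd multiset"
  by (auto simp: in_keys_iff lookup_add)

lemma keys_sum_multiset: "finite A \<Longrightarrow> keys (\<Sum>i\<in>A. F i) = (\<Union>i\<in>A. keys (F i))"
  for F :: "'b \<Rightarrow> 'a \<Rightarrow>\<^sub>0 'd multiset"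
  by (induction A rule: finite_induct) (simp_all add: keys_add_multiset)

lemma keys_place: "keys (place p q a) =
    {(p i, q j) | i j. i < crows a \<and> j < ccols a \<and> centry a i j \<noteq> {#}}"
  by (auto simp: place_def keys_sum_multiset)

lemma fst_keys_place: "fst ` keys (place p q a) = p ` {..<crows a}"
  unfolding keys_place
  by (auto simp: image_iff) (metis cmp_entry_nonempty(1))+

lemma snd_keys_place: "snd ` keys (place p q a) = q ` {..<ccols a}"
  unfolding keys_place
  by (auto simp: image_iff) (metis cmp_entry_nonempty(2))+

lemma lookup_place:
  assumes "inj_on p {..<crows a}" "inj_on q {..<ccols a}" "i < crows a" "j < ccols a"
  shows "lookup (place p q a) (p i, q j) = centry a i j"
proof -
  have "lookup (place p q a) (p i, q j) =
      (\<Sum>i'<crows a. \<Sum>j'<ccols a. if i' = i \<and> j' = j then centry a i' j' else {#})"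
    using assms unfolding place_def lookup_sum lookup_single when_def
    by (intro sum.cong refl) (auto simp: inj_on_def)
  also have "\<dots> = (\<Sum>i'<crows a. if i' = i then centry a i' j else {#})"
    using assms by (intro sum.cong refl) auto
  also have "\<dots> = centry a i j" using assms by simp
  finally show ?thesis .
qed

lemma sorted_list_of_set_image:
  fixes p :: "nat \<Rightarrow> nat"
  assumes "strict_mono_on {..<n} p"
  shows "sorted_list_of_set (p ` {..<n}) = map p [0..<n]"
proof -
  have "inj_on p {..<n}" using assms by (rule strict_mono_on_imp_inj_on)
  then have "card (p ` {..<n}) = n" by (simp add: card_image)
  moreover have "sorted_wrt (<) (map p [0..<n])"
    using assms by (auto simp: sorted_wrt_iff_nth_less strict_mono_on_def)
  moreover have "set (map p [0..<n]) = p ` {..<n}" by auto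
  ultimately show ?thesis
    using sorted_list_of_set_unique[of "p ` {..<n}" "map p [0..<n]"] by auto
qed

lemma mrows_place: "strict_mono_on {..<crows a} p \<Longrightarrow> mrows (place p q a) = map p [0..<crows a]"
  by (simp add: mrows_def fst_keys_place sorted_list_of_set_image)

lemma mcols_place: "strict_mono_on {..<ccols a} q \<Longrightarrow> mcols (place p q a) = map q [0..<ccols a]"
  by (simp add: mcols_def snd_keys_place sorted_list_of_set_image)

lemma set_mrows: "set (mrows F) = fst ` keys F" and set_mcols: "set (mcols F) = snd ` keys F"
  by (simp_all add: mrows_def mcols_def)

lemma strict_mono_mrows: "strict_mono_on {..<length (mrows F)} ((!) (mrows F))"
  and strict_mono_mcols: "strict_mono_on {..<length (mcols F)} ((!) (mcols F))"
  by (auto simp: mrows_def mcols_def strict_mono_on_def sorted_wrt_nth_less[OF strict_sorted_list_of_set])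

lemma is_cmp_compressed: "is_cmp (mat (length (mrows F)) (length (mcols F))
    (\<lambda>(i, j). lookup F (mrows F ! i, mcols F ! j)))"
proof -
  have "\<exists>j<length (mcols F). lookup F (mrows F ! i, mcols F ! j) \<noteq> {#}" if "i < length (mrows F)" for i
  proof -
    have "mrows F ! i \<in> fst ` keys F" using that set_mrows nth_mem by metis
    then obtain y where "(mrows F ! i, y) \<in> keys F" by force
    moreover from this have "y \<in> set (mcols F)" unfolding set_mcols by force
    ultimately show ?thesis by (metis in_set_conv_nth in_keys_iff)
  qed
  moreover have "\<exists>i<length (mrows F). lookup F (mrows F ! i, mcols F ! j) \<noteq> {#}" if "j < length (mcols F)" for j
  proof -
    have "mcols F ! j \<in> snd ` keys F" using that set_mcols nth_mem by metis
    then obtain x where "(x, mcols F ! j) \<in> keys F" by force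
    moreover from this have "x \<in> set (mrows F)" unfolding set_mrows by force
    ultimately show ?thesis by (metis in_set_conv_nth in_keys_iff)
  qed
  ultimately show ?thesis by (simp add: is_cmp_alt cong: conj_cong)
qed

lemma cmpr_dims: "crows (cmpr F) = length (mrows F)" "ccols (cmpr F) = length (mcols F)"
  and centry_cmpr: "i < length (mrows F) \<Longrightarrow> j < length (mcols F) \<Longrightarrow>
    centry (cmpr F) i j = lookup F (mrows F ! i, mcols F ! j)"
  by (simp_all add: cmpr_def Abs_cmp_dims[OF is_cmp_compressed])

text \<open>Together with \<open>place_cmpr\<close>: every monomial arises by a strictly increasing placement of rows and
  columns from exactly one composition.\<close>

lemma cmpr_place:
  assumes "strict_mono_on {..<crows a} p" "strict_mono_on {..<ccols a} q"
  shows "cmpr (place p q a) = a"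
  by (rule cmp_eqI)
    (use assms in \<open>simp_all add: cmpr_dims centry_cmpr mrows_place mcols_place lookup_place
      strict_mono_on_imp_inj_on\<close>)

lemma place_cmpr: "place ((!) (mrows F)) ((!) (mcols F)) (cmpr F) = F"
proof (rule poly_mapping_eqI, clarify)
  fix x y
  let ?P = "place ((!) (mrows F)) ((!) (mcols F)) (cmpr F)"
  show "lookup ?P (x, y) = lookup F (x, y)"
  proof (cases "x \<in> set (mrows F) \<and> y \<in> set (mcols F)")
    case True
    then obtain i j where ij: "i < length (mrows F)" "j < length (mcols F)" "x = mrows F ! i" "y = mcols F ! j"
      by (metis in_set_conv_nth)
    have "lookup ?P (mrows F ! i, mcols F ! j) = centry (cmpr F) i j"
      using ij strict_mono_on_imp_inj_on[OF strict_mono_mrows[of F]]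
        strict_mono_on_imp_inj_on[OF strict_mono_mcols[of F]]
      by (intro lookup_place) (simp_all add: cmpr_dims)
    then show ?thesis using ij by (simp add: centry_cmpr)
  next
    case False
    then have "(x, y) \<notin> keys F" unfolding set_mrows set_mcols by force
    moreover have "(x, y) \<notin> keys ?P" using False by (auto simp: keys_place cmpr_dims)
    ultimately show ?thesis by (simp add: in_keys_iff)
  qed
qed

abbreviation mono_of :: "'d::finite cmp \<Rightarrow> 'd mono"
  where "mono_of a \<equiv> place id id a"

lemma cmpr_mono_of [simp]: "cmpr (mono_of a) = a"
  by (rule cmpr_place) (auto simp: strict_mono_on_def)

lemma cmpr_eq_cempty_iff: "cmpr F = cempty \<longleftrightarrow> F = 0"
proof
  assume "cmpr F = cempty"
  then show "F = 0" using place_cmpr[of F] by (simp add: place_def)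
next
  assume "F = 0"
  then show "cmpr F = cempty" by (simp add: crows_eq_0_iff[symmetric] cmpr_dims mrows_def)
qed

lemma cdiag_entry:
  "u < crows a \<Longrightarrow> v < ccols a \<Longrightarrow> centry (cdiag a b) u v = centry a u v"
  "u < crows a \<Longrightarrow> v < ccols b \<Longrightarrow> centry (cdiag a b) u (ccols a + v) = {#}"
  "u < crows b \<Longrightarrow> v < ccols a \<Longrightarrow> centry (cdiag a b) (crows a + u) v = {#}"
  "u < crows b \<Longrightarrow> v < ccols b \<Longrightarrow> centry (cdiag a b) (crows a + u) (ccols a + v) = centry b u v"
  by (transfer; simp add: Let_def)+

lemma sum_lessThan_plus: "(\<Sum>i<m + n. f i) = (\<Sum>i<m. f i) + (\<Sum>i<n. f (m + i))"
  for f :: "nat \<Rightarrow> 'a::comm_monoid_add" and m n :: nat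
  by (induction n) (simp_all add: add.assoc)

lemma place_cdiag:
  "place p q (cdiag a b) = place p q a + place (\<lambda>i. p (crows a + i)) (\<lambda>j. q (ccols a + j)) b"
  by (simp add: place_def cdiag_dims sum_lessThan_plus cdiag_entry)

definition splits :: "'d::finite mono \<Rightarrow> ('d mono \<times> 'd mono) set"
  where "splits F = {(G, H). G + H = F}"

lemma finite_submultisets: "finite {A :: 'd multiset. A \<subseteq># M}"
proof (induction M)
  case (add x M)
  have "A \<in> {A. A \<subseteq># M} \<union> add_mset x ` {A. A \<subseteq># M}" if "A \<subseteq># add_mset x M" for A
  proof (cases "x \<in># A")
    case True
    then obtain B where "A = add_mset x B" by (metis multi_member_split)
    with that show ?thesis by simp
  next
    case False
    then show ?thesis using that
      by (metis UnI1 mem_Collect_eq diff_single_trivial subset_eq_diff_conv add_mset_add_single)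
  qed
  then have "{A. A \<subseteq># add_mset x M} \<subseteq> {A. A \<subseteq># M} \<union> add_mset x ` {A. A \<subseteq># M}" by blast
  then show ?case by (rule finite_subset) (simp add: add)
qed simp

lemma finite_splits: "finite (splits F)"
proof -
  \<comment> \<open>\<open>G\<close> determines \<open>H\<close>, and \<open>G\<close> is determined by its exponents at the positions of \<open>F\<close>\<close>
  let ?f = "\<lambda>(G, H). restrict (lookup G) (keys F)"
  have "?f ` splits F \<subseteq> Pi\<^sub>E (keys F) (\<lambda>k. {A. A \<subseteq># lookup F k})"
    by (auto simp: splits_def lookup_add)
  moreover have "finite (Pi\<^sub>E (keys F) (\<lambda>k. {A. A \<subseteq># lookup F k}))"
    by (intro finite_PiE finite_submultisets) simp
  ultimately have fin: "finite (?f ` splits F)" by (rule finite_subset)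
  have "inj_on ?f (splits F)"
  proof (rule inj_onI, clarify)
    fix G H G' H'
    assume 1: "(G, H) \<in> splits F" "(G', H') \<in> splits F"
      "restrict (lookup G) (keys F) = restrict (lookup G') (keys F)"
    have G: "G = G'"
    proof (rule poly_mapping_eqI)
      fix k
      show "lookup G k = lookup G' k"
      proof (cases "k \<in> keys F")
        case True
        then show ?thesis using 1(3) by (metis restrict_apply')
      next
        case False
        then have "k \<notin> keys G" "k \<notin> keys G'" using 1(1,2) keys_add_multiset[of G H] keys_add_multiset[of G' H']
            by (auto simp: splits_def)
        then show ?thesis by (simp add: in_keys_iff)
      qed
    qed
    moreover have "H = H'"
      using 1(1,2) G by (auto simp: splits_def)
    ultimately show "G = G' \<and> H = H'" by simp
  qed
  with fin show ?thesis by (rule finite_imageD)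
qed

section \<open>The product counts decompositions of monomials\<close>

lemma single_sum: "Poly_Mapping.single k (sum f A) = (\<Sum>i\<in>A. Poly_Mapping.single k (f i))"
  using sum_comp_morphism[of "Poly_Mapping.single k" f A] by (simp add: single_add o_def)

text \<open>Both sides add up the entries of \<open>cdiag a b\<close> along the fibres of \<open>p\<close> and \<open>q\<close>.\<close>

lemma place_qsh_mat:
  assumes "p \<in> qSh (crows a) (crows b) j" "q \<in> qSh (ccols a) (ccols b) k"
  shows "place r s (Abs_cmp (qsh_mat a b j k p q)) = place (\<lambda>u. r (p u)) (\<lambda>v. s (q v)) (cdiag a b)"
proof -
  let ?M = "{..<crows a + crows b}" and ?N = "{..<ccols a + ccols b}" and ?e = "centry (cdiag a b)"
  have p: "p ` ?M \<subseteq> {..<j}" and q: "q ` ?N \<subseteq> {..<k}"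
    using assms by (auto simp: qSh_def)
  have dims: "dim_row (qsh_mat a b j k p q) = j" "dim_col (qsh_mat a b j k p q) = k"
    by (simp_all add: qsh_mat_def)
  have entry: "qsh_mat a b j k p q $$ (x, y) =
      (\<Sum>u\<in>{u \<in> ?M. p u = x}. \<Sum>v\<in>{v \<in> ?N. q v = y}. ?e u v)" if "x < j" "y < k" for x y
    using that by (simp add: qsh_mat_def)
  have "place r s (Abs_cmp (qsh_mat a b j k p q)) =
      (\<Sum>x<j. \<Sum>y<k. Poly_Mapping.single (r x, s y)
        (\<Sum>u\<in>{u \<in> ?M. p u = x}. \<Sum>v\<in>{v \<in> ?N. q v = y}. ?e u v))"
    unfolding place_def Abs_cmp_dims[OF is_cmp_qsh_mat[OF assms]] dims
    by (intro sum.cong refl) (simp add: entry)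
  also have "\<dots> = (\<Sum>x<j. \<Sum>u\<in>{u \<in> ?M. p u = x}. \<Sum>y<k. \<Sum>v\<in>{v \<in> ?N. q v = y}.
        Poly_Mapping.single (r (p u), s (q v)) (?e u v))"
  proof (rule sum.cong[OF refl])
    fix x
    show "(\<Sum>y<k. Poly_Mapping.single (r x, s y)
          (\<Sum>u\<in>{u \<in> ?M. p u = x}. \<Sum>v\<in>{v \<in> ?N. q v = y}. ?e u v)) =
        (\<Sum>u\<in>{u \<in> ?M. p u = x}. \<Sum>y<k. \<Sum>v\<in>{v \<in> ?N. q v = y}.
          Poly_Mapping.single (r (p u), s (q v)) (?e u v))"
      unfolding single_sum by (subst sum.swap) (auto intro!: sum.cong)
  qed
  also have "\<dots> = (\<Sum>u\<in>?M. \<Sum>v\<in>?N. Poly_Mapping.single (r (p u), s (q v)) (?e u v))"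
    by (simp only: sum.group[OF _ _ p] sum.group[OF _ _ q] finite_lessThan)
  finally show ?thesis by (simp add: place_def cdiag_dims)
qed

text \<open>The decompositions of \<open>F\<close> that contribute to the coefficient of \<open>cmpr F\<close> in the product of \<open>a\<close> and
  \<open>b\<close>.\<close>

definition occurrences :: "'d::finite mono \<Rightarrow> 'd cmp \<Rightarrow> 'd cmp \<Rightarrow> ('d mono \<times> 'd mono) set"
  where "occurrences F a b = {(G, H) \<in> splits F. cmpr G = a \<and> cmpr H = b}"

lemma finite_qSh: "finite (qSh m s j)"
  by (rule finite_subset[of _ "{..<m + s} \<rightarrow>\<^sub>E {..<j}"]) (auto simp: qSh_def intro: finite_PiE)

text \<open>Two finite sets of numbers with union \<open>R\<close>, merged into the increasing
  enumeration of \<open>R\<close>, give a quasi-shuffle.\<close>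

lemma qSh_of_union:
  fixes A B :: "nat set"
  assumes fin: "finite A" "finite B"
  defines "r \<equiv> sorted_list_of_set (A \<union> B)"
  shows "\<exists>p\<in>qSh (card A) (card B) (card (A \<union> B)).
    (\<forall>u<card A. r ! p u = sorted_list_of_set A ! u) \<and>
    (\<forall>u<card B. r ! p (card A + u) = sorted_list_of_set B ! u)"
proof -
  let ?m = "card A" and ?s = "card B" and ?j = "card (A \<union> B)"
  have len: "length r = ?j" "length (sorted_list_of_set A) = ?m" "length (sorted_list_of_set B) = ?s"
    by (simp_all add: r_def)
  have sets: "set r = A \<union> B" "set (sorted_list_of_set A) = A" "set (sorted_list_of_set B) = B"
    using fin by (simp_all add: r_def)
  have sorted: "sorted_wrt (<) (sorted_list_of_set A)" "sorted_wrt (<) (sorted_list_of_set B)"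
    "sorted r" "distinct r"
    using fin by (simp_all add: r_def)
  define f where "f u = (if u < ?m then sorted_list_of_set A ! u else sorted_list_of_set B ! (u - ?m))" for u
  have f: "f u \<in> A \<union> B" if "u < ?m + ?s" for u
    using that nth_mem[of u "sorted_list_of_set A"] nth_mem[of "u - ?m" "sorted_list_of_set B"]
    by (auto simp: f_def len sets)
  have "\<exists>i. i < ?j \<and> r ! i = f u" if "u < ?m + ?s" for u
    using f[OF that] sets(1) len(1) by (metis in_set_conv_nth)
  then obtain p0 where p0: "\<And>u. u < ?m + ?s \<Longrightarrow> p0 u < ?j \<and> r ! p0 u = f u" by metis
  \<comment> \<open>members of \<open>qSh\<close> are extensional functions\<close>
  define p where "p = restrict p0 {..<?m + ?s}"
  have p: "p u < ?j" "r ! p u = f u" if "u < ?m + ?s" for u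
    using p0[OF that] that by (simp_all add: p_def)
  have less: "p u < p u'" if "f u < f u'" "u < ?m + ?s" "u' < ?m + ?s" for u u'
    using that p[of u] p[of u'] sorted_nth_mono[OF sorted(3), of "p u'" "p u"] len(1)
    by (metis leD not_le)
  have "strict_mono_on {..<?m} p"
    using sorted_wrt_nth_less[OF sorted(1)] by (auto simp: strict_mono_on_def f_def len intro!: less)
  moreover have "strict_mono_on {?m..<?m + ?s} p"
    using sorted_wrt_nth_less[OF sorted(2)] by (auto simp: strict_mono_on_def f_def len intro!: less)
  moreover have "p ` {..<?m + ?s} = {..<?j}"
  proof (intro equalityI subsetI)
    fix i assume i: "i \<in> {..<?j}"
    then have "r ! i \<in> A \<union> B" using nth_mem[of i r] len sets by auto
    then have "\<exists>u<?m + ?s. f u = r ! i"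
    proof
      assume "r ! i \<in> A"
      then obtain u where "u < ?m" "sorted_list_of_set A ! u = r ! i"
        using sets(2) len(2) by (metis in_set_conv_nth)
      then show ?thesis by (intro exI[of _ u]) (auto simp: f_def)
    next
      assume "r ! i \<in> B"
      then obtain u where "u < ?s" "sorted_list_of_set B ! u = r ! i"
        using sets(3) len(3) by (metis in_set_conv_nth)
      then show ?thesis by (intro exI[of _ "?m + u"]) (auto simp: f_def)
    qed
    then obtain u where u: "u < ?m + ?s" "f u = r ! i" by blast
    with p[OF u(1)] i have "p u = i" using sorted(4) len(1) by (simp add: nth_eq_iff_index_eq)
    with u show "i \<in> p ` {..<?m + ?s}" by blast
  qed (use p in auto)
  moreover have "p \<in> {..<?m + ?s} \<rightarrow>\<^sub>E {..<?j}" using p by (auto simp: p_def)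
  ultimately have "p \<in> qSh ?m ?s ?j" by (simp add: qSh_def)
  moreover have "\<forall>u<?m. r ! p u = sorted_list_of_set A ! u"
    using p(2) by (simp add: f_def)
  moreover have "\<forall>u<?s. r ! p (?m + u) = sorted_list_of_set B ! u"
    using p(2) by (simp add: f_def)
  ultimately show ?thesis by blast
qed

lemma qSh_le: "p \<in> qSh m s j \<Longrightarrow> j \<le> m + s"
  using card_image_le[of "{..<m + s}" p] by (simp add: qSh_def)

lemma qSh_eqI:
  assumes "p \<in> qSh m s j" "p' \<in> qSh m s j"
    and "\<And>u. u < m \<Longrightarrow> p u = p' u" "\<And>u. u < s \<Longrightarrow> p (m + u) = p' (m + u)"
  shows "p = p'"
proof (rule PiE_ext)
  show "p \<in> {..<m + s} \<rightarrow>\<^sub>E {..<j}" "p' \<in> {..<m + s} \<rightarrow>\<^sub>E {..<j}"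
    using assms by (simp_all add: qSh_def)
  show "p u = p' u" if "u \<in> {..<m + s}" for u
    using that assms(3)[of u] assms(4)[of "u - m"] by (cases "u < m") auto
qed

lemma strict_mono_on_qSh:
  assumes "p \<in> qSh m s j" "strict_mono_on {..<j} r"
  shows "strict_mono_on {..<m} (\<lambda>u. r (p u))" "strict_mono_on {..<s} (\<lambda>u. r (p (m + u)))"
proof -
  have "p ` {..<m + s} = {..<j}" "strict_mono_on {..<m} p" "strict_mono_on {m..<m + s} p"
    using assms by (auto simp: qSh_def)
  then have *: "p u < j" if "u < m + s" for u using that by blast
  show "strict_mono_on {..<m} (\<lambda>u. r (p u))"
    using assms(2) * \<open>strict_mono_on {..<m} p\<close> by (auto simp: strict_mono_on_def)
  show "strict_mono_on {..<s} (\<lambda>u. r (p (m + u)))"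
    using assms(2) * \<open>strict_mono_on {m..<m + s} p\<close> by (auto simp: strict_mono_on_def)
qed

text \<open>Placing the rows of \<open>a\<close> and \<open>b\<close> as \<open>p\<close> prescribes, and the columns as \<open>q\<close> prescribes, into the
  non-trivial rows and columns of \<open>F\<close> splits \<open>F\<close> into a part coming from \<open>a\<close> and a part coming from
  \<open>b\<close>. Conversely, the rows of the two parts of a decomposition cover the rows of \<open>F\<close>, and
  \<open>qSh_of_union\<close> recovers \<open>p\<close> from their positions; likewise for \<open>q\<close>.\<close>

lemma bij_betw_qSh_occurrences:
  fixes a b :: "'d::finite cmp" and F :: "'d mono"
  defines "m \<equiv> crows a" and "s \<equiv> crows b" and "n \<equiv> ccols a" and "t \<equiv> ccols b"
    and "r \<equiv> (!) (mrows F)" and "c \<equiv> (!) (mcols F)"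
    and "j \<equiv> length (mrows F)" and "k \<equiv> length (mcols F)"
  shows "bij_betw (\<lambda>(p, q). (place (\<lambda>u. r (p u)) (\<lambda>v. c (q v)) a,
        place (\<lambda>u. r (p (m + u))) (\<lambda>v. c (q (n + v))) b))
      {(p, q) \<in> qSh m s j \<times> qSh n t k. Abs_cmp (qsh_mat a b j k p q) = cmpr F}
      (occurrences F a b)"
    (is "bij_betw ?h ?T _")
proof (rule bij_betw_imageI)
  have r: "strict_mono_on {..<j} r" and c: "strict_mono_on {..<k} c"
    unfolding r_def j_def c_def k_def by (rule strict_mono_mrows strict_mono_mcols)+
  have rinj: "inj_on r {..<j}" and cinj: "inj_on c {..<k}"
    using r c by (simp_all add: strict_mono_on_imp_inj_on)
  note sm = strict_mono_on_qSh[OF _ r] strict_mono_on_qSh[OF _ c]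
  have inv: "map (\<lambda>u. r (p u)) [0..<m] = mrows (fst (?h (p, q)))"
      "map (\<lambda>u. r (p (m + u))) [0..<s] = mrows (snd (?h (p, q)))"
      "map (\<lambda>v. c (q v)) [0..<n] = mcols (fst (?h (p, q)))"
      "map (\<lambda>v. c (q (n + v))) [0..<t] = mcols (snd (?h (p, q)))"
    if "p \<in> qSh m s j" "q \<in> qSh n t k" for p q
    using sm(1,2)[OF that(1)] sm(3,4)[OF that(2)]
    by (simp_all add: mrows_place mcols_place m_def n_def s_def t_def)
  show "inj_on ?h ?T"
  proof (rule inj_onI)
    fix x y assume xy: "x \<in> ?T" "y \<in> ?T" "?h x = ?h y"
    obtain p q p' q' where [simp]: "x = (p, q)" "y = (p', q')" by (metis surj_pair)
    have pq: "p \<in> qSh m s j" "q \<in> qSh n t k" "p' \<in> qSh m s j" "q' \<in> qSh n t k"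
      using xy by auto
    have lt: "p u < j" "p' u < j" if "u < m + s" for u
      using that pq by (auto simp: qSh_def)
    have lt2: "q u < k" "q' u < k" if "u < n + t" for u
      using that pq by (auto simp: qSh_def)
    have h: "?h (p, q) = ?h (p', q')" using xy(3) by simp
    have "p = p'"
    proof (rule qSh_eqI[OF pq(1,3)])
      show "p u = p' u" if "u < m" for u
        using trans[OF inv(1)[OF pq(1,2)] trans[OF arg_cong[OF h, of "\<lambda>z. mrows (fst z)"] inv(1)[OF pq(3,4), symmetric]]]
          that lt[of u] rinj
        by (auto simp: inj_on_def)
      show "p (m + u) = p' (m + u)" if "u < s" for u
        using trans[OF inv(2)[OF pq(1,2)] trans[OF arg_cong[OF h, of "\<lambda>z. mrows (snd z)"] inv(2)[OF pq(3,4), symmetric]]]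
          that lt[of "m + u"] rinj
        by (auto simp: inj_on_def)
    qed
    moreover have "q = q'"
    proof (rule qSh_eqI[OF pq(2,4)])
      show "q u = q' u" if "u < n" for u
        using trans[OF inv(3)[OF pq(1,2)] trans[OF arg_cong[OF h, of "\<lambda>z. mcols (fst z)"] inv(3)[OF pq(3,4), symmetric]]]
          that lt2[of u] cinj
        by (auto simp: inj_on_def)
      show "q (n + u) = q' (n + u)" if "u < t" for u
        using trans[OF inv(4)[OF pq(1,2)] trans[OF arg_cong[OF h, of "\<lambda>z. mcols (snd z)"] inv(4)[OF pq(3,4), symmetric]]]
          that lt2[of "n + u"] cinj
        by (auto simp: inj_on_def)
    qed
    ultimately show "x = y" by simp
  qed
  show "?h ` ?T = occurrences F a b"
  proof (intro equalityI subsetI)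
    fix z assume "z \<in> ?h ` ?T"
    then obtain p q where pq: "p \<in> qSh m s j" "q \<in> qSh n t k" "z = ?h (p, q)"
      "Abs_cmp (qsh_mat a b j k p q) = cmpr F" by auto
    have "fst z + snd z = place (\<lambda>u. r (p u)) (\<lambda>v. c (q v)) (cdiag a b)"
      using pq(3) by (simp add: place_cdiag m_def n_def)
    also have "\<dots> = place r c (Abs_cmp (qsh_mat a b j k p q))"
      using pq(1,2) by (simp add: place_qsh_mat m_def n_def s_def t_def)
    also have "\<dots> = F" using pq(4) by (simp add: place_cmpr r_def c_def)
    finally have "z \<in> splits F" by (auto simp: splits_def)
    moreover have "cmpr (fst z) = a" "cmpr (snd z) = b"
      using sm(1,2)[OF pq(1)] sm(3,4)[OF pq(2)] pq(3)
      by (simp_all add: cmpr_place m_def n_def s_def t_def)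
    ultimately show "z \<in> occurrences F a b" by (auto simp: occurrences_def)
  next
    fix z assume "z \<in> occurrences F a b"
    then obtain G H where z: "z = (G, H)" "G + H = F" "cmpr G = a" "cmpr H = b"
      by (auto simp: occurrences_def splits_def)
    have un: "fst ` keys F = fst ` keys G \<union> fst ` keys H" "snd ` keys F = snd ` keys G \<union> snd ` keys H"
      by (auto simp: z(2)[symmetric] keys_add_multiset)
    have dims: "m = card (fst ` keys G)" "s = card (fst ` keys H)"
      "n = card (snd ` keys G)" "t = card (snd ` keys H)"
      using z(3,4) by (auto simp: m_def s_def n_def t_def cmpr_dims mrows_def mcols_def)
    have jk: "j = card (fst ` keys F)" "k = card (snd ` keys F)"
      by (simp_all add: j_def k_def mrows_def mcols_def)
    obtain p where p: "p \<in> qSh m s j" "\<And>u. u < m \<Longrightarrow> r (p u) = mrows G ! u"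
      "\<And>u. u < s \<Longrightarrow> r (p (m + u)) = mrows H ! u"
      using qSh_of_union[of "fst ` keys G" "fst ` keys H"]
      unfolding dims jk r_def mrows_def un by auto
    obtain q where q: "q \<in> qSh n t k" "\<And>v. v < n \<Longrightarrow> c (q v) = mcols G ! v"
      "\<And>v. v < t \<Longrightarrow> c (q (n + v)) = mcols H ! v"
      using qSh_of_union[of "snd ` keys G" "snd ` keys H"]
      unfolding dims jk c_def mcols_def un by auto
    have "place (\<lambda>u. r (p u)) (\<lambda>v. c (q v)) a = place ((!) (mrows G)) ((!) (mcols G)) a"
      using p(2) q(2) by (auto simp: place_def m_def n_def intro!: sum.cong)
    also have "\<dots> = G" using z(3) place_cmpr by blast
    finally have G: "place (\<lambda>u. r (p u)) (\<lambda>v. c (q v)) a = G" .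
    have "place (\<lambda>u. r (p (m + u))) (\<lambda>v. c (q (n + v))) b = place ((!) (mrows H)) ((!) (mcols H)) b"
      using p(3) q(3) by (auto simp: place_def s_def t_def intro!: sum.cong)
    also have "\<dots> = H" using z(4) place_cmpr by blast
    finally have H: "place (\<lambda>u. r (p (m + u))) (\<lambda>v. c (q (n + v))) b = H" .
    have "place r c (Abs_cmp (qsh_mat a b j k p q)) = F"
      using p(1) q(1) G H z(2) by (simp add: place_qsh_mat place_cdiag m_def n_def s_def t_def)
    moreover have "cmpr (place r c (Abs_cmp (qsh_mat a b j k p q))) = Abs_cmp (qsh_mat a b j k p q)"
    proof (rule cmpr_place)
      have "is_cmp (qsh_mat a b j k p q)"
        using p(1) q(1) by (simp add: is_cmp_qsh_mat m_def n_def s_def t_def)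
      then have "crows (Abs_cmp (qsh_mat a b j k p q)) = j" "ccols (Abs_cmp (qsh_mat a b j k p q)) = k"
        by (simp_all add: Abs_cmp_dims) (simp_all add: qsh_mat_def)
      then show "strict_mono_on {..<crows (Abs_cmp (qsh_mat a b j k p q))} r"
        "strict_mono_on {..<ccols (Abs_cmp (qsh_mat a b j k p q))} c"
        using r c by simp_all
    qed
    ultimately have "(p, q) \<in> ?T" using p(1) q(1) by simp
    moreover have "z = ?h (p, q)" using G H z(1) by simp
    ultimately show "z \<in> ?h ` ?T" by blast
  qed
qed

text \<open>Only the quasi-shuffles onto the shape of \<open>cmpr F\<close> contribute. If a factor is empty, there is the
  single decomposition in which the other part is all of \<open>F\<close>.\<close>

lemma lookup_qsh_basis: "lookup (qsh_basis a b) (cmpr F) = (of_nat (card (occurrences F a b)) :: 'k::comm_ring_1)"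
proof -
  consider "a = cempty" | "b = cempty" "a \<noteq> cempty" | "a \<noteq> cempty" "b \<noteq> cempty" by blast
  then show ?thesis
  proof cases
    case 1
    have "G + H = F \<and> G = 0 \<and> cmpr H = b \<longleftrightarrow> G = 0 \<and> H = F \<and> cmpr F = b" for G H
      by (metis add_0)
    then have "occurrences F a b = (if cmpr F = b then {(0, F)} else {})"
      unfolding 1 occurrences_def splits_def by (simp add: cmpr_eq_cempty_iff)
    then show ?thesis using 1 by (simp add: qsh_basis_def lookup_basis)
  next
    case 2
    have "G + H = F \<and> cmpr G = a \<and> H = 0 \<longleftrightarrow> H = 0 \<and> G = F \<and> cmpr F = a" for G H
      by (metis add_0_right)
    then have "occurrences F a b = (if cmpr F = a then {(F, 0)} else {})"
      unfolding 2 occurrences_def splits_def by (auto simp: cmpr_eq_cempty_iff)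
    then show ?thesis using 2 by (simp add: qsh_basis_def lookup_basis)
  next
    case 3
    let ?m = "crows a" and ?s = "crows b" and ?n = "ccols a" and ?t = "ccols b"
    let ?j = "length (mrows F)" and ?k = "length (mcols F)"
    let ?Q = "\<lambda>j k. qSh ?m ?s j \<times> qSh ?n ?t k"
    define N where "N j k = card {(p, q) \<in> ?Q j k. Abs_cmp (qsh_mat a b j k p q) = cmpr F}" for j k
    have "lookup (qsh_basis a b) (cmpr F) = (\<Sum>j\<in>{1..?m + ?s}. \<Sum>k\<in>{1..?n + ?t}. of_nat (N j k) :: 'k)"
    proof -
      have "(\<Sum>p\<in>qSh ?m ?s j. \<Sum>q\<in>qSh ?n ?t k.
          lookup (basis (Abs_cmp (qsh_mat a b j k p q))) (cmpr F)) = (of_nat (N j k) :: 'k)" for j k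
      proof -
        have "(\<Sum>p\<in>qSh ?m ?s j. \<Sum>q\<in>qSh ?n ?t k.
            lookup (basis (Abs_cmp (qsh_mat a b j k p q))) (cmpr F)) =
          (\<Sum>z\<in>?Q j k. if Abs_cmp (qsh_mat a b j k (fst z) (snd z)) = cmpr F then 1 else (0 :: 'k))"
          unfolding sum.cartesian_product by (intro sum.cong) (auto simp: lookup_basis)
        also have "\<dots> = of_nat (card {z \<in> ?Q j k. Abs_cmp (qsh_mat a b j k (fst z) (snd z)) = cmpr F})"
          by (simp add: sum.If_cases finite_qSh Int_def)
        also have "{z \<in> ?Q j k. Abs_cmp (qsh_mat a b j k (fst z) (snd z)) = cmpr F} =
            {(p, q) \<in> ?Q j k. Abs_cmp (qsh_mat a b j k p q) = cmpr F}" by auto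
        finally show ?thesis by (simp add: N_def)
      qed
      then show ?thesis using 3 by (simp add: qsh_basis_def lookup_sum)
    qed
    moreover have N0: "N j k = 0" if "\<not> (j = ?j \<and> k = ?k \<and> 1 \<le> j \<and> j \<le> ?m + ?s \<and> 1 \<le> k \<and> k \<le> ?n + ?t)" for j k
    proof -
      have "{(p, q) \<in> ?Q j k. Abs_cmp (qsh_mat a b j k p q) = cmpr F} = {}"
      proof (rule ccontr)
        assume "\<not> ?thesis"
        then obtain p q where p: "p \<in> qSh ?m ?s j" and q: "q \<in> qSh ?n ?t k"
          and eq: "Abs_cmp (qsh_mat a b j k p q) = cmpr F" by blast
        have "is_cmp (qsh_mat a b j k p q)" using p q by (rule is_cmp_qsh_mat)
        then have "j = ?j" "k = ?k"
          using arg_cong[OF eq, of crows] arg_cong[OF eq, of ccols]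
          by (simp_all add: Abs_cmp_dims cmpr_dims) (simp_all add: qsh_mat_def)
        moreover have "?m > 0" "?n > 0" using 3 crows_eq_0_iff ccols_eq_0_iff by (metis gr0I)+
        then have "p 0 \<in> {..<j}" "q 0 \<in> {..<k}" using p q by (auto simp: qSh_def)
        then have "1 \<le> j" "1 \<le> k" by auto
        ultimately show False using that qSh_le[OF p] qSh_le[OF q] by auto
      qed
      then show ?thesis unfolding N_def by (simp only: card.empty)
    qed
    have "(\<Sum>j\<in>{1..?m + ?s}. \<Sum>k\<in>{1..?n + ?t}. of_nat (N j k) :: 'k) = of_nat (N ?j ?k)"
    proof -
      have "(\<Sum>k\<in>{1..?n + ?t}. of_nat (N j k) :: 'k) = of_nat (N j ?k)" for j
      proof -
        have "(\<Sum>k\<in>{1..?n + ?t}. of_nat (N j k) :: 'k) =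
            (\<Sum>k\<in>{1..?n + ?t}. if k = ?k then of_nat (N j ?k) else 0)"
          by (intro sum.cong) (auto simp: N0)
        also have "\<dots> = of_nat (N j ?k)" using N0[of j ?k] by auto
        finally show ?thesis .
      qed
      then have "(\<Sum>j\<in>{1..?m + ?s}. \<Sum>k\<in>{1..?n + ?t}. of_nat (N j k) :: 'k) =
          (\<Sum>j\<in>{1..?m + ?s}. if j = ?j then of_nat (N ?j ?k) else 0)"
        by (intro sum.cong) (auto simp: N0)
      also have "\<dots> = of_nat (N ?j ?k)" using N0[of ?j ?k] by auto
      finally show ?thesis .
    qed
    moreover have "N ?j ?k = card (occurrences F a b)"
      unfolding N_def by (rule bij_betw_same_card[OF bij_betw_qSh_occurrences])
    ultimately show ?thesis by simp
  qed
qed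

text \<open>The map that sends a composition to the sum of all monomials that compress to it
  turns the product into the multiplication of power series.\<close>

lemma lookup_qsh:
  fixes x y :: "'d::finite cmp \<Rightarrow>\<^sub>0 'k::comm_ring_1"
  shows "lookup (qsh x y) (cmpr F) =
    (\<Sum>z\<in>splits F. lookup x (cmpr (fst z)) * lookup y (cmpr (snd z)))"
  unfolding qsh_def
proof (rule lookup_bilin_count[OF finite_splits])
  fix a b :: "'d cmp"
  have "occurrences F a b = {z \<in> splits F. a = cmpr (fst z) \<and> b = cmpr (snd z)}"
    unfolding occurrences_def by force
  then have "of_nat (card (occurrences F a b)) =
      (\<Sum>z\<in>splits F. if a = cmpr (fst z) \<and> b = cmpr (snd z) then 1 else 0 :: 'k)"
    by (simp add: sum.If_cases finite_splits Int_def)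
  also have "\<dots> = (\<Sum>z\<in>splits F.
      (if a = cmpr (fst z) then 1 else 0) * (if b = cmpr (snd z) then 1 else 0))"
    by (rule sum.cong) simp_all
  finally show "lookup (qsh_basis a b) (cmpr F) = (\<Sum>z\<in>splits F.
      (if a = cmpr (fst z) then 1 else 0) * (if b = cmpr (snd z) then 1 else 0) :: 'k)"
    by (simp only: lookup_qsh_basis)
qed

lemma cmp_pm_eqI: "(\<And>F. lookup x (cmpr F) = lookup y (cmpr F)) \<Longrightarrow> x = y"
  for x y :: "'d::finite cmp \<Rightarrow>\<^sub>0 'k::comm_ring_1"
  by (rule poly_mapping_eqI) (metis cmpr_mono_of)

lemma qsh_commute: "qsh x y = qsh y x"
proof (rule cmp_pm_eqI)
  fix F
  show "lookup (qsh x y) (cmpr F) = lookup (qsh y x) (cmpr F)"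
    unfolding lookup_qsh
    by (rule sum.reindex_bij_witness[of _ prod.swap prod.swap])
      (auto simp: splits_def add.commute mult.commute)
qed

text \<open>Both bracketings sum over the decompositions of \<open>F\<close> into three monomials.\<close>

lemma qsh_assoc: "qsh (qsh x y) z = qsh x (qsh y z)"
proof (rule cmp_pm_eqI)
  fix F
  let ?f = "\<lambda>G H K. lookup x (cmpr G) * lookup y (cmpr H) * lookup z (cmpr K)"
  have "lookup (qsh (qsh x y) z) (cmpr F) =
      (\<Sum>s\<in>splits F. \<Sum>t\<in>splits (fst s). ?f (fst t) (snd t) (snd s))"
    by (simp only: lookup_qsh sum_distrib_right)
  also have "\<dots> = (\<Sum>z\<in>(SIGMA s:splits F. splits (fst s)).
      ?f (fst (snd z)) (snd (snd z)) (snd (fst z)))"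
    by (subst sum.Sigma) (simp_all add: finite_splits split_def)
  also have "\<dots> = (\<Sum>z\<in>(SIGMA s:splits F. splits (snd s)).
      ?f (fst (fst z)) (fst (snd z)) (snd (snd z)))"
    by (rule sum.reindex_bij_witness[of _ "\<lambda>((G, B), (H, K)). ((G + H, K), (G, H))"
          "\<lambda>((A, K), (G, H)). ((G, H + K), (H, K))"])
      (clarsimp simp: splits_def add.assoc)+
  also have "\<dots> = (\<Sum>s\<in>splits F. \<Sum>t\<in>splits (snd s). ?f (fst s) (fst t) (snd t))"
    by (subst sum.Sigma) (simp_all add: finite_splits split_def)
  also have "\<dots> = lookup (qsh x (qsh y z)) (cmpr F)"
    by (simp only: lookup_qsh sum_distrib_left mult.assoc)
  finally show "lookup (qsh (qsh x y) z) (cmpr F) = lookup (qsh x (qsh y z)) (cmpr F)" .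
qed

lemma qsh_linear: "module_hom scl scl (\<lambda>x. qsh x y)" "module_hom scl scl (qsh x)"
  by (simp_all add: qsh_def bilin_bilinear)

lemma qsh_unit [simp]: "qsh (basis cempty) x = x" "qsh x (basis cempty) = x"
proof -
  show "qsh (basis cempty) x = x"
  proof (rule lin_ext[OF qsh_linear(2)])
    show "module_hom scl scl (\<lambda>x. x)" by unfold_locales auto
    show "qsh (basis cempty) (basis b) = basis b" for b
      by (simp add: qsh_def qsh_basis_def)
  qed
  then show "qsh x (basis cempty) = x" by (simp add: qsh_commute)
qed

section \<open>The bialgebra structure\<close>

lemma place_cong:
  assumes "\<And>i. i < crows a \<Longrightarrow> p i = p' i" "\<And>j. j < ccols a \<Longrightarrow> q j = q' j"
  shows "place p q a = place p' q' a"
  using assms by (simp add: place_def)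

lemma mono_of_inject: "mono_of a = mono_of b \<Longrightarrow> a = b"
  by (metis cmpr_mono_of)

lemma place_cempty [simp]: "place p q cempty = 0"
  by (simp add: place_def)

lemma cdiag_assoc: "cdiag (cdiag a b) c = cdiag a (cdiag b c)"
  by (rule mono_of_inject) (simp add: place_cdiag cdiag_dims add.assoc)

lemma cdiag_cempty [simp]: "cdiag cempty a = a" "cdiag a cempty = a"
  by (rule mono_of_inject, simp add: place_cdiag id_def)+

text \<open>Then \<open>F + G\<close> is block diagonal with blocks \<open>F\<close> and \<open>G\<close>, up to trivial rows and columns.\<close>

definition below :: "'d::finite mono \<Rightarrow> 'd mono \<Rightarrow> bool"
  where "below F G \<longleftrightarrow> (\<forall>(i, j)\<in>keys F. \<forall>(i', j')\<in>keys G. i < i' \<and> j < j')"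

lemma below_subset: "below F G \<Longrightarrow> keys F' \<subseteq> keys F \<Longrightarrow> keys G' \<subseteq> keys G \<Longrightarrow> below F' G'"
  unfolding below_def by blast

lemma below_disjoint: "below F G \<Longrightarrow> keys F \<inter> keys G = {}"
  unfolding below_def by fastforce

lemma cmpr_add_below:
  assumes "below F G"
  shows "cmpr (F + G) = cdiag (cmpr F) (cmpr G)"
proof -
  let ?a = "cmpr F" and ?b = "cmpr G"
  define p where "p = (!) (mrows F @ mrows G)"
  define q where "q = (!) (mcols F @ mcols G)"
  have "sorted_wrt (<) (mrows F @ mrows G)"
    using assms set_mrows[of F] set_mrows[of G]
    by (fastforce simp: sorted_wrt_append mrows_def below_def)
  then have p: "strict_mono_on {..<crows (cdiag ?a ?b)} p"
    using sorted_wrt_nth_less unfolding p_def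
    by (fastforce simp: strict_mono_on_def cdiag_dims cmpr_dims)
  have "sorted_wrt (<) (mcols F @ mcols G)"
    using assms set_mcols[of F] set_mcols[of G]
    by (fastforce simp: sorted_wrt_append mcols_def below_def)
  then have q: "strict_mono_on {..<ccols (cdiag ?a ?b)} q"
    using sorted_wrt_nth_less unfolding q_def
    by (fastforce simp: strict_mono_on_def cdiag_dims cmpr_dims)
  have "place p q ?a = place ((!) (mrows F)) ((!) (mcols F)) ?a"
    by (rule place_cong) (simp_all add: p_def q_def nth_append cmpr_dims)
  moreover have "place (\<lambda>i. p (crows ?a + i)) (\<lambda>j. q (ccols ?a + j)) ?b =
      place ((!) (mrows G)) ((!) (mcols G)) ?b"
    by (rule place_cong) (simp_all add: p_def q_def nth_append cmpr_dims)
  ultimately have "place p q (cdiag ?a ?b) = F + G"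
    by (simp add: place_cdiag place_cmpr)
  then show ?thesis using cmpr_place[OF p q] by simp
qed

lemma obtain_below:
  obtains F G where "below F G" "cmpr F = a" "cmpr G = b"
proof -
  let ?G = "place (\<lambda>i. crows a + i) (\<lambda>j. ccols a + j) b"
  have "below (mono_of a) ?G" by (auto simp: below_def keys_place)
  moreover have "cmpr ?G = b" by (rule cmpr_place) (auto simp: strict_mono_on_def)
  ultimately show ?thesis using that cmpr_mono_of by blast
qed

lemma splits_keys: "z \<in> splits F \<Longrightarrow> keys (fst z) \<subseteq> keys F \<and> keys (snd z) \<subseteq> keys F"
  using keys_add_multiset[of "fst z" "snd z"] by (auto simp: splits_def)

text \<open>Monomials without common variables are decomposed independently; the parts are recovered by
  restriction to the variables of \<open>F\<close> and to the remaining variables.\<close>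

lemma sum_splits_add:
  fixes F G :: "'d::finite mono"
  assumes "keys F \<inter> keys G = {}"
  shows "(\<Sum>z\<in>splits (F + G). f (fst z) (snd z)) =
    (\<Sum>s\<in>splits F. \<Sum>t\<in>splits G. f (fst s + fst t) (snd s + snd t))"
proof -
  define res where "res K P = Poly_Mapping.mapp (\<lambda>k v. if k \<in> K then v else 0) P"
    for K :: "(nat \<times> nat) set" and P :: "'d mono"
  have res: "lookup (res K P) k = (if k \<in> K then lookup P k else 0)" for K P k
    by (simp add: res_def lookup_mapp when_def in_keys_iff)
  have res_add: "res K (P + Q) = res K P + res K Q" for K P Q
    by (rule poly_mapping_eqI) (simp add: res lookup_add)
  have res_compl: "res K P + res (- K) P = P" for K P
    by (rule poly_mapping_eqI) (simp add: res lookup_add)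
  have res_id: "res K P = P" if "keys P \<subseteq> K" for K P
    using that by (intro poly_mapping_eqI) (auto simp: res in_keys_iff)
  have res_0: "res K P = 0" if "keys P \<inter> K = {}" for K P
    using that by (intro poly_mapping_eqI) (auto simp: res in_keys_iff)
  let ?K = "keys F"
  have K: "res ?K F = F" "res ?K G = 0" "res (- ?K) F = 0" "res (- ?K) G = G"
    using assms by (auto intro!: res_id res_0)
  have "(\<Sum>z\<in>splits (F + G). f (fst z) (snd z)) =
    (\<Sum>w\<in>splits F \<times> splits G. f (fst (fst w) + fst (snd w)) (snd (fst w) + snd (snd w)))"
  proof (rule sum.reindex_bij_witness[of _
        "\<lambda>w. (fst (fst w) + fst (snd w), snd (fst w) + snd (snd w))"
        "\<lambda>z. ((res ?K (fst z), res ?K (snd z)), (res (- ?K) (fst z), res (- ?K) (snd z)))"])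
    fix z assume "z \<in> splits (F + G)"
    then have z: "fst z + snd z = F + G" by (auto simp: splits_def)
    show "((res ?K (fst z), res ?K (snd z)), (res (- ?K) (fst z), res (- ?K) (snd z))) \<in> splits F \<times> splits G"
      by (simp add: splits_def res_add[symmetric] z) (simp add: res_add K)
  next
    fix w assume w: "w \<in> splits F \<times> splits G"
    then have "fst w \<in> splits F" "snd w \<in> splits G" by auto
    from splits_keys[OF this(1)] splits_keys[OF this(2)]
    have "res ?K (fst (fst w)) = fst (fst w)" "res ?K (snd (fst w)) = snd (fst w)"
      "res ?K (fst (snd w)) = 0" "res ?K (snd (snd w)) = 0"
      "res (- ?K) (fst (fst w)) = 0" "res (- ?K) (snd (fst w)) = 0"
      "res (- ?K) (fst (snd w)) = fst (snd w)" "res (- ?K) (snd (snd w)) = snd (snd w)"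
      using assms by (auto intro!: res_id res_0)
    then show "((res ?K (fst (fst (fst w) + fst (snd w), snd (fst w) + snd (snd w))),
          res ?K (snd (fst (fst w) + fst (snd w), snd (fst w) + snd (snd w)))),
        (res (- ?K) (fst (fst (fst w) + fst (snd w), snd (fst w) + snd (snd w))),
          res (- ?K) (snd (fst (fst w) + fst (snd w), snd (fst w) + snd (snd w))))) = w"
      by (simp add: res_add)
    have FG: "F = fst (fst w) + snd (fst w)" "G = fst (snd w) + snd (snd w)"
      using w by (auto simp: splits_def)
    have "(fst (fst w) + fst (snd w)) + (snd (fst w) + snd (snd w)) = F + G"
      unfolding FG by (simp only: ac_simps)
    then show "(fst (fst w) + fst (snd w), snd (fst w) + snd (snd w)) \<in> splits (F + G)"
      by (simp add: splits_def)
  qed (simp_all add: res_compl)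
  then show ?thesis by (simp add: sum.cartesian_product split_def)
qed

text \<open>Deconcatenation is dual to \<open>cdiag\<close>.\<close>

lemma lookup_deconc:
  fixes x :: "'d::finite cmp \<Rightarrow>\<^sub>0 'k::comm_ring_1"
  shows "lookup (deconc x) (b, c) = lookup x (cdiag b c)"
proof -
  have "lookup (\<Sum>(b, c) | cdiag b c = a. tensor (basis b) (basis c)) (b, c) =
      (if a = cdiag b c then 1 else 0 :: 'k)" for a
  proof -
    have "lookup (\<Sum>(b, c) | cdiag b c = a. tensor (basis b) (basis c)) (b, c) =
        (\<Sum>z\<in>{(b, c). cdiag b c = a}. if z = (b, c) then 1 else 0 :: 'k)"
      unfolding lookup_sum by (rule sum.cong) (auto simp: lookup_basis)
    then show ?thesis by (simp add: finite_cdiag_eq)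
  qed
  then show ?thesis unfolding deconc_def lookup_lin by (simp only: sum_keys_delta)
qed

lemma cunit_1: "cunit 1 = basis cempty"
  by (simp add: cunit_def)

lemma splits_0: "splits 0 = {(0, 0)}"
proof -
  have "G + H = 0 \<longleftrightarrow> G = 0 \<and> H = 0" for G H :: "'a mono"
    using keys_add_multiset[of G H] by auto
  then show ?thesis unfolding splits_def by auto
qed

text \<open>The counterpart of \<open>lookup_qsh\<close> in two independent sets of variables.\<close>

lemma lookup_tensor_mult:
  fixes s t :: "'d::finite cmp \<times> 'd cmp \<Rightarrow>\<^sub>0 'k::comm_ring_1"
  shows "lookup (tensor_mult qsh s t) (cmpr F, cmpr G) =
    (\<Sum>z\<in>splits F. \<Sum>w\<in>splits G. lookup s (cmpr (fst z), cmpr (fst w)) * lookup t (cmpr (snd z), cmpr (snd w)))"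
proof -
  have "lookup (tensor_mult qsh s t) (cmpr F, cmpr G) = (\<Sum>z\<in>splits F \<times> splits G.
      lookup s (cmpr (fst (fst z)), cmpr (fst (snd z))) * lookup t (cmpr (snd (fst z)), cmpr (snd (snd z))))"
    unfolding tensor_mult_def
  proof (rule lookup_bilin_count)
    show "finite (splits F \<times> splits G)" by (simp add: finite_splits)
  next
    fix a b :: "'d cmp \<times> 'd cmp"
    let ?d = "\<lambda>a c. if a = c then 1 else 0 :: 'k"
    obtain a1 a2 b1 b2 where ab: "a = (a1, a2)" "b = (b1, b2)" by (metis surj_pair)
    have "lookup ((\<lambda>(a, b) (c, d). tensor (qsh (basis a) (basis c)) (qsh (basis b) (basis d))) a b)
        (cmpr F, cmpr G) =
      lookup (qsh (basis a1) (basis b1)) (cmpr F) * lookup (qsh (basis a2) (basis b2)) (cmpr G)"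
      by (simp add: ab lookup_tensor)
    also have "\<dots> = (\<Sum>z\<in>splits F. \<Sum>w\<in>splits G.
        (?d (cmpr (fst z)) a1 * ?d (cmpr (snd z)) b1) * (?d (cmpr (fst w)) a2 * ?d (cmpr (snd w)) b2))"
      by (simp only: lookup_qsh lookup_basis sum_product)
    also have "\<dots> = (\<Sum>z\<in>splits F \<times> splits G.
        ?d a (cmpr (fst (fst z)), cmpr (fst (snd z))) * ?d b (cmpr (snd (fst z)), cmpr (snd (snd z))))"
      unfolding sum.cartesian_product ab by (rule sum.cong) auto
    finally show "lookup ((\<lambda>(a, b) (c, d). tensor (qsh (basis a) (basis c)) (qsh (basis b) (basis d))) a b)
        (cmpr F, cmpr G) = (\<Sum>z\<in>splits F \<times> splits G.
        ?d a (cmpr (fst (fst z)), cmpr (fst (snd z))) * ?d b (cmpr (snd (fst z)), cmpr (snd (snd z))))" .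
  qed
  then show ?thesis by (simp add: sum.cartesian_product split_def)
qed

text \<open>By duality, the left-hand side is read off at a block diagonal monomial \<open>F + G\<close> with \<open>F\<close> before
  \<open>G\<close>. Its decompositions are pairs of decompositions of \<open>F\<close> and of \<open>G\<close>, and both parts are block
  diagonal again.\<close>

lemma deconc_qsh:
  fixes x y :: "'d::finite cmp \<Rightarrow>\<^sub>0 'k::comm_ring_1"
  shows "deconc (qsh x y) = tensor_mult qsh (deconc x) (deconc y)"
proof (rule poly_mapping_eqI, clarify)
  fix c d :: "'d cmp"
  obtain F G where FG: "below F G" "cmpr F = c" "cmpr G = d" by (rule obtain_below)
  have "lookup (deconc (qsh x y)) (c, d) = lookup (qsh x y) (cmpr (F + G))"
    using FG by (simp add: lookup_deconc cmpr_add_below)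
  also have "\<dots> = (\<Sum>s\<in>splits F. \<Sum>t\<in>splits G.
      lookup x (cmpr (fst s + fst t)) * lookup y (cmpr (snd s + snd t)))"
    unfolding lookup_qsh by (rule sum_splits_add[OF below_disjoint[OF FG(1)]])
  also have "\<dots> = (\<Sum>s\<in>splits F. \<Sum>t\<in>splits G.
      lookup (deconc x) (cmpr (fst s), cmpr (fst t)) * lookup (deconc y) (cmpr (snd s), cmpr (snd t)))"
  proof (intro sum.cong refl)
    fix s t assume "s \<in> splits F" "t \<in> splits G"
    then have "below (fst s) (fst t)" "below (snd s) (snd t)"
      using splits_keys below_subset[OF FG(1)] by blast+
    then show "lookup x (cmpr (fst s + fst t)) * lookup y (cmpr (snd s + snd t)) =
      lookup (deconc x) (cmpr (fst s), cmpr (fst t)) * lookup (deconc y) (cmpr (snd s), cmpr (snd t))"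
      by (simp add: lookup_deconc cmpr_add_below)
  qed
  also have "\<dots> = lookup (tensor_mult qsh (deconc x) (deconc y)) (c, d)"
    using FG(2,3) lookup_tensor_mult[of "deconc x" "deconc y" F G] by simp
  finally show "lookup (deconc (qsh x y)) (c, d) = lookup (tensor_mult qsh (deconc x) (deconc y)) (c, d)" .
qed

lemma deconc_coassoc: "tensor_assoc (tensor_map deconc id (deconc x)) = tensor_map id deconc (deconc x)"
proof (rule poly_mapping_eqI, clarify)
  fix a b c
  have "lookup (tensor_assoc (tensor_map deconc id (deconc x))) (a, b, c) =
      (\<Sum>z\<in>keys (deconc x). lookup (deconc x) z * (if z = (cdiag a b, c) then 1 else 0))"
    unfolding lookup_tensor_assoc lookup_tensor_map
    by (rule sum.cong) (auto simp: lookup_deconc lookup_basis split: if_splits)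
  moreover have "lookup (tensor_map id deconc (deconc x)) (a, b, c) =
      (\<Sum>z\<in>keys (deconc x). lookup (deconc x) z * (if z = (a, cdiag b c) then 1 else 0))"
    unfolding lookup_tensor_map
    by (rule sum.cong) (auto simp: lookup_deconc lookup_basis split: if_splits)
  ultimately show "lookup (tensor_assoc (tensor_map deconc id (deconc x))) (a, b, c) =
      lookup (tensor_map id deconc (deconc x)) (a, b, c)"
    unfolding sum_keys_delta by (simp add: lookup_deconc cdiag_assoc)
qed

lemma deconc_counit:
  "lin (\<lambda>(a, b). scl (ccounit (basis a)) (basis b)) (deconc x) = x"
  "lin (\<lambda>(a, b). scl (ccounit (basis b)) (basis a)) (deconc x) = x"
proof -
  show "lin (\<lambda>(a, b). scl (ccounit (basis a)) (basis b)) (deconc x) = x"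
  proof (rule poly_mapping_eqI)
    fix c
    have "lookup (lin (\<lambda>(a, b). scl (ccounit (basis a)) (basis b)) (deconc x)) c =
        (\<Sum>z\<in>keys (deconc x). lookup (deconc x) z * (if z = (cempty, c) then 1 else 0))"
      unfolding lookup_lin by (rule sum.cong) (auto simp: lookup_basis ccounit_def split: if_splits)
    then show "lookup (lin (\<lambda>(a, b). scl (ccounit (basis a)) (basis b)) (deconc x)) c = lookup x c"
      unfolding sum_keys_delta by (simp add: lookup_deconc)
  qed
  show "lin (\<lambda>(a, b). scl (ccounit (basis b)) (basis a)) (deconc x) = x"
  proof (rule poly_mapping_eqI)
    fix c
    have "lookup (lin (\<lambda>(a, b). scl (ccounit (basis b)) (basis a)) (deconc x)) c =
        (\<Sum>z\<in>keys (deconc x). lookup (deconc x) z * (if z = (c, cempty) then 1 else 0))"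
      unfolding lookup_lin by (rule sum.cong) (auto simp: lookup_basis ccounit_def split: if_splits)
    then show "lookup (lin (\<lambda>(a, b). scl (ccounit (basis b)) (basis a)) (deconc x)) c = lookup x c"
      unfolding sum_keys_delta by (simp add: lookup_deconc)
  qed
qed

lemma deconc_linear: "module_hom scl scl deconc"
  by (simp add: deconc_def module_hom_lin)

lemma cunit_linear: "module_hom (*) scl cunit"
  by unfold_locales (simp_all add: cunit_def algebra_simps fm.scale_left_distrib)

lemma ccounit_linear: "module_hom scl (*) ccounit"
  by unfold_locales (simp_all add: ccounit_def lookup_add algebra_simps)

lemma fm_bialgebra_qsh:
  "fm_bialgebra (qsh :: ('d::finite cmp \<Rightarrow>\<^sub>0 'k::comm_ring_1) \<Rightarrow> _) cunit deconc ccounit"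
proof (intro fm_bialgebra.intro fm_algebra.intro fm_coalgebra.intro fm_bialgebra_axioms.intro)
  fix x y :: "'d cmp \<Rightarrow>\<^sub>0 'k"
  show "deconc (cunit 1 :: 'd cmp \<Rightarrow>\<^sub>0 'k) = tensor (cunit 1) (cunit 1)"
  proof (rule poly_mapping_eqI, clarify)
    fix a b :: "'d cmp"
    have "cdiag a b = cempty \<longleftrightarrow> a = cempty \<and> b = cempty"
      by (auto simp: crows_eq_0_iff[symmetric] cdiag_dims)
    then show "lookup (deconc (cunit 1)) (a, b) =
        lookup (tensor (cunit 1) (cunit 1) :: 'd cmp \<times> 'd cmp \<Rightarrow>\<^sub>0 'k) (a, b)"
      by (simp add: lookup_deconc cunit_1 lookup_basis)
  qed
  show "ccounit (qsh x y) = ccounit x * ccounit y"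
    using lookup_qsh[of x y 0] cmpr_eq_cempty_iff[of "0 :: 'd mono"]
    by (simp add: splits_0 ccounit_def)
  show "ccounit (cunit 1 :: 'd cmp \<Rightarrow>\<^sub>0 'k) = 1"
    by (simp add: cunit_1 ccounit_def)
qed (simp_all add: qsh_linear qsh_assoc cunit_1 cunit_linear ccounit_linear deconc_linear
    deconc_counit deconc_coassoc deconc_qsh)

section \<open>Unique factorization\<close>

lemma centry_cdiag:
  assumes "u < crows a + crows b" "v < ccols a + ccols b"
  shows "centry (cdiag a b) u v =
    (if u < crows a then if v < ccols a then centry a u v else {#}
     else if v < ccols a then {#} else centry b (u - crows a) (v - ccols a))"
  using assms cdiag_entry(1)[of u a v b] cdiag_entry(2)[of u a "v - ccols a" b]
    cdiag_entry(3)[of "u - crows a" b v a] cdiag_entry(4)[of "u - crows a" b "v - ccols a" a]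
  by auto

lemma cdiag_left_cancel:
  assumes "cdiag a b = cdiag a c"
  shows "b = c"
proof (rule cmp_eqI)
  show dims: "crows b = crows c" "ccols b = ccols c"
    using arg_cong[OF assms, of crows] arg_cong[OF assms, of ccols] by (simp_all add: cdiag_dims)
  show "centry b i j = centry c i j" if "i < crows b" "j < ccols b" for i j
    using arg_cong[OF assms, of "\<lambda>x. centry x (crows a + i) (ccols a + j)"] that dims
    by (simp add: cdiag_entry)
qed

text \<open>Levi's lemma for block decompositions. The number of rows decides which of the two decompositions
  refines the other: a first block with at most as many rows cannot have more columns, since every
  column of a first block has a non-trivial entry in a row of this block.\<close>

lemma cdiag_levi:
  assumes eq: "cdiag a b = cdiag c d" and le: "crows a \<le> crows c"
  obtains e where "c = cdiag a e" "b = cdiag e d"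
proof -
  have dims: "crows a + crows b = crows c + crows d" "ccols a + ccols b = ccols c + ccols d"
    using arg_cong[OF eq, of crows] arg_cong[OF eq, of ccols] by (simp_all add: cdiag_dims)
  have le2: "ccols a \<le> ccols c"
  proof (rule ccontr)
    assume "\<not> ccols a \<le> ccols c"
    then have v: "ccols c < ccols a" by simp
    then obtain u where "u < crows a" "centry a u (ccols c) \<noteq> {#}"
      using cmp_entry_nonempty(2) by blast
    then show False
      using arg_cong[OF eq, of "\<lambda>x. centry x u (ccols c)"] v le dims by (simp add: centry_cdiag)
  qed
  \<comment> \<open>the part of \<open>c\<close> below and to the right of \<open>a\<close>\<close>
  let ?E = "mat (crows c - crows a) (ccols c - ccols a) (\<lambda>(i, j). centry c (crows a + i) (ccols a + j))"
  have off1: "centry c (crows a + i) j = {#}" if "i < crows c - crows a" "j < ccols a" for i j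
  proof -
    have "crows a + i < crows c" "j < ccols c" using that le2 by auto
    then show ?thesis
      using arg_cong[OF eq, of "\<lambda>x. centry x (crows a + i) j"] that dims by (simp add: centry_cdiag)
  qed
  have off2: "centry c i (ccols a + j) = {#}" if "i < crows a" "j < ccols c - ccols a" for i j
  proof -
    have "i < crows c" "ccols a + j < ccols c" using that le by auto
    then show ?thesis
      using arg_cong[OF eq, of "\<lambda>x. centry x i (ccols a + j)"] that dims by (simp add: centry_cdiag)
  qed
  have on: "centry c i j = centry a i j" if "i < crows a" "j < ccols a" for i j
    using arg_cong[OF eq, of "\<lambda>x. centry x i j"] that le le2 dims
    by (simp add: centry_cdiag)
  have "is_cmp ?E"
    unfolding is_cmp_alt
  proof (intro conjI allI impI)
    fix i assume i: "i < dim_row ?E"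
    then have "crows a + i < crows c" using le by simp
    then obtain j where j: "j < ccols c" "centry c (crows a + i) j \<noteq> {#}"
      using cmp_entry_nonempty(1) by blast
    with off1 i have "ccols a \<le> j" by (metis dim_row_mat(1) not_le)
    then show "\<exists>j<dim_col ?E. ?E $$ (i, j) \<noteq> {#}"
      using i j by (intro exI[of _ "j - ccols a"]) auto
  next
    fix j assume j: "j < dim_col ?E"
    then have "ccols a + j < ccols c" using le2 by simp
    then obtain i where i: "i < crows c" "centry c i (ccols a + j) \<noteq> {#}"
      using cmp_entry_nonempty(2) by blast
    with off2 j have "crows a \<le> i" by (metis dim_col_mat(1) not_le)
    then show "\<exists>i<dim_row ?E. ?E $$ (i, j) \<noteq> {#}"
      using i j by (intro exI[of _ "i - crows a"]) auto
  qed
  note E = Abs_cmp_dims[OF this]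
  have c: "c = cdiag a (Abs_cmp ?E)"
  proof (rule cmp_eqI)
    show "crows c = crows (cdiag a (Abs_cmp ?E))" "ccols c = ccols (cdiag a (Abs_cmp ?E))"
      using le le2 by (simp_all add: cdiag_dims E)
    show "centry c i j = centry (cdiag a (Abs_cmp ?E)) i j" if "i < crows c" "j < ccols c" for i j
    proof -
      have "centry c i j = {#}" if "i < crows a" "\<not> j < ccols a"
        using off2[of i "j - ccols a"] that \<open>j < ccols c\<close> by simp
      moreover have "centry c i j = {#}" if "\<not> i < crows a" "j < ccols a"
        using off1[of "i - crows a" j] that \<open>i < crows c\<close> by simp
      ultimately show ?thesis using that on by (simp add: centry_cdiag E)
    qed
  qed
  have "cdiag a b = cdiag a (cdiag (Abs_cmp ?E) d)"
    by (simp only: eq cdiag_assoc[symmetric] c[symmetric])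
  then have "b = cdiag (Abs_cmp ?E) d" by (rule cdiag_left_cancel)
  with c show ?thesis by (rule that)
qed

lemma cdiag_list_simps [simp]:
  "cdiag_list [] = cempty" "cdiag_list (v # vs) = cdiag v (cdiag_list vs)"
  by (simp_all add: cdiag_list_def)

lemma cdiag_list_append: "cdiag_list (vs @ ws) = cdiag (cdiag_list vs) (cdiag_list ws)"
  by (induction vs) (simp_all add: cdiag_assoc)

lemma cdiag_eq_cempty_iff: "cdiag a b = cempty \<longleftrightarrow> a = cempty \<and> b = cempty"
  by (auto simp: crows_eq_0_iff[symmetric] cdiag_dims)

lemma cconnected_nonempty: "cconnected v \<Longrightarrow> v \<noteq> cempty"
  by (simp add: cconnected_def)

lemma cconnected_cdiagD: "cconnected (cdiag a b) \<Longrightarrow> a = cempty \<or> b = cempty"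
  unfolding cconnected_def by blast

text \<open>The first factors agree: one of them is a block of the other by \<open>cdiag_levi\<close>, and the other is
  connected.\<close>

lemma cdiag_list_inject:
  assumes "\<forall>v\<in>set vs. cconnected v" "\<forall>w\<in>set ws. cconnected w" "cdiag_list vs = cdiag_list ws"
  shows "vs = ws"
  using assms
proof (induction vs arbitrary: ws)
  case Nil
  then have "cdiag_list ws = cempty" by simp
  then show ?case using Nil.prems(2) cconnected_nonempty by (cases ws) (auto simp: cdiag_eq_cempty_iff)
next
  case (Cons v vs)
  then have "v \<noteq> cempty" using cconnected_nonempty[of v] by simp
  then have "ws \<noteq> []" using Cons.prems(3) by (auto simp: cdiag_eq_cempty_iff)
  then obtain w ws' where ws: "ws = w # ws'" by (cases ws) auto
  have con: "cconnected v" "cconnected w" using Cons.prems ws by auto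
  have eq: "cdiag v (cdiag_list vs) = cdiag w (cdiag_list ws')" using Cons.prems(3) ws by simp
  have "v = w"
  proof (cases "crows v \<le> crows w")
    case True
    obtain e where "w = cdiag v e" by (rule cdiag_levi[OF eq True])
    with con show ?thesis using cconnected_cdiagD cconnected_nonempty by fastforce
  next
    case False
    then have "crows w \<le> crows v" by simp
    then obtain e where "v = cdiag w e" using cdiag_levi[OF eq[symmetric]] by blast
    with con show ?thesis using cconnected_cdiagD cconnected_nonempty by fastforce
  qed
  with eq have "cdiag_list vs = cdiag_list ws'" by (metis cdiag_left_cancel)
  then have "vs = ws'" using Cons.prems(1,2) ws by (intro Cons.IH) simp_all
  with \<open>v = w\<close> ws show ?case by simp
qed

lemma cdiag_list_surj: "\<exists>vs. (\<forall>v\<in>set vs. cconnected v) \<and> cdiag_list vs = a"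
proof (induction "crows a" arbitrary: a rule: less_induct)
  case less
  consider "a = cempty" | "cconnected a" | b c where "a = cdiag b c" "b \<noteq> cempty" "c \<noteq> cempty"
    unfolding cconnected_def by blast
  then show ?case
  proof cases
    case 1
    then show ?thesis by (intro exI[of _ "[]"]) simp
  next
    case 2
    then show ?thesis by (intro exI[of _ "[a]"]) simp
  next
    case 3
    then have "crows b < crows a" "crows c < crows a"
      using crows_eq_0_iff[of b] crows_eq_0_iff[of c] by (simp_all add: cdiag_dims)
    with less obtain vs ws where "\<forall>v\<in>set vs. cconnected v" "cdiag_list vs = b"
      "\<forall>v\<in>set ws. cconnected v" "cdiag_list ws = c" by metis
    with 3 show ?thesis by (intro exI[of _ "vs @ ws"]) (auto simp: cdiag_list_append)
  qed
qed

definition factors :: "'d::finite cmp \<Rightarrow> 'd cmp list"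
  where "factors a = (THE vs. (\<forall>v\<in>set vs. cconnected v) \<and> cdiag_list vs = a)"

lemma factors_cdiag_list: "(\<forall>v\<in>set vs. cconnected v) \<Longrightarrow> factors (cdiag_list vs) = vs"
  unfolding factors_def by (rule the_equality) (simp, metis cdiag_list_inject)

lemma cconnected_factors: "v \<in> set (factors a) \<Longrightarrow> cconnected v"
  and cdiag_list_factors [simp]: "cdiag_list (factors a) = a"
proof -
  obtain vs where "\<forall>v\<in>set vs. cconnected v" "cdiag_list vs = a"
    using cdiag_list_surj by blast
  moreover from this have "factors a = vs" using factors_cdiag_list by blast
  ultimately show "v \<in> set (factors a) \<Longrightarrow> cconnected v" "cdiag_list (factors a) = a" by auto
qed

lemma factors_cdiag: "factors (cdiag a b) = factors a @ factors b"
proof -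
  have "\<forall>v\<in>set (factors a @ factors b). cconnected v" using cconnected_factors by auto
  then have "factors (cdiag_list (factors a @ factors b)) = factors a @ factors b"
    by (rule factors_cdiag_list)
  then show ?thesis by (simp add: cdiag_list_append)
qed

lemma factors_cempty [simp]: "factors cempty = []"
  using factors_cdiag_list[of "[]"] by simp

lemma factors_eq_Nil_iff [simp]: "factors a = [] \<longleftrightarrow> a = cempty"
  by (metis cdiag_list_factors cdiag_list_simps(1) factors_cempty)

section \<open>The antipode\<close>

lemma mult_map_tensor:
  assumes "\<And>y. module_hom scl scl (\<lambda>x. m x y)" "\<And>x. module_hom scl scl (m x)"
  shows "mult_map m (tensor x y) = m x y"
proof -
  let ?f = "\<lambda>a b. m (basis a) (basis b)"
  have comp: "module_hom scl scl (\<lambda>x. mult_map m (u x))" if "module_hom scl scl u" for u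
    using module_hom_compose[OF that module_hom_lin] by (simp add: o_def mult_map_def)
  have "(\<lambda>x y. mult_map m (tensor x y)) = bilin ?f"
    by (rule bilin_unique) (auto intro!: comp tensor_bilinear, simp add: mult_map_def)
  moreover have "m = bilin ?f" by (rule bilin_unique) (use assms in auto)
  ultimately show ?thesis by metis
qed

lemma lin_sum: "lin f (\<Sum>i\<in>I. x i) = (\<Sum>i\<in>I. lin f (x i))"
  by (rule module_hom.sum[OF module_hom_lin])

text \<open>By unique factorization, the block decompositions of a word of connected compositions are its
  cuts into a prefix and a suffix.\<close>

lemma sum_cdiag_eq:
  assumes "\<forall>v\<in>set vs. cconnected v"
  shows "(\<Sum>(b, c) | cdiag b c = cdiag_list vs. f b c) =
    (\<Sum>i\<le>length vs. f (cdiag_list (take i vs)) (cdiag_list (drop i vs)))"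
proof (rule sum.reindex_bij_witness[of _ "\<lambda>i. (cdiag_list (take i vs), cdiag_list (drop i vs))"
      "\<lambda>z. length (factors (fst z))"])
  fix z assume z: "z \<in> {(b, c). cdiag b c = cdiag_list vs}"
  then have "factors (fst z) @ factors (snd z) = vs"
    using assms factors_cdiag_list by (metis (mono_tags, lifting) case_prodE factors_cdiag fst_conv mem_Collect_eq snd_conv)
  then have *: "take (length (factors (fst z))) vs = factors (fst z)"
    "drop (length (factors (fst z))) vs = factors (snd z)" "length (factors (fst z)) \<le> length vs"
    by auto
  show "(cdiag_list (take (length (factors (fst z))) vs), cdiag_list (drop (length (factors (fst z))) vs)) = z"
    by (simp add: *)
  show "length (factors (fst z)) \<in> {..length vs}" using *(3) by simp
  show "f (cdiag_list (take (length (factors (fst z))) vs)) (cdiag_list (drop (length (factors (fst z))) vs)) =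
      (case z of (b, c) \<Rightarrow> f b c)"
    by (simp add: * split_def)
next
  fix i assume i: "i \<in> {..length vs}"
  have "\<forall>v\<in>set (take i vs). cconnected v" using assms by (meson in_set_takeD)
  then show "length (factors (fst (cdiag_list (take i vs), cdiag_list (drop i vs)))) = i"
    using i by (simp add: factors_cdiag_list)
  show "(cdiag_list (take i vs), cdiag_list (drop i vs)) \<in> {(b, c). cdiag b c = cdiag_list vs}"
    by (simp add: cdiag_list_append[symmetric])
qed

lemma convolution_basis:
  assumes "\<forall>v\<in>set vs. cconnected v"
  shows "mult_map qsh (tensor_map f g (deconc (basis (cdiag_list vs)))) =
    (\<Sum>i\<le>length vs. qsh (f (basis (cdiag_list (take i vs)))) (g (basis (cdiag_list (drop i vs)))))"
proof -
  have "tensor_map f g (deconc (basis (cdiag_list vs))) =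
      (\<Sum>i\<le>length vs. tensor (f (basis (cdiag_list (take i vs)))) (g (basis (cdiag_list (drop i vs)))))"
    by (simp add: deconc_def sum_cdiag_eq[OF assms] tensor_map_def lin_sum)
  then show ?thesis
    by (simp add: mult_map_def lin_sum) (simp flip: mult_map_def add: mult_map_tensor qsh_linear)
qed

text \<open>Unlike \<open>int_compositions\<close>, this contains the empty tuple as the only composition of 0, so that the
  recursions over first and last parts have a uniform starting point.\<close>

definition compositions :: "nat \<Rightarrow> nat list set"
  where "compositions n = {is. (\<forall>i\<in>set is. 0 < i) \<and> sum_list is = n}"

lemma compositions_0: "compositions 0 = {[]}"
  unfolding compositions_def by (auto, metis all_not_in_conv less_nat_zero_code set_empty)

lemma int_compositions_eq: "n > 0 \<Longrightarrow> int_compositions n = compositions n"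
  by (auto simp: int_compositions_def compositions_def)

lemma finite_compositions: "finite (compositions n)"
proof (rule finite_subset[OF _ finite_lists_length_le[of "{..n}" n]])
  have "length is \<le> sum_list is" if "\<forall>i\<in>set is. 0 < i" for "is" :: "nat list"
    using that by (induction "is") auto
  then show "compositions n \<subseteq> {xs. set xs \<subseteq> {..n} \<and> length xs \<le> n}"
    by (auto simp: compositions_def member_le_sum_list)
qed simp

lemma sum_compositions_first:
  assumes "n > 0"
  shows "(\<Sum>is\<in>compositions n. f is) = (\<Sum>i\<in>{1..n}. \<Sum>js\<in>compositions (n - i). f (i # js))"
proof -
  have "(\<Sum>is\<in>compositions n. f is) = (\<Sum>z\<in>(SIGMA i:{1..n}. compositions (n - i)). f (fst z # snd z))"
  proof (rule sum.reindex_bij_witness[of _ "\<lambda>z. fst z # snd z" "\<lambda>is. (hd is, tl is)"])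
    fix "is" assume "is \<in> compositions n"
    then obtain i js where "is = i # js" "0 < i" "i + sum_list js = n" "\<forall>i\<in>set js. 0 < i"
      using assms by (cases "is") (auto simp: compositions_def)
    then show "fst (hd is, tl is) # snd (hd is, tl is) = is"
      "(hd is, tl is) \<in> (SIGMA i:{1..n}. compositions (n - i))"
      "f (fst (hd is, tl is) # snd (hd is, tl is)) = f is"
      by (auto simp: compositions_def)
  qed (auto simp: compositions_def)
  then show ?thesis by (simp add: sum.Sigma finite_compositions split_def)
qed

lemma sum_compositions_last:
  assumes "n > 0"
  shows "(\<Sum>is\<in>compositions n. f is) = (\<Sum>i<n. \<Sum>js\<in>compositions i. f (js @ [n - i]))"
proof -
  have "(\<Sum>is\<in>compositions n. f is) = (\<Sum>z\<in>(SIGMA i:{..<n}. compositions i). f (snd z @ [n - fst z]))"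
  proof (rule sum.reindex_bij_witness[of _ "\<lambda>z. snd z @ [n - fst z]" "\<lambda>is. (sum_list (butlast is), butlast is)"])
    fix "is" assume "is \<in> compositions n"
    then obtain js j where "is = js @ [j]" "0 < j" "sum_list js + j = n" "\<forall>i\<in>set js. 0 < i"
      using assms by (cases "is" rule: rev_cases) (auto simp: compositions_def)
    then show "snd (sum_list (butlast is), butlast is) @ [n - fst (sum_list (butlast is), butlast is)] = is"
      "(sum_list (butlast is), butlast is) \<in> (SIGMA i:{..<n}. compositions i)"
      "f (snd (sum_list (butlast is), butlast is) @ [n - fst (sum_list (butlast is), butlast is)]) = f is"
      by (auto simp: compositions_def)
  qed (auto simp: compositions_def)
  then show ?thesis by (simp add: sum.Sigma finite_compositions split_def)
qed

lemma blocks_snoc: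
  "blocks (js @ [k]) vs = blocks js (take (sum_list js) vs) @ [take k (drop (sum_list js) vs)]"
  by (induction js arbitrary: vs) (simp_all add: take_drop ac_simps)

lemma qsh_prod_Cons: "qsh_prod (x # xs) = qsh x (qsh_prod xs)"
  by (simp add: qsh_prod_def)

lemma qsh_prod_append: "qsh_prod (xs @ ys) = qsh (qsh_prod xs) (qsh_prod ys)"
  by (induction xs) (simp_all add: qsh_prod_def qsh_assoc)

lemma qsh_scl: "qsh (scl c x) y = scl c (qsh x y)" "qsh x (scl c y) = scl c (qsh x y)"
  using module_hom.scale[OF qsh_linear(1)] module_hom.scale[OF qsh_linear(2)] by blast+

lemma qsh_sum: "qsh (\<Sum>i\<in>I. f i) y = (\<Sum>i\<in>I. qsh (f i) y)" "qsh x (\<Sum>i\<in>I. f i) = (\<Sum>i\<in>I. qsh x (f i))"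
  using module_hom.sum[OF qsh_linear(1)] module_hom.sum[OF qsh_linear(2)] by blast+

text \<open>The alternating sum over all ways to cut the word \<open>vs\<close> into blocks; it is the unit at the empty word.\<close>

definition antipode_word :: "'d::finite cmp list \<Rightarrow> ('d cmp \<Rightarrow>\<^sub>0 'k::comm_ring_1)"
  where "antipode_word vs = (\<Sum>is\<in>compositions (length vs).
    scl ((-1) ^ length is) (qsh_prod (map (\<lambda>b. basis (cdiag_list b)) (blocks is vs))))"

lemma antipode_word_Nil: "antipode_word [] = basis cempty"
  by (simp add: antipode_word_def compositions_0 qsh_prod_def)

text \<open>Splitting off the first block leaves an arbitrary cutting of the rest of the word. Moving
  everything to one side gives the equation of a right antipode.\<close>

lemma antipode_word_first:
  assumes "vs \<noteq> []"
  shows "antipode_word vs = - (\<Sum>i\<in>{1..length vs}. qsh (basis (cdiag_list (take i vs))) (antipode_word (drop i vs)))"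
proof -
  have "antipode_word vs = (\<Sum>i\<in>{1..length vs}. \<Sum>js\<in>compositions (length vs - i).
      scl (- 1) (qsh (basis (cdiag_list (take i vs)))
        (scl ((-1) ^ length js) (qsh_prod (map (\<lambda>b. basis (cdiag_list b)) (blocks js (drop i vs)))))))"
    using assms by (simp add: antipode_word_def sum_compositions_first qsh_prod_Cons qsh_scl)
  then show ?thesis
    by (simp add: antipode_word_def qsh_sum sum_negf)
qed

text \<open>The same for the last block; this gives the equation of a left antipode.\<close>

lemma antipode_word_last:
  assumes "vs \<noteq> []"
  shows "antipode_word vs = - (\<Sum>i<length vs. qsh (antipode_word (take i vs)) (basis (cdiag_list (drop i vs))))"
proof -
  have "antipode_word vs = (\<Sum>i<length vs. \<Sum>js\<in>compositions i.
      scl ((-1) ^ length (js @ [length vs - i]))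
        (qsh_prod (map (\<lambda>b. basis (cdiag_list b)) (blocks (js @ [length vs - i]) vs))))"
    unfolding antipode_word_def by (rule sum_compositions_last) (use assms in simp)
  also have "\<dots> = (\<Sum>i<length vs. \<Sum>js\<in>compositions i. scl (- 1) (qsh
      (scl ((-1) ^ length js) (qsh_prod (map (\<lambda>b. basis (cdiag_list b)) (blocks js (take i vs)))))
      (basis (cdiag_list (drop i vs)))))"
    by (intro sum.cong refl)
      (auto simp: blocks_snoc compositions_def qsh_prod_append qsh_scl, simp add: qsh_prod_def)
  finally show ?thesis
    by (simp add: antipode_word_def qsh_sum sum_negf)
qed

lemma fm_antipode_lin:
  "fm_antipode qsh cunit deconc ccounit
    (lin (\<lambda>a. antipode_word (factors a)) :: ('d::finite cmp \<Rightarrow>\<^sub>0 'k::comm_ring_1) \<Rightarrow> _)"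
  (is "fm_antipode _ _ _ _ ?S")
proof -
  have S: "?S (basis (cdiag_list vs)) = antipode_word vs" if "\<forall>v\<in>set vs. cconnected v" for vs
    using that by (simp add: factors_cdiag_list)
  have lin1: "module_hom scl scl (\<lambda>x. mult_map qsh (tensor_map f g (deconc x)))" for f g
    using module_hom_compose[OF module_hom_compose[OF deconc_linear module_hom_lin] module_hom_lin]
    by (simp add: o_def mult_map_def tensor_map_def)
  have lin2: "module_hom scl scl (\<lambda>x. cunit (ccounit x))"
    using module_hom_compose[OF ccounit_linear cunit_linear] by (simp add: o_def)
  have eps: "cunit (ccounit (basis (cdiag_list vs))) = (if vs = [] then basis cempty else 0)"
    if "\<forall>v\<in>set vs. cconnected v" for vs
    using that factors_cdiag_list[OF that] by (auto simp: cunit_def ccounit_def lookup_basis)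
  have L: "mult_map qsh (tensor_map ?S id (deconc x)) = cunit (ccounit x)" for x
  proof (rule lin_ext[OF lin1 lin2])
    fix a :: "'d cmp"
    define vs where "vs = factors a"
    have con: "\<forall>v\<in>set vs. cconnected v" and a: "a = cdiag_list vs"
      using cconnected_factors by (auto simp: vs_def)
    have "mult_map qsh (tensor_map ?S id (deconc (basis a))) =
        (\<Sum>i\<le>length vs. qsh (antipode_word (take i vs)) (basis (cdiag_list (drop i vs))))"
      unfolding a convolution_basis[OF con]
      by (intro sum.cong refl arg_cong2[where f = qsh] S) (use con in \<open>auto dest: in_set_takeD\<close>)
    also have "\<dots> = cunit (ccounit (basis a))"
    proof (cases "vs = []")
      case True
      then show ?thesis unfolding a eps[OF con] by (simp add: antipode_word_Nil)
    next
      case False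
      then show ?thesis
        unfolding a eps[OF con] by (simp add: antipode_word_last[OF False] lessThan_Suc_atMost[symmetric])
    qed
    finally show "mult_map qsh (tensor_map ?S id (deconc (basis a))) = cunit (ccounit (basis a))" .
  qed
  have R: "mult_map qsh (tensor_map id ?S (deconc x)) = cunit (ccounit x)" for x
  proof (rule lin_ext[OF lin1 lin2])
    fix a :: "'d cmp"
    define vs where "vs = factors a"
    have con: "\<forall>v\<in>set vs. cconnected v" and a: "a = cdiag_list vs"
      using cconnected_factors by (auto simp: vs_def)
    have "mult_map qsh (tensor_map id ?S (deconc (basis a))) =
        (\<Sum>i\<le>length vs. qsh (basis (cdiag_list (take i vs))) (antipode_word (drop i vs)))"
      unfolding a convolution_basis[OF con]
      by (intro sum.cong refl arg_cong2[where f = qsh] S) (use con in \<open>auto dest: in_set_dropD\<close>)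
    also have "\<dots> = cunit (ccounit (basis a))"
    proof (cases "vs = []")
      case True
      then show ?thesis unfolding a eps[OF con] by (simp add: antipode_word_Nil)
    next
      case False
      then show ?thesis
        unfolding a eps[OF con]
        by (simp add: antipode_word_first[OF False] atMost_atLeast0 sum.atLeast_Suc_atMost)
    qed
    finally show "mult_map qsh (tensor_map id ?S (deconc (basis a))) = cunit (ccounit (basis a))" .
  qed
  show ?thesis using L R module_hom_lin by (simp add: fm_antipode_def)
qed

text \<open>The defining equation of a left antipode determines its value at a word from its values at the
  proper prefixes of this word.\<close>

lemma fm_antipode_word:
  assumes "fm_antipode qsh cunit deconc ccounit A" "\<forall>v\<in>set vs. cconnected v"
  shows "A (basis (cdiag_list vs)) = antipode_word vs"
  using assms(2)
proof (induction "length vs" arbitrary: vs rule: less_induct)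
  case less
  have eq: "(\<Sum>i\<le>length vs. qsh (A (basis (cdiag_list (take i vs)))) (basis (cdiag_list (drop i vs)))) =
      cunit (ccounit (basis (cdiag_list vs)))"
    using assms(1) convolution_basis[OF less.prems, of A id] by (simp add: fm_antipode_def)
  show ?case
  proof (cases "vs = []")
    case True
    then show ?thesis using eq by (simp add: antipode_word_Nil ccounit_def lookup_basis cunit_def)
  next
    case False
    have "cdiag_list vs \<noteq> cempty" using factors_cdiag_list[OF less.prems] False by auto
    then have "A (basis (cdiag_list vs)) =
        - (\<Sum>i<length vs. qsh (A (basis (cdiag_list (take i vs)))) (basis (cdiag_list (drop i vs))))"
      using eq by (simp add: lessThan_Suc_atMost[symmetric] ccounit_def lookup_basis cunit_def
          eq_neg_iff_add_eq_0 add.commute)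
    also have "(\<Sum>i<length vs. qsh (A (basis (cdiag_list (take i vs)))) (basis (cdiag_list (drop i vs)))) =
        (\<Sum>i<length vs. qsh (antipode_word (take i vs)) (basis (cdiag_list (drop i vs))))"
    proof (intro sum.cong refl arg_cong2[where f = qsh])
      fix i assume "i \<in> {..<length vs}"
      then have "length (take i vs) < length vs" by simp
      then show "A (basis (cdiag_list (take i vs))) = antipode_word (take i vs)"
        using less.prems by (intro less.hyps) (auto dest: in_set_takeD)
    qed
    finally show ?thesis by (simp only: antipode_word_last[OF False])
  qed
qed

lemma antipode_formula_iff:
  fixes A :: "('d::finite cmp \<Rightarrow>\<^sub>0 'k::comm_ring_1) \<Rightarrow> ('d cmp \<Rightarrow>\<^sub>0 'k)"
  shows "antipode_formula A \<longleftrightarrow> module_hom scl scl A \<and>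
    (\<forall>vs. (\<forall>v\<in>set vs. cconnected v) \<longrightarrow> A (basis (cdiag_list vs)) = antipode_word vs)"
proof -
  have "antipode_word vs = (\<Sum>is\<in>int_compositions (length vs).
      scl ((-1) ^ length is) (qsh_prod (map (\<lambda>b. basis (cdiag_list b)) (blocks is vs)))
        :: 'd cmp \<Rightarrow>\<^sub>0 'k)"
    if "vs \<noteq> []" for vs :: "'d cmp list"
    using that by (simp add: antipode_word_def int_compositions_eq)
  then have "antipode_formula A \<longleftrightarrow> module_hom scl scl A \<and> A (basis cempty) = basis cempty \<and>
      (\<forall>vs. vs \<noteq> [] \<and> (\<forall>v\<in>set vs. cconnected v) \<longrightarrow> A (basis (cdiag_list vs)) = antipode_word vs)"
    unfolding antipode_formula_def by auto
  moreover have "A (basis cempty) = basis cempty \<longleftrightarrow> A (basis (cdiag_list [])) = antipode_word []"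
    by (simp add: antipode_word_Nil)
  ultimately show ?thesis by (metis empty_iff list.set(1))
qed

lemma fm_antipode_iff_formula: "fm_antipode qsh cunit deconc ccounit A \<longleftrightarrow> antipode_formula A"
proof
  assume A: "fm_antipode qsh cunit deconc ccounit A"
  then show "antipode_formula A"
    using fm_antipode_word[OF A] by (auto simp: antipode_formula_iff fm_antipode_def)
next
  assume A: "antipode_formula A"
  have "A (basis a) = antipode_word (factors a)" for a
    using A cconnected_factors[of _ a] unfolding antipode_formula_iff by (metis cdiag_list_factors)
  then have "A = lin (\<lambda>a. antipode_word (factors a))"
    using A by (intro lin_unique) (auto simp: antipode_formula_iff)
  then show "fm_antipode qsh cunit deconc ccounit A" using fm_antipode_lin by simp
qed

section \<open>The grading\<close>

lemma basis_expansion: "x = (\<Sum>a\<in>keys x. scl (lookup x a) (basis a))"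
  using lin_basis_id[of x] by (simp add: lin_def)

lemma mem_cgrade_iff: "x \<in> cgrade n \<longleftrightarrow> (\<forall>a\<in>keys x. cweight a = n)"
proof
  assume "x \<in> cgrade n"
  then show "\<forall>a\<in>keys x. cweight a = n"
    unfolding cgrade_def
  proof (induction rule: fm.span_induct_alt)
    case (step c y z)
    then obtain a where "y = basis a" "cweight a = n" by auto
    then show ?case
      using step by (auto simp: in_keys_iff lookup_add lookup_basis split: if_splits)
  qed simp
next
  assume *: "\<forall>a\<in>keys x. cweight a = n"
  have "(\<Sum>a\<in>keys x. scl (lookup x a) (basis a)) \<in> cgrade n"
    unfolding cgrade_def using * by (intro fm.span_sum fm.span_scale fm.span_base) auto
  then show "x \<in> cgrade n" using basis_expansion[of x] by simp
qed

lemma basis_in_cgrade: "basis a \<in> cgrade (cweight a)"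
  unfolding cgrade_def by (rule fm.span_base) auto

text \<open>The total degree. It is additive, which makes the product homogeneous by \<open>lookup_qsh\<close>.\<close>

definition mweight :: "'d::finite mono \<Rightarrow> nat"
  where "mweight F = (\<Sum>k\<in>keys F. size (lookup F k))"

lemma mweight_superset: "finite K \<Longrightarrow> keys F \<subseteq> K \<Longrightarrow> mweight F = (\<Sum>k\<in>K. size (lookup F k))"
  unfolding mweight_def by (rule sum.mono_neutral_left) (auto simp: in_keys_iff)

lemma mweight_add: "mweight (F + G) = mweight F + mweight G"
  by (simp add: mweight_superset[of "keys F \<union> keys G"] keys_add_multiset lookup_add sum.distrib)

lemma mweight_single: "mweight (Poly_Mapping.single k m) = size m"
  by (cases "m = {#}") (simp_all add: mweight_def)

lemma mweight_sum: "mweight (\<Sum>i\<in>I. F i) = (\<Sum>i\<in>I. mweight (F i))"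
  by (induction I rule: infinite_finite_induct) (simp_all add: mweight_add, simp_all add: mweight_def)

lemma mweight_place: "mweight (place p q a) = cweight a"
  by (simp add: place_def mweight_sum mweight_single cweight_def)

lemma cweight_cmpr: "cweight (cmpr F) = mweight F"
  using mweight_place[of "(!) (mrows F)" "(!) (mcols F)" "cmpr F"] by (simp add: place_cmpr)

text \<open>Block diagonal compositions are compressed sums of monomials, and the degree is additive.\<close>

lemma cweight_cdiag: "cweight (cdiag a b) = cweight a + cweight b"
proof -
  obtain F G where "below F G" "cmpr F = a" "cmpr G = b" by (rule obtain_below)
  then show ?thesis by (metis cmpr_add_below cweight_cmpr mweight_add)
qed

lemma cweight_eq_0_iff: "cweight a = 0 \<longleftrightarrow> a = cempty"
proof
  assume "cweight a = 0"
  then have "centry a i j = {#}" if "i < crows a" "j < ccols a" for i j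
    using that by (simp add: cweight_def)
  then have "crows a = 0" using cmp_entry_nonempty(1)[of 0 a] by blast
  then show "a = cempty" by (simp add: crows_eq_0_iff)
qed (simp add: cweight_def)

lemma qsh_in_cgrade:
  assumes "x \<in> cgrade i" "y \<in> cgrade j"
  shows "qsh x y \<in> cgrade (i + j)"
  unfolding mem_cgrade_iff
proof
  fix a assume "a \<in> keys (qsh x y)"
  then have "lookup (qsh x y) (cmpr (mono_of a)) \<noteq> 0" by (simp add: in_keys_iff)
  then obtain z where z: "z \<in> splits (mono_of a)"
    "lookup x (cmpr (fst z)) * lookup y (cmpr (snd z)) \<noteq> 0"
    unfolding lookup_qsh by (meson sum.not_neutral_contains_not_neutral)
  then have "cmpr (fst z) \<in> keys x" "cmpr (snd z) \<in> keys y"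
    unfolding in_keys_iff by (metis mult_zero_left mult_zero_right)+
  then have "mweight (fst z) = i" "mweight (snd z) = j"
    using assms by (auto simp: mem_cgrade_iff cweight_cmpr)
  moreover have "fst z + snd z = mono_of a" using z(1) by (auto simp: splits_def)
  then have "cweight a = mweight (fst z) + mweight (snd z)"
    using cweight_cmpr[of "mono_of a"] by (simp flip: mweight_add)
  ultimately show "cweight a = i + j" by simp
qed

lemma subspace_cgrade: "fm.subspace (cgrade n)"
  unfolding cgrade_def by (rule fm.subspace_span)

text \<open>By induction along the recursion for the antipode.\<close>

lemma antipode_word_in_cgrade:
  "(antipode_word vs :: 'd::finite cmp \<Rightarrow>\<^sub>0 'k::comm_ring_1) \<in> cgrade (cweight (cdiag_list vs))"
proof (induction "length vs" arbitrary: vs rule: less_induct)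
  case less
  show ?case
  proof (cases "vs = []")
    case True
    then show ?thesis using basis_in_cgrade[of cempty] by (simp add: antipode_word_Nil)
  next
    case False
    have "qsh (antipode_word (take i vs)) (basis (cdiag_list (drop i vs)) :: 'd cmp \<Rightarrow>\<^sub>0 'k)
        \<in> cgrade (cweight (cdiag_list vs))"
      if "i < length vs" for i
    proof -
      have "cweight (cdiag_list vs) = cweight (cdiag_list (take i vs)) + cweight (cdiag_list (drop i vs))"
        by (simp flip: cweight_cdiag cdiag_list_append)
      moreover have "(antipode_word (take i vs) :: 'd cmp \<Rightarrow>\<^sub>0 'k) \<in> cgrade (cweight (cdiag_list (take i vs)))"
        using that by (intro less.hyps) simp
      ultimately show ?thesis by (simp only: qsh_in_cgrade basis_in_cgrade)
    qed
    then show ?thesis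
      unfolding antipode_word_last[OF False]
      by (intro fm.subspace_neg[OF subspace_cgrade] fm.subspace_sum[OF subspace_cgrade]) simp
  qed
qed

lemma cgrade_direct_sum:
  fixes x :: "'d::finite cmp \<Rightarrow>\<^sub>0 'k::comm_ring_1"
  shows "\<exists>!c. (\<forall>n. c n \<in> cgrade n) \<and> finite {n. c n \<noteq> 0} \<and> x = (\<Sum>n | c n \<noteq> 0. c n)"
proof (rule ex1I)
  define c where "c n = Poly_Mapping.mapp (\<lambda>a v. if cweight a = n then v else 0) x" for n
  have c: "lookup (c n) a = (if cweight a = n then lookup x a else 0)" for n a
    by (simp add: c_def lookup_mapp when_def in_keys_iff)
  have sub: "{n. c n \<noteq> 0} \<subseteq> cweight ` keys x"
  proof
    fix n assume "n \<in> {n. c n \<noteq> 0}"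
    then obtain a where "lookup (c n) a \<noteq> 0" by (metis mem_Collect_eq poly_mapping_eqI lookup_zero)
    then show "n \<in> cweight ` keys x" by (auto simp: c in_keys_iff split: if_splits)
  qed
  then have fin: "finite {n. c n \<noteq> 0}" by (rule finite_subset) simp
  have "x = (\<Sum>n | c n \<noteq> 0. c n)"
  proof (rule poly_mapping_eqI)
    fix a
    have "(\<Sum>n | c n \<noteq> 0. lookup (c n) a) = (\<Sum>n | c n \<noteq> 0. if n = cweight a then lookup x a else 0)"
      by (rule sum.cong) (auto simp: c)
    also have "\<dots> = lookup x a" using fin c[of "cweight a" a] by auto
    finally show "lookup x a = lookup (\<Sum>n | c n \<noteq> 0. c n) a" by (simp add: lookup_sum)
  qed
  then show "(\<forall>n. c n \<in> cgrade n) \<and> finite {n. c n \<noteq> 0} \<and> x = (\<Sum>n | c n \<noteq> 0. c n)"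
    using fin by (auto simp: mem_cgrade_iff in_keys_iff c split: if_splits)
next
  fix c' assume c': "(\<forall>n. c' n \<in> cgrade n) \<and> finite {n. c' n \<noteq> 0} \<and> x = (\<Sum>n | c' n \<noteq> 0. c' n)"
  have *: "lookup (c' n) a = (if cweight a = n then lookup x a else 0)" for n a
  proof -
    have 0: "lookup (c' m) a = 0" if "cweight a \<noteq> m" for m
    proof -
      have "\<forall>b\<in>keys (c' m). cweight b = m" using c' mem_cgrade_iff by blast
      with that show ?thesis by (auto simp: in_keys_iff)
    qed
    have "lookup x a = (\<Sum>m | c' m \<noteq> 0. lookup (c' m) a)"
      using c' lookup_sum[of c' "{n. c' n \<noteq> 0}" a] by simp
    also have "\<dots> = (\<Sum>m | c' m \<noteq> 0. if m = cweight a then lookup (c' (cweight a)) a else 0)"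
      by (rule sum.cong) (use 0 in auto)
    also have "\<dots> = lookup (c' (cweight a)) a" using c' by auto
    finally show ?thesis using 0 by auto
  qed
  show "c' = (\<lambda>n. Poly_Mapping.mapp (\<lambda>a v. if cweight a = n then v else 0) x)"
    by (intro ext poly_mapping_eqI) (simp add: * lookup_mapp when_def in_keys_iff)
qed

lemma graded_connected_commutative_qsh:
  "graded_connected_commutative_fm_hopf_algebra
    (qsh :: ('d::finite cmp \<Rightarrow>\<^sub>0 'k::comm_ring_1) \<Rightarrow> _) cunit deconc ccounit cgrade"
proof (intro graded_connected_commutative_fm_hopf_algebra.intro graded_fm_hopf_algebra.intro
    fm_hopf_algebra.intro fm_hopf_algebra_axioms.intro graded_fm_hopf_algebra_axioms.intro
    graded_connected_commutative_fm_hopf_algebra_axioms.intro)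
  fix x y :: "'d cmp \<Rightarrow>\<^sub>0 'k" and c :: 'k and n i j :: nat and S
  show "fm_bialgebra (qsh :: ('d cmp \<Rightarrow>\<^sub>0 'k) \<Rightarrow> _) cunit deconc ccounit" by (rule fm_bialgebra_qsh)
  show "\<exists>S. fm_antipode (qsh :: ('d cmp \<Rightarrow>\<^sub>0 'k) \<Rightarrow> _) cunit deconc ccounit S"
    using fm_antipode_lin by blast
  show "fm.subspace (cgrade n :: ('d cmp \<Rightarrow>\<^sub>0 'k) set)" by (rule subspace_cgrade)
  show "\<exists>!c. (\<forall>n. c n \<in> cgrade n) \<and> finite {n. c n \<noteq> 0} \<and> x = (\<Sum>n | c n \<noteq> 0. c n)"
    by (rule cgrade_direct_sum)
  show "x \<in> cgrade i \<Longrightarrow> y \<in> cgrade j \<Longrightarrow> qsh x y \<in> cgrade (i + j)" by (rule qsh_in_cgrade)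
  show "cunit c \<in> (cgrade 0 :: ('d cmp \<Rightarrow>\<^sub>0 'k) set)"
    by (auto simp: mem_cgrade_iff in_keys_iff cunit_def lookup_basis cweight_eq_0_iff split: if_splits)
  show "deconc x \<in> fm.span {tensor y z |y z i j. y \<in> cgrade i \<and> z \<in> cgrade j \<and> i + j = n}"
    if x: "x \<in> cgrade n"
  proof -
    have "basis z \<in> {tensor y z |(y :: 'd cmp \<Rightarrow>\<^sub>0 'k) z i j. y \<in> cgrade i \<and> z \<in> cgrade j \<and> i + j = n}"
      if "z \<in> keys (deconc x)" for z
    proof -
      obtain b c where z: "z = (b, c)" by (cases z)
      then have "cdiag b c \<in> keys x" using that by (simp add: in_keys_iff lookup_deconc)
      then have "cweight b + cweight c = n" using x by (simp add: mem_cgrade_iff flip: cweight_cdiag)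
      moreover have "basis z = tensor (basis b) (basis c :: 'd cmp \<Rightarrow>\<^sub>0 'k)" using z by simp
      ultimately show ?thesis using basis_in_cgrade by blast
    qed
    then have "(\<Sum>z\<in>keys (deconc x). scl (lookup (deconc x) z) (basis z)) \<in>
        fm.span {tensor y z |y z i j. y \<in> cgrade i \<and> z \<in> cgrade j \<and> i + j = n}"
      by (intro fm.span_sum fm.span_scale fm.span_base)
    then show ?thesis using basis_expansion[of "deconc x"] by simp
  qed
  show "ccounit x = 0" if "x \<in> cgrade n" "n \<noteq> 0"
  proof -
    have "cempty \<notin> keys x" using that cweight_eq_0_iff[of "cempty :: 'd cmp"] by (auto simp: mem_cgrade_iff)
    then show ?thesis by (simp add: ccounit_def in_keys_iff)
  qed
  show "S x \<in> cgrade n" if S: "fm_antipode qsh cunit deconc ccounit S" and x: "x \<in> cgrade n"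
  proof -
    have S': "module_hom scl scl S" "S (basis a) = antipode_word (factors a)" for a
      using S fm_antipode_word[OF S, of "factors a"] cconnected_factors[of _ a]
      by (simp_all add: fm_antipode_def)
    have "S x = S (\<Sum>a\<in>keys x. scl (lookup x a) (basis a))" using basis_expansion[of x] by simp
    also have "\<dots> = (\<Sum>a\<in>keys x. scl (lookup x a) (antipode_word (factors a)))"
      by (simp add: module_hom.sum[OF S'(1)] module_hom.scale[OF S'(1)] S'(2))
    also have "\<dots> \<in> cgrade n"
    proof (intro fm.subspace_sum[OF subspace_cgrade] fm.subspace_scale[OF subspace_cgrade])
      fix a assume "a \<in> keys x"
      then show "antipode_word (factors a) \<in> cgrade n"
        using x antipode_word_in_cgrade[of "factors a"] by (simp add: mem_cgrade_iff)
    qed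
    finally show ?thesis .
  qed
  show "(cgrade 0 :: ('d cmp \<Rightarrow>\<^sub>0 'k) set) = {cunit c |c. True}"
  proof (intro equalityI subsetI)
    fix x :: "'d cmp \<Rightarrow>\<^sub>0 'k" assume "x \<in> cgrade 0"
    then have "a = cempty" if "a \<in> keys x" for a using that by (simp add: mem_cgrade_iff cweight_eq_0_iff)
    then have "x = cunit (lookup x cempty)"
      by (intro poly_mapping_eqI) (auto simp: cunit_def lookup_basis in_keys_iff)
    then show "x \<in> {cunit c |c. True}" by blast
  next
    fix x :: "'d cmp \<Rightarrow>\<^sub>0 'k" assume "x \<in> {cunit c |c. True}"
    then show "x \<in> cgrade 0"
      by (auto simp: mem_cgrade_iff in_keys_iff cunit_def lookup_basis cweight_eq_0_iff split: if_splits)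
  qed
  show "qsh x y = qsh y x" by (rule qsh_commute)
qed

section \<open>Lyndon words and maximal shuffles\<close>

lemma append_le_append_iff [simp]: "xs @ ys \<le> xs @ zs \<longleftrightarrow> ys \<le> zs"
  for xs ys zs :: "'a::linorder list"
  by (induction xs) auto

lemma le_append: "xs \<le> xs @ ys" for xs ys :: "'a::linorder list"
  using append_le_append_iff[of xs "[]" ys] by (simp del: append_le_append_iff)

lemma append_le_if_not_prefix:
  fixes q u v w z :: "'a::linorder list"
  assumes "q @ v \<le> u" "\<not> prefix q u"
  shows "q @ w \<le> u @ z"
  using assms
proof (induction q arbitrary: u)
  case (Cons b q)
  then show ?case by (cases u) auto
qed auto

lemma append_less_if_not_prefix:
  fixes l s x :: "'a::linorder list"
  assumes "l < s" "\<not> prefix l s"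
  shows "l @ x < s"
  using assms
proof (induction l arbitrary: s)
  case (Cons b q)
  then show ?case by (cases s) auto
qed auto

lemma append_in_shuffles: "y \<in> shuffles u v \<Longrightarrow> q @ y \<in> shuffles (q @ u) v"
  by (induction q) (auto intro: Cons_in_shuffles_leftI)

lemma concat_in_shuffles: "u @ v \<in> shuffles u v"
  using append_in_shuffles[of v "[]" v u] by simp

lemma shuffles_Cons_split:
  assumes "x \<in> shuffles (a # w) v"
  shows "\<exists>q v' y. v = q @ v' \<and> x = q @ a # y \<and> y \<in> shuffles w v'"
  using assms
proof (induction v arbitrary: x)
  case Nil
  then show ?case by force
next
  case (Cons b v)
  from Cons.prems consider y where "x = a # y" "y \<in> shuffles w (b # v)"
    | y where "x = b # y" "y \<in> shuffles (a # w) v"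
    by auto
  then show ?case
  proof cases
    case 1
    then show ?thesis by (intro exI[of _ "[]"] exI[of _ "b # v"] exI[of _ y]) auto
  next
    case 2
    with Cons.IH obtain q v' y' where "v = q @ v'" "y = q @ a # y'" "y' \<in> shuffles w v'"
      by blast
    with 2 show ?thesis by (intro exI[of _ "b # q"] exI[of _ v'] exI[of _ y']) auto
  qed
qed

text \<open>A shuffle that exploits the prefix \<open>p\<close> in front of the larger word \<open>u\<close> can be imitated with \<open>p\<close> in
  front of \<open>v\<close>, and without becoming smaller: \<open>u\<close> plays the part of \<open>v\<close> until \<open>p\<close> starts.\<close>

lemma shuffles_exchange:
  fixes p u v :: "'a::linorder list"
  assumes "v \<le> u" "x \<in> shuffles (p @ u) v"
  shows "\<exists>y\<in>shuffles u (p @ v). x \<le> y"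
  using assms
proof (induction "length p + length u + length v" arbitrary: p u v x rule: less_induct)
  case less
  show ?case
  proof (cases p)
    case Nil
    with less.prems show ?thesis by auto
  next
    case (Cons a p')
    with less.prems obtain q v' y where q: "v = q @ v'" "x = q @ a # y" "y \<in> shuffles (p' @ u) v'"
      using shuffles_Cons_split by (metis append_Cons)
    show ?thesis
    proof (cases "prefix q u")
      case True
      then obtain u' where u: "u = q @ u'" by (auto simp: prefix_def)
      have "v' \<le> u'" using less.prems(1) q u by simp
      moreover have "y \<in> shuffles ((p' @ q) @ u') v'" using q u by simp
      moreover have "length (p' @ q) + length u' + length v' < length p + length u + length v"
        using Cons q u by simp
      ultimately obtain y' where y': "y' \<in> shuffles u' ((p' @ q) @ v')" "y \<le> y'"
        using less.hyps by blast
      have "a # y' \<in> shuffles u' (p @ v)"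
        using y' Cons q by (auto intro: Cons_in_shuffles_rightI)
      then have "q @ a # y' \<in> shuffles u (p @ v)"
        using append_in_shuffles u by blast
      then show ?thesis using q y' by (intro bexI[of _ "q @ a # y'"]) auto
    next
      case False
      with less.prems(1) q have "x \<le> u @ (p @ v)"
        using append_le_if_not_prefix by metis
      then show ?thesis using concat_in_shuffles by blast
    qed
  qed
qed

text \<open>Building the largest shuffle letter by letter, one always takes a letter from \<open>u\<close>
  as long as what is left of \<open>u\<close> is at least \<open>v\<close>.\<close>

lemma shuffles_le_append:
  fixes u v :: "'a::linorder list"
  assumes "\<And>s. s \<noteq> [] \<Longrightarrow> suffix s u \<Longrightarrow> v \<le> s" "x \<in> shuffles u v"
  shows "x \<le> u @ v"
  using assms
proof (induction u arbitrary: x)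
  case Nil
  then show ?case by simp
next
  case (Cons a u)
  have IH: "y \<le> u @ v" if "y \<in> shuffles u v" for y
    by (rule Cons.IH) (simp_all add: that Cons.prems(1) suffix_ConsI)
  show ?case
  proof (cases v)
    case Nil
    with Cons.prems show ?thesis by simp
  next
    case v: (Cons b v')
    have le: "v \<le> a # u" using Cons.prems(1)[of "a # u"] by simp
    from Cons.prems(2) v consider y where "x = a # y" "y \<in> shuffles u v"
      | y where "x = b # y" "y \<in> shuffles (a # u) v'"
      by auto
    then show ?thesis
    proof cases
      case 1
      with IH show ?thesis by simp
    next
      case 2
      show ?thesis
      proof (cases "b < a")
        case True
        with 2 show ?thesis by simp
      next
        case False
        with le v have ab: "b = a" "v' \<le> u" by auto
        with 2 shuffles_exchange[of v' u y "[a]"] obtain y' where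
          "y' \<in> shuffles u v" "y \<le> y'" using v by auto
        with IH 2 ab show ?thesis using order_trans by fastforce
      qed
    qed
  qed
qed

text \<open>The same choice of positions applies to the larger word.\<close>

lemma shuffles_mono:
  fixes u u' v :: "'a::linorder list"
  assumes "x \<in> shuffles u v" "length u = length u'" "u \<le> u'"
  shows "\<exists>y\<in>shuffles u' v. x \<le> y"
  using assms
proof (induction u v arbitrary: x u' rule: shuffles.induct)
  case (3 a u b v)
  from 3(4) obtain a' w where u': "u' = a' # w" "length u = length w" by (cases u') auto
  from 3(3) consider y where "x = a # y" "y \<in> shuffles u (b # v)"
    | y where "x = b # y" "y \<in> shuffles (a # u) v"
    by auto
  then show ?case
  proof cases
    case 1
    show ?thesis
    proof (cases "a < a'")
      case True
      have "x \<le> u' @ (b # v)" using True 1 u' by simp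
      then show ?thesis using concat_in_shuffles by blast
    next
      case False
      with 3(5) u' have "a = a'" "u \<le> w" by auto
      with 3(1)[OF 1(2) u'(2)] obtain y' where "y' \<in> shuffles w (b # v)" "y \<le> y'" by blast
      then show ?thesis using \<open>a = a'\<close> 1 u' by (intro bexI[of _ "a' # y'"]) auto
    qed
  next
    case 2
    with 3(2)[OF 2(2) 3(4,5)] obtain y' where "y' \<in> shuffles u' v" "y \<le> y'" by blast
    then show ?thesis using 2 by (intro bexI[of _ "b # y'"]) (auto intro: Cons_in_shuffles_rightI)
  qed
qed auto

definition lyndon :: "'a::linorder list \<Rightarrow> bool"
  where "lyndon w \<longleftrightarrow> w \<noteq> [] \<and> (\<forall>u v. w = u @ v \<and> u \<noteq> [] \<and> v \<noteq> [] \<longrightarrow> w < v)"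

lemma lyndon_le_suffix: "lyndon w \<Longrightarrow> suffix s w \<Longrightarrow> s \<noteq> [] \<Longrightarrow> w \<le> s"
  unfolding lyndon_def suffix_def by (metis append_Nil less_le order_refl)

definition lyndon_list :: "'a::linorder list list \<Rightarrow> bool"
  where "lyndon_list ls \<longleftrightarrow> (\<forall>l\<in>set ls. lyndon l) \<and> sorted_wrt (\<ge>) ls"

lemma lyndon_list_snoc:
  "lyndon_list (ls @ [l]) \<longleftrightarrow> lyndon_list ls \<and> lyndon l \<and> (\<forall>l'\<in>set ls. l \<le> l')"
  by (auto simp: lyndon_list_def sorted_wrt_append)

text \<open>A suffix that starts inside a factor \<open>l\<close> begins with a suffix of \<open>l\<close>, which is at least \<open>l\<close> and
  hence at least the last factor.\<close>

lemma lyndon_list_last_le_suffix: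
  assumes "lyndon_list ls" "suffix s (concat ls)" "s \<noteq> []"
  shows "last ls \<le> s"
  using assms
proof (induction ls)
  case (Cons l ls)
  have "suffix s (l @ concat ls)" using Cons.prems(2) by simp
  then consider "suffix s (concat ls)"
    | t where "s = t @ concat ls" "suffix t l" "t \<noteq> []"
    by (metis suffix_append append_Nil suffix_order.order_refl)
  then show ?case
  proof cases
    case 1
    moreover from this Cons.prems(3) have "ls \<noteq> []" by auto
    ultimately show ?thesis using Cons by (simp add: lyndon_list_def)
  next
    case 2
    have "last (l # ls) \<le> l" using Cons.prems(1) by (auto simp: lyndon_list_def)
    also have "l \<le> t" using 2 Cons.prems(1) lyndon_le_suffix by (auto simp: lyndon_list_def)
    also have "t \<le> s" using 2 le_append by simp
    finally show ?thesis .
  qed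
qed simp

text \<open>The last factor is the smallest non-empty suffix of the whole word, so the word determines it.\<close>

lemma lyndon_factorization_unique:
  assumes "lyndon_list ls" "lyndon_list ls'" "concat ls = concat ls'"
  shows "ls = ls'"
  using assms
proof (induction ls arbitrary: ls' rule: rev_induct)
  case Nil
  then have "concat ls' = []" by simp
  then show ?case using Nil.prems(2) by (cases ls') (auto simp: lyndon_list_def lyndon_def)
next
  case (snoc l ls)
  have "l \<noteq> []" using snoc.prems(1) by (auto simp: lyndon_list_snoc lyndon_def)
  with snoc.prems(3) have "ls' \<noteq> []" by auto
  then obtain ks k where ls': "ls' = ks @ [k]" by (metis rev_exhaust)
  have "k \<noteq> []" using snoc.prems(2) ls' by (auto simp: lyndon_list_snoc lyndon_def)
  have "suffix k (concat ls')" "suffix l (concat (ls @ [l]))" using ls' by (auto simp: suffix_def)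
  with snoc.prems \<open>k \<noteq> []\<close> \<open>l \<noteq> []\<close> ls' have "l = k"
    using lyndon_list_last_le_suffix[of ls' l] lyndon_list_last_le_suffix[of "ls @ [l]" k]
    by (intro order.antisym) auto
  with snoc ls' show ?case by (auto simp: lyndon_list_snoc)
qed

text \<open>Split off the smallest non-empty suffix \<open>s\<close>, which is a Lyndon word, and factorize the rest. The
  last factor \<open>l\<close> of the rest is at least \<open>s\<close>: otherwise \<open>l < s \<le> l @ s\<close> forces \<open>s = l @ t\<close> with
  \<open>t \<le> s\<close>, which contradicts that \<open>s\<close> is smaller than its proper suffixes.\<close>

lemma lyndon_factorization_exists:
  fixes w :: "'a::linorder list"
  shows "\<exists>ls. lyndon_list ls \<and> concat ls = w"
proof (induction "length w" arbitrary: w rule: less_induct)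
  case less
  show ?case
  proof (cases "w = []")
    case True
    then show ?thesis by (intro exI[of _ "[]"]) (auto simp: lyndon_list_def)
  next
    case False
    let ?S = "{s. suffix s w \<and> s \<noteq> []}"
    have "?S \<subseteq> set (suffixes w)" by auto
    then have fin: "finite ?S" by (rule finite_subset) simp
    have "w \<in> ?S" using False by simp
    define s where "s = Min ?S"
    have s: "s \<in> ?S" using fin \<open>w \<in> ?S\<close> Min_in[of ?S] unfolding s_def by blast
    have min: "s \<le> t" if "t \<in> ?S" for t using fin that unfolding s_def by simp
    have lyn: "lyndon s"
      unfolding lyndon_def
    proof (intro conjI allI impI)
      show "s \<noteq> []" using s by simp
    next
      fix u v assume uv: "s = u @ v \<and> u \<noteq> [] \<and> v \<noteq> []"
      then have "v \<in> ?S" using s by (auto simp: suffix_def)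
      with min have "s \<le> v" by blast
      moreover have "s \<noteq> v" using uv by simp
      ultimately show "s < v" by simp
    qed
    obtain u where u: "w = u @ s" using s by (auto simp: suffix_def)
    have "length u < length w" using u s by auto
    with less obtain ls where ls: "lyndon_list ls" "concat ls = u" by blast
    have "s \<le> l" if "ls \<noteq> []" and l: "l = last ls" for l
    proof (rule ccontr)
      assume "\<not> s \<le> l"
      have "l \<in> set ls" using that by simp
      then have "l \<noteq> []" using ls by (auto simp: lyndon_list_def lyndon_def)
      have "u = concat (butlast ls) @ l"
        using ls that by (metis append_butlast_last_id concat.simps concat_append append_Nil2)
      then have "l @ s \<in> ?S" using u s by (auto intro: suffixI)
      then have 1: "s \<le> l @ s" by (rule min)
      then have "prefix l s"
        using \<open>\<not> s \<le> l\<close> append_less_if_not_prefix[of l s s] by (meson leD not_le)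
      then obtain t where t: "s = l @ t" by (auto simp: prefix_def)
      with 1 have "t \<le> s" by simp
      moreover have "t \<noteq> []" using t \<open>\<not> s \<le> l\<close> by auto
      ultimately show False using lyn t \<open>l \<noteq> []\<close> unfolding lyndon_def by (metis leD)
    qed
    moreover have "last ls \<le> l'" if "l' \<in> set ls" for l'
      using that ls(1) by (cases ls rule: rev_cases) (auto simp: lyndon_list_snoc)
    ultimately have "s \<le> l'" if "l' \<in> set ls" for l'
      using that order_trans by (metis empty_iff empty_set)
    then have "lyndon_list (ls @ [s])" using ls lyn by (simp add: lyndon_list_snoc)
    moreover have "concat (ls @ [s]) = w" using ls u by simp
    ultimately show ?thesis by blast
  qed
qed

section \<open>Leading words of products\<close>

definition struct_const :: "'d::finite cmp \<Rightarrow> 'd cmp \<Rightarrow> 'd cmp \<Rightarrow> nat"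
  where "struct_const a b c = card (occurrences (mono_of c) a b)"

lemma lookup_qsh_basis_basis:
  "lookup (qsh (basis a) (basis b)) c = (of_nat (struct_const a b c) :: 'k::comm_ring_1)"
  using lookup_qsh_basis[of a b "mono_of c"] by (simp add: qsh_def struct_const_def)

lemma struct_const_pos_iff:
  "struct_const a b c > 0 \<longleftrightarrow> (\<exists>z\<in>splits (mono_of c). cmpr (fst z) = a \<and> cmpr (snd z) = b)"
proof -
  have "finite (occurrences (mono_of c) a b)"
    by (rule finite_subset[OF _ finite_splits[of "mono_of c"]]) (auto simp: occurrences_def)
  then show ?thesis unfolding struct_const_def card_gt_0_iff by (fastforce simp: occurrences_def)
qed

lemma struct_const_cmpr: "struct_const a b (cmpr F) = card (occurrences F a b)"
proof -
  have "(of_nat (struct_const a b (cmpr F)) :: int) = of_nat (card (occurrences F a b))"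
    using lookup_qsh_basis[of a b F, where 'k = int]
      lookup_qsh_basis_basis[of a b "cmpr F", where 'k = int] by (simp add: qsh_def)
  then show ?thesis by (simp only: of_nat_eq_iff)
qed

lemma struct_const_cempty: "struct_const cempty b c = (if c = b then 1 else 0)"
  "struct_const a cempty c = (if c = a then 1 else 0)"
proof -
  have "(of_nat (struct_const cempty b c) :: int) = of_nat (if c = b then 1 else 0)"
    "(of_nat (struct_const a cempty c) :: int) = of_nat (if c = a then 1 else 0)"
    by (simp_all flip: lookup_qsh_basis_basis add: lookup_basis)
  then show "struct_const cempty b c = (if c = b then 1 else 0)"
    "struct_const a cempty c = (if c = a then 1 else 0)" by (simp_all only: of_nat_eq_iff)
qed

text \<open>The compatibility of product and coproduct, read for a single coefficient: all sums involved have
  non-negative terms.\<close>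

lemma struct_const_cdiagD:
  assumes "struct_const a b (cdiag c d) > 0"
  shows "\<exists>a1 a2 b1 b2. a = cdiag a1 a2 \<and> b = cdiag b1 b2 \<and>
    struct_const a1 b1 c > 0 \<and> struct_const a2 b2 d > 0"
proof -
  let ?a = "basis a :: 'a cmp \<Rightarrow>\<^sub>0 int" and ?b = "basis b :: 'a cmp \<Rightarrow>\<^sub>0 int"
  have "lookup (deconc (qsh ?a ?b)) (cmpr (mono_of c), cmpr (mono_of d)) \<noteq> 0"
    using assms by (simp add: lookup_deconc lookup_qsh_basis_basis)
  then obtain z w where zw: "z \<in> splits (mono_of c)" "w \<in> splits (mono_of d)"
    "lookup (deconc ?a) (cmpr (fst z), cmpr (fst w)) * lookup (deconc ?b) (cmpr (snd z), cmpr (snd w)) \<noteq> 0"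
    unfolding deconc_qsh lookup_tensor_mult by (meson sum.not_neutral_contains_not_neutral)
  have "a = cdiag (cmpr (fst z)) (cmpr (fst w))" "b = cdiag (cmpr (snd z)) (cmpr (snd w))"
    using zw(3) by (auto simp: lookup_deconc lookup_basis split: if_splits)
  moreover have "struct_const (cmpr (fst z)) (cmpr (snd z)) c > 0"
    "struct_const (cmpr (fst w)) (cmpr (snd w)) d > 0"
    using zw(1,2) by (auto simp: struct_const_pos_iff)
  ultimately show ?thesis by blast
qed

text \<open>By \<open>struct_const_cdiagD\<close>, the first component \<open>u\<close> of \<open>c\<close> occurs in the product of an initial
  block \<open>a1\<close> of \<open>a\<close> and an initial block \<open>b1\<close> of \<open>b\<close>. If one of these blocks is empty, then \<open>u\<close> is the
  other one, which is a single letter. Otherwise at least two letters are used up for one.\<close>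

lemma struct_const_word:
  assumes "struct_const a b c > 0"
  shows "length (factors c) < length (factors a) + length (factors b) \<or>
    factors c \<in> shuffles (factors a) (factors b)"
  using assms
proof (induction "factors c" arbitrary: a b c)
  case Nil
  then have "c = cempty" by (metis factors_eq_Nil_iff)
  then obtain z where "z \<in> splits 0" "cmpr (fst z) = a" "cmpr (snd z) = b"
    using Nil.prems by (auto simp: struct_const_pos_iff)
  then have "a = cempty" "b = cempty" by (auto simp: splits_0 cmpr_eq_cempty_iff)
  then show ?case using \<open>c = cempty\<close> by simp
next
  case (Cons u us)
  have con: "\<forall>v\<in>set (u # us). cconnected v" using Cons.hyps(2) cconnected_factors by metis
  define d where "d = cdiag_list us"
  have c: "c = cdiag u d" using Cons.hyps(2) by (metis cdiag_list_factors cdiag_list_simps(2) d_def)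
  have d: "factors d = us" using con by (simp add: d_def factors_cdiag_list)
  have u: "factors u = [u]" using con factors_cdiag_list[of "[u]"] by simp
  obtain a1 a2 b1 b2 where ab: "a = cdiag a1 a2" "b = cdiag b1 b2"
    "struct_const a1 b1 u > 0" "struct_const a2 b2 d > 0"
    using struct_const_cdiagD Cons.prems c by blast
  have IH: "length us < length (factors a2) + length (factors b2) \<or> us \<in> shuffles (factors a2) (factors b2)"
    using Cons.hyps(1)[OF d[symmetric] ab(4)] d by simp
  consider "a1 = cempty" | "b1 = cempty" | "a1 \<noteq> cempty" "b1 \<noteq> cempty" by blast
  then show ?case
  proof cases
    case 1
    then have "u = b1" using ab(3) by (auto simp: struct_const_cempty split: if_splits)
    then have "factors a = factors a2" "factors b = u # factors b2"
      using 1 ab(1,2) u by (simp_all add: factors_cdiag)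
    then show ?thesis using IH Cons.hyps(2)[symmetric] by (auto intro: Cons_in_shuffles_rightI)
  next
    case 2
    then have "u = a1" using ab(3) by (auto simp: struct_const_cempty split: if_splits)
    then have "factors b = factors b2" "factors a = u # factors a2"
      using 2 ab(1,2) u by (simp_all add: factors_cdiag)
    then show ?thesis using IH Cons.hyps(2)[symmetric] by (auto intro: Cons_in_shuffles_leftI)
  next
    case 3
    then have "1 \<le> length (factors a1)" "1 \<le> length (factors b1)" by (simp_all add: Suc_le_eq)
    moreover have "length us \<le> length (factors a2) + length (factors b2)"
      using IH length_shuffles by fastforce
    ultimately have "length (factors c) < length (factors a) + length (factors b)"
      unfolding ab(1,2) factors_cdiag length_append Cons.hyps(2)[symmetric] list.size by linarith
    then show ?thesis ..
  qed
qed

text \<open>The product contains the block diagonal composition: place the two compositions one below the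
  other.\<close>

lemma struct_const_cdiag: "struct_const a b (cdiag a b) > 0"
proof -
  obtain F G where FG: "below F G" "cmpr F = a" "cmpr G = b" by (rule obtain_below)
  have "(F, G) \<in> occurrences (F + G) a b" using FG by (simp add: occurrences_def splits_def)
  moreover have "finite (occurrences (F + G) a b)"
    by (rule finite_subset[OF _ finite_splits[of "F + G"]]) (auto simp: occurrences_def)
  ultimately have "card (occurrences (F + G) a b) > 0" by (auto simp: card_gt_0_iff)
  then show ?thesis using FG by (simp flip: struct_const_cmpr add: cmpr_add_below)
qed

text \<open>Lyndon words need an order on the letters. The triangularity argument is an induction over words and
  needs this order to be well-founded, so a well-order is chosen.\<close>

definition cmp_order :: "('d::finite cmp \<times> 'd cmp) set"
  where "cmp_order = (SOME r. well_order_on UNIV r)"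

lemma well_order_cmp_order: "well_order_on UNIV cmp_order"
  unfolding cmp_order_def by (rule someI_ex[OF well_order_on])

instantiation cmp :: (finite) wellorder
begin

definition less_eq_cmp :: "'a cmp \<Rightarrow> 'a cmp \<Rightarrow> bool"
  where "less_eq_cmp a b \<longleftrightarrow> (a, b) \<in> cmp_order"

definition less_cmp :: "'a cmp \<Rightarrow> 'a cmp \<Rightarrow> bool"
  where "less_cmp a b \<longleftrightarrow> (a, b) \<in> cmp_order - Id"

instance
proof
  have lin: "linear_order_on UNIV (cmp_order :: ('a cmp \<times> 'a cmp) set)"
    and wf: "wf (cmp_order - Id :: ('a cmp \<times> 'a cmp) set)"
    using well_order_cmp_order by (auto simp: well_order_on_def)
  then have refl: "refl (cmp_order :: ('a cmp \<times> 'a cmp) set)"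
    and tr: "trans (cmp_order :: ('a cmp \<times> 'a cmp) set)"
    and anti: "antisym (cmp_order :: ('a cmp \<times> 'a cmp) set)"
    and tot: "total (cmp_order :: ('a cmp \<times> 'a cmp) set)"
    by (auto simp: linear_order_on_def partial_order_on_def preorder_on_def)
  fix a b c :: "'a cmp"
  show "a < b \<longleftrightarrow> a \<le> b \<and> \<not> b \<le> a"
    using anti refl by (auto simp: less_eq_cmp_def less_cmp_def dest: antisymD reflD)
  show "a \<le> a" using refl by (auto simp: less_eq_cmp_def dest: reflD)
  show "a \<le> b \<Longrightarrow> b \<le> c \<Longrightarrow> a \<le> c" using tr by (auto simp: less_eq_cmp_def dest: transD)
  show "a \<le> b \<Longrightarrow> b \<le> a \<Longrightarrow> a = b" using anti by (auto simp: less_eq_cmp_def dest: antisymD)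
  show "a \<le> b \<or> b \<le> a"
    using tot reflD[OF refl, of a] by (cases "a = b") (auto simp: less_eq_cmp_def total_on_def)
  fix P :: "'a cmp \<Rightarrow> bool"
  assume "\<And>x. (\<And>y. y < x \<Longrightarrow> P y) \<Longrightarrow> P x"
  then show "P a" using wf_induct_rule[OF wf] unfolding less_cmp_def by blast
qed

end

text \<open>First by length and then lexicographically, since a product contributes shorter words besides the
  shuffles.\<close>

definition word_le :: "'a::linorder list \<Rightarrow> 'a list \<Rightarrow> bool"
  where "word_le u w \<longleftrightarrow> length u < length w \<or> length u = length w \<and> u \<le> w"

text \<open>The word \<open>w\<close> is the largest one in \<open>x\<close>. The coefficients are required to be natural numbers because
  positive numbers cannot cancel: the leading coefficient of a product is then positive again, and it
  need not be known exactly.\<close>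

definition leads :: "('d::finite cmp \<Rightarrow>\<^sub>0 'k::comm_ring_1) \<Rightarrow> 'd cmp list \<Rightarrow> bool"
  where "leads x w \<longleftrightarrow> (\<exists>f :: 'd cmp \<Rightarrow> nat. (\<forall>c. lookup x c = of_nat (f c)) \<and>
    f (cdiag_list w) > 0 \<and> (\<forall>c. f c > 0 \<longrightarrow> word_le (factors c) w))"

lemma leads_unit: "leads (basis cempty) []"
  unfolding leads_def
  by (rule exI[of _ "\<lambda>c. if c = cempty then 1 else 0"]) (auto simp: lookup_basis word_le_def)

text \<open>The hypothesis on suffixes makes \<open>u @ v\<close> the largest shuffle of \<open>u\<close> and \<open>v\<close>; shuffles of \<open>v\<close> with
  words smaller than \<open>u\<close> are no larger by \<open>shuffles_mono\<close>.\<close>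

lemma leads_qsh:
  fixes x :: "'d::finite cmp \<Rightarrow>\<^sub>0 'k::idom"
  assumes char: "\<And>n. n > 0 \<Longrightarrow> (of_nat n :: 'k) \<noteq> 0"
    and x: "leads x u"
    and con: "\<forall>c\<in>set u. cconnected c" "\<forall>c\<in>set v. cconnected c"
    and suff: "\<And>s. s \<noteq> [] \<Longrightarrow> suffix s u \<Longrightarrow> v \<le> s"
  shows "leads (qsh x (basis (cdiag_list v))) (u @ v)"
proof -
  obtain f where f: "\<And>c. lookup x c = of_nat (f c)" "f (cdiag_list u) > 0"
    "\<And>c. f c > 0 \<Longrightarrow> word_le (factors c) u"
    using x unfolding leads_def by blast
  have keys: "a \<in> keys x \<longleftrightarrow> f a > 0" for a
    using char[of "f a"] f(1)[of a] by (cases "f a = 0") (auto simp: in_keys_iff)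
  define g where "g c = (\<Sum>a\<in>keys x. f a * struct_const a (cdiag_list v) c)" for c
  have "lookup (qsh x (basis (cdiag_list v))) c = of_nat (g c)" for c
  proof -
    have "qsh x (basis (cdiag_list v)) = lin (\<lambda>a. qsh (basis a) (basis (cdiag_list v))) x"
      by (simp add: qsh_def bilin_def)
    then show ?thesis by (simp add: lookup_lin lookup_qsh_basis_basis f(1) g_def)
  qed
  moreover have "g (cdiag_list (u @ v)) > 0"
  proof -
    have "cdiag_list u \<in> keys x" using keys f(2) by simp
    moreover have "f (cdiag_list u) * struct_const (cdiag_list u) (cdiag_list v) (cdiag_list (u @ v)) > 0"
      using f(2) struct_const_cdiag by (simp add: cdiag_list_append)
    ultimately show ?thesis unfolding g_def by (meson finite_keys sum_pos2 zero_le)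
  qed
  moreover have "word_le (factors c) (u @ v)" if "g c > 0" for c
  proof -
    have "(\<Sum>a\<in>keys x. f a * struct_const a (cdiag_list v) c) \<noteq> 0"
      using \<open>g c > 0\<close> unfolding g_def by linarith
    then obtain a where "f a * struct_const a (cdiag_list v) c \<noteq> 0"
      by (rule sum.not_neutral_contains_not_neutral)
    then have a: "word_le (factors a) u" "struct_const a (cdiag_list v) c > 0" using f(3) by auto
    from struct_const_word[OF a(2)] consider "length (factors c) < length (factors a) + length v"
      | "factors c \<in> shuffles (factors a) v"
      using con by (auto simp: factors_cdiag_list)
    then show ?thesis
    proof cases
      case 1
      then show ?thesis using a(1) by (auto simp: word_le_def)
    next
      case 2
      show ?thesis
      proof (cases "length (factors a) < length u")
        case True
        then show ?thesis using length_shuffles[OF 2] by (simp add: word_le_def)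
      next
        case False
        with a(1) have "length (factors a) = length u" "factors a \<le> u" by (auto simp: word_le_def)
        with 2 obtain y where y: "y \<in> shuffles u v" "factors c \<le> y" using shuffles_mono by blast
        have "y \<le> u @ v" using suff y(1) by (rule shuffles_le_append)
        with y(2) have "factors c \<le> u @ v" by simp
        then show ?thesis
          using length_shuffles[OF 2] \<open>length (factors a) = length u\<close> by (simp add: word_le_def)
      qed
    qed
  qed
  ultimately show ?thesis unfolding leads_def by blast
qed

lemma leads_lyndon_list:
  assumes char: "\<And>n. n > 0 \<Longrightarrow> (of_nat n :: 'k::idom) \<noteq> 0"
    and "lyndon_list ls" "\<forall>l\<in>set ls. \<forall>v\<in>set l. cconnected v"
  shows "leads (qsh_prod (map (\<lambda>l. basis (cdiag_list l)) ls) :: 'd::finite cmp \<Rightarrow>\<^sub>0 'k) (concat ls)"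
  using assms(2,3)
proof (induction ls rule: rev_induct)
  case Nil
  then show ?case by (simp add: qsh_prod_def leads_unit)
next
  case (snoc l ls)
  have "l \<le> s" if "s \<noteq> []" "suffix s (concat ls)" for s
  proof -
    have "ls \<noteq> []" using that by auto
    then have "l \<le> last ls" using snoc.prems(1) by (simp add: lyndon_list_snoc)
    also have "last ls \<le> s"
      using lyndon_list_last_le_suffix that snoc.prems(1) lyndon_list_snoc by blast
    finally show ?thesis .
  qed
  then have "leads (qsh (qsh_prod (map (\<lambda>l. basis (cdiag_list l)) ls)) (basis (cdiag_list l))
      :: 'd cmp \<Rightarrow>\<^sub>0 'k) (concat ls @ l)"
    using snoc by (intro leads_qsh char) (auto simp: lyndon_list_snoc)
  then show ?case by (simp add: qsh_prod_append qsh_prod_Cons) (simp add: qsh_prod_def)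
qed

section \<open>Freeness\<close>

text \<open>A family that is triangular with units on the diagonal is a basis. Independence: in a linear
  relation, consider a maximal leading element, to which no other member of the family contributes.
  Spanning: by well-founded induction, solve for the leading element.\<close>

lemma bij_lin_if_triangular:
  fixes f :: "'a \<Rightarrow> ('b \<Rightarrow>\<^sub>0 'k::idom)"
  assumes wf: "wf r" and lead: "bij_betw lead A UNIV"
    and unit: "\<And>a. a \<in> A \<Longrightarrow> lookup (f a) (lead a) dvd 1"
    and low: "\<And>a b. a \<in> A \<Longrightarrow> lookup (f a) b \<noteq> 0 \<Longrightarrow> b = lead a \<or> (b, lead a) \<in> r"
  shows "bij_betw (lin f) {P. keys P \<subseteq> A} UNIV"
proof -
  have nonzero: "lin f D \<noteq> 0" if D: "keys D \<subseteq> A" "D \<noteq> 0" for D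
  proof -
    define S where "S = lead ` keys D"
    let ?r = "r \<inter> S \<times> S"
    have "finite S" "S \<noteq> {}" using D(2) by (auto simp: S_def)
    have "acyclic ?r" using wf by (meson acyclic_subset inf_le1 wf_acyclic)
    then have "wf (?r\<inverse>)" using \<open>finite S\<close> by (intro finite_acyclic_wf_converse) auto
    then obtain m where m: "m \<in> S" "\<And>b. (b, m) \<in> ?r\<inverse> \<Longrightarrow> b \<notin> S"
      using \<open>S \<noteq> {}\<close> by (metis ex_in_conv wfE_min)
    from m(1) obtain a where a: "a \<in> keys D" "m = lead a" by (auto simp: S_def)
    have "lookup (lin f D) m = (\<Sum>b\<in>keys D. if b = a then lookup D a * lookup (f a) m else 0)"
      unfolding lookup_lin
    proof (rule sum.cong[OF refl])
      fix b assume b: "b \<in> keys D"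
      have "lookup (f b) m = 0" if "b \<noteq> a"
      proof (rule ccontr)
        assume "lookup (f b) m \<noteq> 0"
        then have "m = lead b \<or> (m, lead b) \<in> r" using low[of b m] b D(1) by blast
        moreover have "lead b \<noteq> lead a"
          using that lead a(1) b D(1) unfolding bij_betw_def inj_on_def by blast
        ultimately have "(m, lead b) \<in> r" using a(2) by auto
        then show False using m b by (auto simp: S_def)
      qed
      then show "lookup D b * lookup (f b) m = (if b = a then lookup D a * lookup (f a) m else 0)"
        by auto
    qed
    also have "\<dots> = lookup D a * lookup (f a) m" using a(1) by simp
    also have "\<dots> \<noteq> 0"
    proof -
      have "lookup (f a) m \<noteq> 0" using unit[of a] a D(1) by auto
      then show ?thesis using a(1) by (simp add: in_keys_iff)
    qed
    finally show ?thesis by auto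
  qed
  have inj: "inj_on (lin f) {P. keys P \<subseteq> A}"
  proof (rule inj_onI, rule ccontr)
    fix P Q assume PQ: "P \<in> {P. keys P \<subseteq> A}" "Q \<in> {P. keys P \<subseteq> A}" "lin f P = lin f Q" "P \<noteq> Q"
    have "keys (P - Q) \<subseteq> A"
      using PQ(1,2) by (auto simp: in_keys_iff lookup_minus) (metis diff_self in_keys_iff subsetD)
    moreover have "lin f (P - Q) = 0"
      using PQ(3) module_hom.diff[OF module_hom_lin, of f P Q] by simp
    ultimately show False using nonzero[of "P - Q"] PQ(4) by auto
  qed
  define I where "I = lin f ` {P. keys P \<subseteq> A}"
  have subI: "fm.subspace I"
  proof (rule fm.subspaceI)
    show "0 \<in> I" unfolding I_def by (rule image_eqI[of _ _ 0]) (simp_all add: lin_def)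
  next
    fix x y assume "x \<in> I" "y \<in> I"
    then obtain P Q where "x = lin f P" "keys P \<subseteq> A" "y = lin f Q" "keys Q \<subseteq> A" by (auto simp: I_def)
    then show "x + y \<in> I"
      unfolding I_def using keys_add[of P Q] by (intro image_eqI[of _ _ "P + Q"]) (auto simp: lin_add)
  next
    fix c x assume "x \<in> I"
    then obtain P where "x = lin f P" "keys P \<subseteq> A" by (auto simp: I_def)
    then show "scl c x \<in> I"
      unfolding I_def by (intro image_eqI[of _ _ "scl c P"]) (auto simp: lin_scl in_keys_iff)
  qed
  have basisI: "basis b \<in> I" for b
    using wf
  proof (induction b rule: wf_induct_rule)
    case (less b)
    obtain a where a: "a \<in> A" "lead a = b" using lead by (metis UNIV_I bij_betw_imp_surj_on imageE)
    obtain w where w: "lookup (f a) b * w = 1" using unit[OF a(1)] a(2) by (metis dvd_def)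
    have fa: "f a \<in> I"
      unfolding I_def using a(1) by (intro image_eqI[of _ _ "basis a"]) auto
    have "b \<in> keys (f a)" using w by (auto simp: in_keys_iff)
    then have "f a = scl (lookup (f a) b) (basis b) + (\<Sum>c\<in>keys (f a) - {b}. scl (lookup (f a) c) (basis c))"
      using basis_expansion[of "f a"] by (simp add: sum.remove)
    then have "scl w (f a - (\<Sum>c\<in>keys (f a) - {b}. scl (lookup (f a) c) (basis c))) =
        scl w (scl (lookup (f a) b) (basis b))" by (metis add_diff_cancel_right')
    also have "\<dots> = basis b" using w by (simp add: mult.commute)
    finally have "basis b = scl w (f a - (\<Sum>c\<in>keys (f a) - {b}. scl (lookup (f a) c) (basis c)))" ..
    also have "\<dots> \<in> I"
    proof (intro fm.subspace_scale[OF subI] fm.subspace_diff[OF subI] fa fm.subspace_sum[OF subI])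
      fix c assume c: "c \<in> keys (f a) - {b}"
      then have "(c, b) \<in> r" using low[OF a(1), of c] a(2) by (auto simp: in_keys_iff)
      then show "basis c \<in> I" by (rule less)
    qed
    finally show ?case .
  qed
  have "y \<in> I" for y
  proof -
    have "(\<Sum>b\<in>keys y. scl (lookup y b) (basis b)) \<in> I"
      by (intro fm.subspace_sum[OF subI] fm.subspace_scale[OF subI] basisI)
    then show ?thesis using basis_expansion[of y] by simp
  qed
  then have "I = UNIV" by blast
  with inj show ?thesis unfolding bij_betw_def I_def by blast
qed

text \<open>A monomial in the polynomial ring, seen as the multiset of its variables.\<close>

definition mset_of :: "('x \<Rightarrow>\<^sub>0 nat) \<Rightarrow> 'x multiset"
  where "mset_of \<alpha> = (\<Sum>x\<in>keys \<alpha>. replicate_mset (lookup \<alpha> x) x)"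

lemma count_mset_of [simp]: "count (mset_of \<alpha>) x = lookup \<alpha> x"
  by (simp add: mset_of_def count_sum in_keys_iff if_distrib cong: if_cong)

lemma mset_of_add: "mset_of (\<alpha> + \<beta>) = mset_of \<alpha> + mset_of \<beta>"
  and mset_of_single: "mset_of (Poly_Mapping.single x 1) = {#x#}"
  and mset_of_0: "mset_of 0 = {#}"
  by (rule multiset_eqI; simp add: lookup_add lookup_single when_def)+

lemma mset_of_inject: "mset_of \<alpha> = mset_of \<beta> \<Longrightarrow> \<alpha> = \<beta>"
  by (rule poly_mapping_eqI) (metis count_mset_of)

lemma set_mset_of: "set_mset (mset_of \<alpha>) = keys \<alpha>"
  by (auto simp: in_keys_iff simp flip: count_greater_zero_iff)

lemma mset_of_surj: "\<exists>\<alpha>. mset_of \<alpha> = mset xs"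
proof (induction xs)
  case Nil
  then show ?case using mset_of_0 by auto
next
  case (Cons x xs)
  then obtain \<alpha> where "mset_of \<alpha> = mset xs" by blast
  then have "mset_of (Poly_Mapping.single x 1 + \<alpha>) = mset (x # xs)"
    by (simp only: mset_of_add mset_of_single) simp
  then show ?case by blast
qed

interpretation qsh_mset: comm_monoid_mset qsh "basis cempty"
proof unfold_locales
  fix a b c :: "'a::finite cmp \<Rightarrow>\<^sub>0 'b::comm_ring_1"
  show "qsh (qsh a b) c = qsh a (qsh b c)" by (rule qsh_assoc)
  show "qsh a b = qsh b a" by (rule qsh_commute)
  show "qsh a (basis cempty) = a" by simp
qed

text \<open>The value of a monomial under the substitution of every variable, which is an element of the
  algebra, by itself.\<close>

definition qsh_monomial :: "(('d::finite cmp \<Rightarrow>\<^sub>0 'k::comm_ring_1) \<Rightarrow>\<^sub>0 nat) \<Rightarrow> ('d cmp \<Rightarrow>\<^sub>0 'k)"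
  where "qsh_monomial \<alpha> = qsh_mset.F (mset_of \<alpha>)"

lemma qsh_mset_mset: "qsh_mset.F (mset xs) = qsh_prod xs"
  by (induction xs) (simp_all add: qsh_prod_def)

text \<open>Scalars are constant polynomials.\<close>

lemma scl_mult:
  fixes P Q :: "('x \<Rightarrow>\<^sub>0 nat) \<Rightarrow>\<^sub>0 'k::comm_ring_1"
  shows "scl c P * Q = scl c (P * Q)" "P * scl c Q = scl c (P * Q)"
  by (simp_all add: scl_def mult_map_scale_conv_mult ac_simps)

lemma lin_qsh_monomial_mult:
  fixes P Q :: "(('d::finite cmp \<Rightarrow>\<^sub>0 'k::comm_ring_1) \<Rightarrow>\<^sub>0 nat) \<Rightarrow>\<^sub>0 'k"
  shows "lin qsh_monomial (P * Q) = qsh (lin qsh_monomial P) (lin qsh_monomial Q)"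
proof -
  let ?\<phi> = "lin qsh_monomial :: ((('d cmp \<Rightarrow>\<^sub>0 'k) \<Rightarrow>\<^sub>0 nat) \<Rightarrow>\<^sub>0 'k) \<Rightarrow> _"
  let ?f = "\<lambda>\<alpha> \<beta>. qsh_monomial (\<alpha> + \<beta>) :: 'd cmp \<Rightarrow>\<^sub>0 'k"
  have mult_hom: "module_hom scl scl (\<lambda>P. P * Q)" "module_hom scl scl ((*) Q)"
    for Q :: "(('d cmp \<Rightarrow>\<^sub>0 'k) \<Rightarrow>\<^sub>0 nat) \<Rightarrow>\<^sub>0 'k"
    by (unfold_locales; simp add: scl_mult distrib_left distrib_right)+
  have "(\<lambda>P Q. ?\<phi> (P * Q)) = bilin ?f"
  proof (rule bilin_unique)
    show "module_hom scl scl (\<lambda>P. ?\<phi> (P * Q))" "module_hom scl scl (\<lambda>P. ?\<phi> (Q * P))" for Q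
      using module_hom_compose[OF mult_hom(1) module_hom_lin]
        module_hom_compose[OF mult_hom(2) module_hom_lin] by (simp_all add: o_def)
  qed (simp add: mult_single)
  moreover have "(\<lambda>P Q. qsh (?\<phi> P) (?\<phi> Q)) = bilin ?f"
  proof (rule bilin_unique)
    show "module_hom scl scl (\<lambda>P. qsh (?\<phi> P) (?\<phi> Q))" "module_hom scl scl (\<lambda>P. qsh (?\<phi> Q) (?\<phi> P))" for Q
      using module_hom_compose[OF module_hom_lin qsh_linear(1)]
        module_hom_compose[OF module_hom_lin qsh_linear(2)] by (simp_all add: o_def)
  qed (simp add: qsh_monomial_def mset_of_add)
  ultimately show ?thesis by metis
qed

definition lyndon_cmps :: "'d::finite cmp list set"
  where "lyndon_cmps = {l. lyndon l \<and> (\<forall>v\<in>set l. cconnected v)}"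

abbreviation word_basis :: "'d::finite cmp list \<Rightarrow> ('d cmp \<Rightarrow>\<^sub>0 'k::comm_ring_1)"
  where "word_basis l \<equiv> basis (cdiag_list l)"

lemma inj_word_basis: "inj_on (word_basis :: _ \<Rightarrow> ('d::finite cmp \<Rightarrow>\<^sub>0 'k::comm_ring_1)) lyndon_cmps"
proof (rule inj_onI)
  fix l l' :: "'d cmp list"
  assume l: "l \<in> lyndon_cmps" "l' \<in> lyndon_cmps" and eq: "word_basis l = (word_basis l' :: 'd cmp \<Rightarrow>\<^sub>0 'k)"
  have "lookup (word_basis l' :: 'd cmp \<Rightarrow>\<^sub>0 'k) (cdiag_list l) = 1"
    using arg_cong[OF eq, of "\<lambda>x. lookup x (cdiag_list l)"] by simp
  then have "cdiag_list l = cdiag_list l'" by (simp add: lookup_basis split: if_splits)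
  then show "l = l'" using l cdiag_list_inject unfolding lyndon_cmps_def by blast
qed

text \<open>For a monomial in the Lyndon words, the list of these words in non-increasing order.\<close>

definition lyndon_words_of :: "(('d::finite cmp \<Rightarrow>\<^sub>0 'k::comm_ring_1) \<Rightarrow>\<^sub>0 nat) \<Rightarrow> 'd cmp list list"
  where "lyndon_words_of \<alpha> =
    rev (sorted_list_of_multiset (image_mset (inv_into lyndon_cmps word_basis) (mset_of \<alpha>)))"

lemma lyndon_words_of:
  fixes \<alpha> :: "('d::finite cmp \<Rightarrow>\<^sub>0 'k::comm_ring_1) \<Rightarrow>\<^sub>0 nat"
  assumes "keys \<alpha> \<subseteq> word_basis ` lyndon_cmps"
  shows "set (lyndon_words_of \<alpha>) \<subseteq> lyndon_cmps" "lyndon_list (lyndon_words_of \<alpha>)"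
    "mset (map word_basis (lyndon_words_of \<alpha>)) = mset_of \<alpha>"
proof -
  let ?w = "word_basis :: _ \<Rightarrow> ('d cmp \<Rightarrow>\<^sub>0 'k)" and ?v = "inv_into lyndon_cmps word_basis"
  have set: "set (lyndon_words_of \<alpha>) = ?v ` keys \<alpha>"
    by (simp add: lyndon_words_of_def set_mset_of)
  have "?v x \<in> lyndon_cmps" if "x \<in> keys \<alpha>" for x
    by (rule inv_into_into) (use assms that in blast)
  then show sub: "set (lyndon_words_of \<alpha>) \<subseteq> lyndon_cmps"
    unfolding set by (rule image_subsetI)
  show "lyndon_list (lyndon_words_of \<alpha>)"
    unfolding lyndon_list_def
  proof
    show "\<forall>l\<in>set (lyndon_words_of \<alpha>). lyndon l" using sub unfolding lyndon_cmps_def by blast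
    show "sorted_wrt (\<ge>) (lyndon_words_of \<alpha>)"
      unfolding lyndon_words_of_def sorted_wrt_rev by simp
  qed
  have "mset (map ?w (lyndon_words_of \<alpha>)) = image_mset (\<lambda>x. ?w (?v x)) (mset_of \<alpha>)"
    by (simp add: lyndon_words_of_def multiset.map_comp o_def)
  also have "\<dots> = image_mset (\<lambda>x. x) (mset_of \<alpha>)"
  proof (rule image_mset_cong)
    fix x assume "x \<in># mset_of \<alpha>"
    then have "x \<in> ?w ` lyndon_cmps" using assms by (auto simp: set_mset_of)
    then show "?w (?v x) = x" by (rule f_inv_into_f)
  qed
  finally show "mset (map ?w (lyndon_words_of \<alpha>)) = mset_of \<alpha>" by simp
qed

definition lead_cmp :: "(('d::finite cmp \<Rightarrow>\<^sub>0 'k::comm_ring_1) \<Rightarrow>\<^sub>0 nat) \<Rightarrow> 'd cmp"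
  where "lead_cmp \<alpha> = cdiag_list (concat (lyndon_words_of \<alpha>))"

text \<open>The unique factorization into non-increasing Lyndon words.\<close>

lemma bij_lead_cmp:
  "bij_betw (lead_cmp :: (('d::finite cmp \<Rightarrow>\<^sub>0 'k::comm_ring_1) \<Rightarrow>\<^sub>0 nat) \<Rightarrow> _)
    {\<alpha>. keys \<alpha> \<subseteq> word_basis ` lyndon_cmps} UNIV"
  (is "bij_betw ?lead ?A UNIV")
proof (rule bij_betw_imageI)
  show "inj_on ?lead ?A"
  proof (rule inj_onI)
    fix \<alpha> \<beta> assume "\<alpha> \<in> ?A" "\<beta> \<in> ?A" and eq: "?lead \<alpha> = ?lead \<beta>"
    then have \<alpha>: "keys \<alpha> \<subseteq> word_basis ` lyndon_cmps" and \<beta>: "keys \<beta> \<subseteq> word_basis ` lyndon_cmps" by auto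
    have "concat (lyndon_words_of \<alpha>) = concat (lyndon_words_of \<beta>)"
      using eq unfolding lead_cmp_def
      by (rule cdiag_list_inject[rotated 2])
        (use lyndon_words_of(1)[OF \<alpha>] lyndon_words_of(1)[OF \<beta>] in \<open>auto simp: lyndon_cmps_def\<close>)
    then have "lyndon_words_of \<alpha> = lyndon_words_of \<beta>"
      using lyndon_factorization_unique lyndon_words_of(2)[OF \<alpha>] lyndon_words_of(2)[OF \<beta>] by blast
    then have "mset_of \<alpha> = mset_of \<beta>"
      using lyndon_words_of(3)[OF \<alpha>] lyndon_words_of(3)[OF \<beta>] by metis
    then show "\<alpha> = \<beta>" by (rule mset_of_inject)
  qed
  have "c \<in> ?lead ` ?A" for c
  proof -
    obtain ls where ls: "lyndon_list ls" "concat ls = factors c" using lyndon_factorization_exists by blast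
    have "set l \<subseteq> set (factors c)" if "l \<in> set ls" for l using that by (auto simp flip: ls(2))
    then have sub: "set ls \<subseteq> lyndon_cmps"
      using ls(1) cconnected_factors unfolding lyndon_list_def lyndon_cmps_def by blast
    obtain \<alpha> :: "('d cmp \<Rightarrow>\<^sub>0 'k) \<Rightarrow>\<^sub>0 nat" where \<alpha>: "mset_of \<alpha> = mset (map word_basis ls)"
      using mset_of_surj by blast
    have "keys \<alpha> = set (map word_basis ls)" using arg_cong[OF \<alpha>, of set_mset] by (simp add: set_mset_of)
    then have A: "\<alpha> \<in> ?A" using sub by auto
    have "image_mset (inv_into lyndon_cmps word_basis) (mset_of \<alpha>) =
        image_mset (\<lambda>l. inv_into lyndon_cmps word_basis (word_basis l :: 'd cmp \<Rightarrow>\<^sub>0 'k)) (mset ls)"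
      by (simp add: \<alpha> multiset.map_comp o_def)
    also have "\<dots> = image_mset (\<lambda>l. l) (mset ls)"
      by (rule image_mset_cong) (use sub inv_into_f_f[OF inj_word_basis] in auto)
    finally have "lyndon_words_of \<alpha> = rev (sort ls)"
      by (simp add: lyndon_words_of_def)
    also have "sort ls = rev ls"
      using ls(1) by (intro properties_for_sort) (auto simp: lyndon_list_def sorted_wrt_rev)
    finally have "?lead \<alpha> = c" by (simp add: lead_cmp_def ls(2))
    with A show ?thesis by blast
  qed
  then show "?lead ` ?A = UNIV" by blast
qed

lemma word_le_imp: "word_le u w \<Longrightarrow> u = w \<or> (u, w) \<in> lenlex {(x, y). x < y}"
  by (auto simp: word_le_def lenlex_conv list_le_def list_less_def lexord_lex)

text \<open>The monomials in the Lyndon words form a basis: their leading words run exactly once through all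
  words, and the leading coefficients are invertible.\<close>

lemma bij_lin_qsh_monomial:
  assumes unit: "\<And>n. n > 0 \<Longrightarrow> (of_nat n :: 'k::idom) dvd 1"
  shows "bij_betw (lin (qsh_monomial :: (('d::finite cmp \<Rightarrow>\<^sub>0 'k) \<Rightarrow>\<^sub>0 nat) \<Rightarrow> _))
    {P. keys P \<subseteq> {\<alpha>. keys \<alpha> \<subseteq> word_basis ` lyndon_cmps}} UNIV"
proof -
  let ?r = "inv_image (lenlex {(x, y). x < y}) factors :: ('d cmp \<times> 'd cmp) set"
  have "wf {(x :: 'd cmp, y). x < y}" by (rule wf)
  then have "wf ?r" by (rule wf_inv_image[OF wf_lenlex])
  moreover have "lookup (qsh_monomial \<alpha>) (lead_cmp \<alpha>) dvd 1 \<and>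
      (\<forall>b. lookup (qsh_monomial \<alpha>) b \<noteq> 0 \<longrightarrow> b = lead_cmp \<alpha> \<or> (b, lead_cmp \<alpha>) \<in> ?r)"
    if "keys \<alpha> \<subseteq> word_basis ` lyndon_cmps" for \<alpha> :: "('d cmp \<Rightarrow>\<^sub>0 'k) \<Rightarrow>\<^sub>0 nat"
  proof -
    let ?w = "concat (lyndon_words_of \<alpha>)"
    have char: "(of_nat n :: 'k) \<noteq> 0" if "n > 0" for n
      using unit[OF that] by auto
    have con: "\<forall>l\<in>set (lyndon_words_of \<alpha>). \<forall>v\<in>set l. cconnected v"
      using lyndon_words_of(1)[OF that] by (auto simp: lyndon_cmps_def)
    have "qsh_monomial \<alpha> = qsh_prod (map word_basis (lyndon_words_of \<alpha>))"
      unfolding qsh_monomial_def lyndon_words_of(3)[OF that, symmetric] by (rule qsh_mset_mset)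
    then have "leads (qsh_monomial \<alpha>) ?w"
      using leads_lyndon_list[OF char lyndon_words_of(2)[OF that] con] by simp
    then obtain f where f: "\<And>c. lookup (qsh_monomial \<alpha>) c = of_nat (f c)" "f (cdiag_list ?w) > 0"
      "\<And>c. f c > 0 \<Longrightarrow> word_le (factors c) ?w"
      unfolding leads_def by blast
    have "lookup (qsh_monomial \<alpha>) (lead_cmp \<alpha>) dvd 1"
      unfolding f(1) lead_cmp_def by (rule unit[OF f(2)])
    moreover have "b = lead_cmp \<alpha> \<or> (b, lead_cmp \<alpha>) \<in> ?r" if "lookup (qsh_monomial \<alpha>) b \<noteq> 0" for b
    proof -
      have "f b > 0" using that f(1)[of b] by (cases "f b") auto
      moreover have "factors (lead_cmp \<alpha>) = ?w"
        unfolding lead_cmp_def using con by (intro factors_cdiag_list) auto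
      ultimately have "factors b = factors (lead_cmp \<alpha>) \<or> (b, lead_cmp \<alpha>) \<in> ?r"
        using word_le_imp[OF f(3)] by simp
      then show ?thesis by (metis cdiag_list_factors)
    qed
    ultimately show ?thesis by blast
  qed
  ultimately show ?thesis
    by (intro bij_lin_if_triangular[where r = ?r and lead = lead_cmp] bij_lead_cmp) auto
qed

lemma free_qsh:
  assumes unit: "\<And>n. n > 0 \<Longrightarrow> (of_nat n :: 'k::idom) dvd 1"
  shows "free_fm_comm_algebra (qsh :: ('d::finite cmp \<Rightarrow>\<^sub>0 'k) \<Rightarrow> _) cunit"
  unfolding free_fm_comm_algebra_def
proof (intro exI conjI ballI allI)
  let ?X = "word_basis ` lyndon_cmps :: ('d cmp \<Rightarrow>\<^sub>0 'k) set"
  let ?\<phi> = "lin qsh_monomial :: ((('d cmp \<Rightarrow>\<^sub>0 'k) \<Rightarrow>\<^sub>0 nat) \<Rightarrow>\<^sub>0 'k) \<Rightarrow> _"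
  have "polys_in ?X = {P :: (('d cmp \<Rightarrow>\<^sub>0 'k) \<Rightarrow>\<^sub>0 nat) \<Rightarrow>\<^sub>0 'k. keys P \<subseteq> {\<alpha>. keys \<alpha> \<subseteq> ?X}}"
    by (auto simp: polys_in_def)
  then show "bij_betw ?\<phi> (polys_in ?X) UNIV" using bij_lin_qsh_monomial[OF unit] by simp
  show "?\<phi> (P + Q) = ?\<phi> P + ?\<phi> Q" "?\<phi> (scl c P) = scl c (?\<phi> P)" "?\<phi> (P * Q) = qsh (?\<phi> P) (?\<phi> Q)" for P Q c
    by (simp_all add: lin_add lin_scl lin_qsh_monomial_mult)
  show "?\<phi> 1 = cunit 1"
    by (simp add: cunit_1 qsh_monomial_def mset_of_0 flip: single_one)
  show "?\<phi> (poly_var x) = x" for x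
    by (simp add: poly_var_def qsh_monomial_def mset_of_single del: One_nat_def)
qed

theorem theorem2p11:
  fixes qscale :: "rat \<Rightarrow> 'k::idom \<Rightarrow> 'k"
  assumes "vector_space qscale"
    and "\<And>r x y. qscale r (x * y) = qscale r x * y"
  shows "graded_connected_commutative_fm_hopf_algebra
      (qsh :: ('d::finite cmp \<Rightarrow>\<^sub>0 'k) \<Rightarrow> ('d cmp \<Rightarrow>\<^sub>0 'k) \<Rightarrow> ('d cmp \<Rightarrow>\<^sub>0 'k))
      cunit deconc ccounit cgrade \<and>
    (\<forall>A :: ('d cmp \<Rightarrow>\<^sub>0 'k) \<Rightarrow> ('d cmp \<Rightarrow>\<^sub>0 'k).
      fm_antipode qsh cunit deconc ccounit A \<longleftrightarrow> antipode_formula A) \<and>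
    free_fm_comm_algebra
      (qsh :: ('d cmp \<Rightarrow>\<^sub>0 'k) \<Rightarrow> ('d cmp \<Rightarrow>\<^sub>0 'k) \<Rightarrow> ('d cmp \<Rightarrow>\<^sub>0 'k)) cunit"
proof (intro conjI allI)
  interpret vector_space qscale by fact
  have "(of_nat n :: 'k) dvd 1" if "n > 0" for n
  proof -
    \<comment> \<open>a positive integer \<open>n\<close> has the inverse \<open>qscale (1 / n) 1\<close>\<close>
    have q: "qscale (of_nat m) 1 = (of_nat m :: 'k)" for m
      by (induction m) (simp_all add: scale_left_distrib)
    have "qscale (1 / of_nat n) 1 * (of_nat n :: 'k) = qscale (1 / of_nat n) (qscale (of_nat n) 1)"
      by (simp add: q flip: assms(2))
    also have "\<dots> = 1" using that by simp
    finally show ?thesis by (metis dvd_triv_right)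
  qed
  then show "free_fm_comm_algebra (qsh :: ('d cmp \<Rightarrow>\<^sub>0 'k) \<Rightarrow> _) cunit" by (rule free_qsh)
qed (simp_all add: graded_connected_commutative_qsh fm_antipode_iff_formula)

end
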